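(* Let $T=z^4+p_2z^2+p_0$ and $Q=z^2+q_1z+q_0$ define the torus $\mathcal{T}$ and the quadric $\mathcal{Q}$ as in the context, and let $\mathcal{C}_{\mathbb{R}}=\mathcal{T}\cap\mathcal{Q}$. Let $(x_0,y_0)$ be a point on the cutcurve $\Pi_z(\mathcal{C}_{\mathbb{R}})$. If $q_1\not\equiv 0$, $q_1\nmid\mathbf{S}_0$, $q_1(x_0,y_0)=0$ and $\Delta_{\mathcal{T}}(x_0,y_0)=0$, then $(x_0,y_0,0)$ is a singular point of $\mathcal{C}_{\mathbb{R}}$ if and only if $(x_0,y_0)$ is a non-transversal intersection point of the plane curves defined by $\Delta_{\mathcal{T}}$ and $\Delta_{\mathcal{Q}}$.
   Context: Fix real numbers $0<r<R$. Put $p_2(x,y)=2(R^2-r^2+x^2+y^2)$, $p_0(x,y)=(R^2+2Rr+r^2-x^2-y^2)(R^2-2Rr+r^2-x^2-y^2)$, $T=z^4+p_2z^2+p_0\in\mathbb{R}[x,y,z]$, and $\mathcal{T}=\{T=0\}\subset\mathbb{R}^3$ (a ring torus). Let $q_1=ex+fy+i$ and $q_0=ax^2+by^2+dxy+gx+hy+j$ with real coefficients, $Q=z^2+q_1z+q_0$, and $\mathcal{Q}=\{Q=0\}\subset\mathbb{R}^3$. Standing assumption: the quadric is irreducible, i.e. neither the square of a plane nor the union of two planes. $\Pi_z(x,y,z)=(x,y)$; the cutcurve is the set $\Pi_z(\mathcal{C}_{\mathbb{R}})$. $\Delta_{\mathcal{T}}=p_0$ and $\Delta_{\mathcal{Q}}=q_1^2-4q_0$.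 $\widetilde{\mathbf{S}_0}\in\mathbb{R}[x,y]$ is the resultant of $T$ and $Q$ with respect to $z$, explicitly $\widetilde{\mathbf{S}_0}=(q_0q_1^2+p_2q_0-q_0^2-p_0)^2+q_1^2(q_1^2+p_2-2q_0)(p_0-q_0^2)$; $\widehat{\mathbf{S}_0}$ is its squarefree part; and $\mathbf{S}_0=\widehat{\mathbf{S}_0}/\gcd(\widehat{\mathbf{S}_0},\,p_2+q_1^2-2q_0)$. Two plane algebraic curves intersect transversally at a common point $P$ if $P$ is a regular point of both and their tangent lines at $P$ are different (equivalently, the Jacobian determinant of the defining polynomials does not vanish at $P$); a common point where this fails is a non-transversal intersection point. Singular points of $\mathcal{C}_{\mathbb{R}}$: let $I(\mathcal{C}_{\mathbb{R}})=\{F\in\mathbb{R}[x,y,z]: F|_{\mathcal{C}_{\mathbb{R}}}=0\}$. A point of $\mathcal{C}_{\mathbb{R}}$ is singular if the Jacobian matrix of a system of generators of $I(\mathcal{C}_{\mathbb{R}})$ has rank $0$ or $1$ at the point, and regular if the rank is $2$. Isolated points of $\mathcal{C}_{\mathbb{R}}$ (in the Euclidean topology) are regarded as singular. *)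

theory Defs
  imports
    "HOL-Analysis.Analysis"
    "HOL-Computational_Algebra.Field_as_Ring"
    "HOL-Computational_Algebra.Polynomial_Factorial"
    "Subresultants.Resultant_Prelim"
begin

section \<open>Polynomials in two and three variables\<close>

text \<open>
  The ring \<open>\<real>[x,y]\<close> is \<^typ>\<open>real poly poly\<close>, read as \<open>\<real>[x][y]\<close> (the outer variable is \<open>y\<close>),
  and \<open>\<real>[x,y,z]\<close> is \<^typ>\<open>real poly poly poly\<close>, read as \<open>\<real>[x,y][z]\<close> (the outer variable is \<open>z\<close>).
\<close>

definition const2 :: "real \<Rightarrow> real poly poly" where
  "const2 c = [:[:c:]:]"

definition X2 :: "real poly poly" where
  "X2 = [:[:0, 1:]:]"

definition Y2 :: "real poly poly" where
  "Y2 = [:0, 1:]"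

definition eval2 :: "real poly poly \<Rightarrow> real \<times> real \<Rightarrow> real" where
  "eval2 F = (\<lambda>(x, y). poly (poly F [:y:]) x)"

definition eval3 :: "real poly poly poly \<Rightarrow> real \<times> real \<times> real \<Rightarrow> real" where
  "eval3 F = (\<lambda>(x, y, z). eval2 (poly F [:[:z:]:]) (x, y))"

definition grad2 :: "real poly poly \<Rightarrow> real \<times> real \<Rightarrow> real \<times> real" where
  "grad2 F P = (eval2 (map_poly pderiv F) P, eval2 (pderiv F) P)"

definition grad3 :: "real poly poly poly \<Rightarrow> real \<times> real \<times> real \<Rightarrow> real \<times> real \<times> real" where
  "grad3 F P = (eval3 (map_poly (map_poly pderiv) F) P, eval3 (map_poly pderiv F) P, eval3 (pderiv F) P)"


section \<open>The torus, the quadric and their intersection\<close>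

definition torus_p2 :: "real \<Rightarrow> real \<Rightarrow> real poly poly" where
  "torus_p2 R r = const2 2 * (const2 (R\<^sup>2 - r\<^sup>2) + X2\<^sup>2 + Y2\<^sup>2)"

definition torus_p0 :: "real \<Rightarrow> real \<Rightarrow> real poly poly" where
  "torus_p0 R r = (const2 (R\<^sup>2 + 2 * R * r + r\<^sup>2) - X2\<^sup>2 - Y2\<^sup>2)
                * (const2 (R\<^sup>2 - 2 * R * r + r\<^sup>2) - X2\<^sup>2 - Y2\<^sup>2)"

definition torus_poly :: "real \<Rightarrow> real \<Rightarrow> real poly poly poly" where
  "torus_poly R r = [:torus_p0 R r, 0, torus_p2 R r, 0, 1:]"

definition lin2 :: "real \<Rightarrow> real \<Rightarrow> real \<Rightarrow> real poly poly" where
  "lin2 e f i = const2 e * X2 + const2 f * Y2 + const2 i"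

definition quad2 :: "real \<Rightarrow> real \<Rightarrow> real \<Rightarrow> real \<Rightarrow> real \<Rightarrow> real \<Rightarrow> real poly poly" where
  "quad2 a b d g h j = const2 a * X2\<^sup>2 + const2 b * Y2\<^sup>2 + const2 d * X2 * Y2
                     + const2 g * X2 + const2 h * Y2 + const2 j"

definition quadric_poly :: "real poly poly \<Rightarrow> real poly poly \<Rightarrow> real poly poly poly" where
  "quadric_poly q1 q0 = [:q0, q1, 1:]"

definition zero_set3 :: "real poly poly poly \<Rightarrow> (real \<times> real \<times> real) set" where
  "zero_set3 F = {P. eval3 F P = 0}"

definition curve :: "real \<Rightarrow> real \<Rightarrow> real poly poly \<Rightarrow> real poly poly \<Rightarrow> (real \<times> real \<times> real) set" where
  "curve R r q1 q0 = zero_set3 (torus_poly R r) \<inter> zero_set3 (quadric_poly q1 q0)"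

definition proj_z :: "real \<times> real \<times> real \<Rightarrow> real \<times> real" where
  "proj_z = (\<lambda>(x, y, z). (x, y))"

definition cutcurve :: "real \<Rightarrow> real \<Rightarrow> real poly poly \<Rightarrow> real poly poly \<Rightarrow> (real \<times> real) set" where
  "cutcurve R r q1 q0 = proj_z ` curve R r q1 q0"

definition disc_torus :: "real \<Rightarrow> real \<Rightarrow> real poly poly" where
  "disc_torus R r = torus_p0 R r"

definition disc_quadric :: "real poly poly \<Rightarrow> real poly poly \<Rightarrow> real poly poly" where
  "disc_quadric q1 q0 = q1\<^sup>2 - const2 4 * q0"


section \<open>The polynomial defining the projected curve\<close>

text \<open>
  Expanding the Sylvester determinant gives
  \<open>(q0 q1\<^sup>2 + p2 q0 - q0\<^sup>2 - p0)\<^sup>2 + q1\<^sup>2 (q1\<^sup>2 + p2 - 2 q0) (p0 - q0\<^sup>2)\<close>.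
\<close>

definition S0_tilde :: "real \<Rightarrow> real \<Rightarrow> real poly poly \<Rightarrow> real poly poly \<Rightarrow> real poly poly" where
  "S0_tilde R r q1 q0 = resultant (torus_poly R r) (quadric_poly q1 q0)"

text \<open>
  The squarefree part is the product of the distinct prime factors, determined up to a unit. It is not
  the constant \<open>squarefree_part\<close> of \<open>HOL-Computational_Algebra.Squarefree\<close>, which retains only the
  primes of odd multiplicity.
\<close>

definition sqfree_part :: "real poly poly \<Rightarrow> real poly poly" where
  "sqfree_part F = \<Prod>(prime_factors F)"

definition S0 :: "real \<Rightarrow> real \<Rightarrow> real poly poly \<Rightarrow> real poly poly \<Rightarrow> real poly poly" where
  "S0 R r q1 q0 =
     (let S = sqfree_part (S0_tilde R r q1 q0)
      in S div gcd S (torus_p2 R r + q1\<^sup>2 - const2 2 * q0))"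


section \<open>Transversality of plane curves\<close>

definition regular_point2 :: "real poly poly \<Rightarrow> real \<times> real \<Rightarrow> bool" where
  "regular_point2 F P \<longleftrightarrow> eval2 F P = 0 \<and> grad2 F P \<noteq> 0"

definition tangent_line2 :: "real poly poly \<Rightarrow> real \<times> real \<Rightarrow> (real \<times> real) set" where
  "tangent_line2 F P = {V. inner (grad2 F P) (V - P) = 0}"

definition transversal_at :: "real poly poly \<Rightarrow> real poly poly \<Rightarrow> real \<times> real \<Rightarrow> bool" where
  "transversal_at F G P \<longleftrightarrow> regular_point2 F P \<and> regular_point2 G P
     \<and> tangent_line2 F P \<noteq> tangent_line2 G P"

definition nontransversal_intersection :: "real poly poly \<Rightarrow> real poly poly \<Rightarrow> real \<times> real \<Rightarrow> bool" where
  "nontransversal_intersection F G P \<longleftrightarrow> eval2 F P = 0 \<and> eval2 G P = 0 \<and> \<not> transversal_at F G P"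


section \<open>Singular points of a space curve\<close>

definition vanishing_ideal :: "(real \<times> real \<times> real) set \<Rightarrow> real poly poly poly set" where
  "vanishing_ideal C = {F. \<forall>P\<in>C. eval3 F P = 0}"

definition generates :: "real poly poly poly set \<Rightarrow> real poly poly poly set \<Rightarrow> bool" where
  "generates G I \<longleftrightarrow> finite G \<and> I = {\<Sum>F\<in>G. c F * F | c. True}"

text \<open>
  The rank of the Jacobian matrix of the finite system \<open>G\<close> at \<open>P\<close>, whose rows are the gradients of the
  members of \<open>G\<close>. As the number of rows is not fixed, this is the definition of \<^const>\<open>rank\<close>
  (dimension of the set of rows) written out.
\<close>

definition jacobian_rank :: "real poly poly poly set \<Rightarrow> real \<times> real \<times> real \<Rightarrow> nat" where
  "jacobian_rank G P = dim ((\<lambda>F. grad3 F P) ` G)"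

text \<open>
  The rank does not depend on the chosen finite system of generators. Isolated points are singular by
  convention (if \<open>P\<close> is also isolated in the Zariski topology, the rank there is 3).
\<close>

definition singular_point :: "(real \<times> real \<times> real) set \<Rightarrow> real \<times> real \<times> real \<Rightarrow> bool" where
  "singular_point C P \<longleftrightarrow> P \<in> C \<and>
     (P isolated_in C \<or> (\<exists>G. generates G (vanishing_ideal C) \<and> jacobian_rank G P \<le> 1))"

end

(*
  The torus is parametrised near P = (x0, y0, 0) by half-angle coordinates (s, t), of which P is the
  origin; with these the quadric pulls back to a polynomial H of bidegree at most (4, 4), and every
  polynomial F vanishing on the curve pulls back to a polynomial vanishing on the real zeros of H.

  If the two plane curves meet transversally, the gradients of T and Q at P are independent, and
  (x, y, z) -> (T, Q, z) is open at P, so that P is not isolated.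

  If they do not, H is singular at the origin.  Suppose that P is not isolated and that some such F
  has a gradient at P that is not parallel to (x0, y0, 0).  A prime factor u of H whose real zeros
  accumulate at the origin then divides F, so it is smooth there, and H / u vanishes at the origin.
  A prime factor of H / u vanishing there either is u again, i.e. the quadric touches the torus along
  a curve, or has only finitely many real zeros.  Both are impossible for an irreducible quadric with
  q1 nonzero.  The decisive tool is the value t = i m at which the distance to the axis of rotation
  vanishes: there H is a constant multiple of (1 + s^2)^2, which determines how its factors look.
*)

theory Submission
  imports Defs
begin

section \<open>Evaluation of plane polynomials\<close>

text \<open>The ideal of the real curve can be larger than the ideal generated by T and Q:
  multiplicities, and complex branches with isolated real points, leave no trace in the real zero
  set. A tangency of the surfaces can then be invisible to the Jacobian. The sphere x^2 + y^2 + z^2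
  = (R + r)^2, which has q1 = 0, touches the torus along the outer equator and meets it nowhere
  else, and this circle is regular. Hence the need to control the factors of H. The exceptional
  value of t comes from the complex torus. Let A, B be the radii R + r, R - r in either order and m
  = sqrt (A / B). The line t = i m is contracted to a double point (0, 0, z), z^2 = - A B, on the
  axis. Unless the quadric passes through it, a factor of H restricts to this line as c (s - i)^x (s
  + i)^y, and for a real factor the real and imaginary parts of this expression constrain the
  coefficients. The lines t = m s and t = - m s are the two Villarceau circles through P. They
  restrict to multiples of s - i and s + i, which is why these circles appear as the exceptional
  cases.\<close>

lemma eval2_simps [simp]:
  "eval2 0 P = 0" "eval2 1 P = 1"
  "eval2 (F + G) P = eval2 F P + eval2 G P"
  "eval2 (F - G) P = eval2 F P - eval2 G P"
  "eval2 (- F) P = - eval2 F P"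
  "eval2 (F * G) P = eval2 F P * eval2 G P"
  "eval2 (F ^ k) P = eval2 F P ^ k"
  "eval2 (const2 c) P = c"
  by (auto simp: eval2_def const2_def poly_power split: prod.splits)

lemma eval2_X2 [simp]: "eval2 X2 (x, y) = x"
  and eval2_Y2 [simp]: "eval2 Y2 (x, y) = y"
  by (auto simp: eval2_def X2_def Y2_def)

lemma eval2_pCons: "eval2 (pCons p F) (x, y) = poly p x + y * eval2 F (x, y)"
  by (simp add: eval2_def)

lemma eval2_smult [simp]: "eval2 (Polynomial.smult p F) (x, y) = poly p x * eval2 F (x, y)"
  by (simp add: eval2_def)

lemma eval2_conv_poly: "eval2 F (x, y) = poly (map_poly (\<lambda>p. poly p x) F) y"
  by (induction F) (auto simp: eval2_pCons map_poly_pCons)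

lemma eval2_eqI:
  assumes "\<And>x y. eval2 F (x, y) = eval2 G (x, y)"
  shows "F = G"
proof (rule poly_eqI)
  fix n
  have "poly (coeff F n) x = poly (coeff G n) x" for x
  proof -
    have "map_poly (\<lambda>p. poly p x) F = map_poly (\<lambda>p. poly p x) G"
      using assms by (simp add: eval2_conv_poly poly_eq_poly_eq_iff[symmetric] fun_eq_iff)
    then have "coeff (map_poly (\<lambda>p. poly p x) F) n = coeff (map_poly (\<lambda>p. poly p x) G) n"
      by simp
    then show ?thesis by (simp add: coeff_map_poly)
  qed
  then show "coeff F n = coeff G n"
    by (simp add: poly_eq_poly_eq_iff[symmetric] fun_eq_iff)
qed

text \<open>Degree and fibre arguments are natural in the outer variable y; exchanging the variables
  makes them available for x.\<close>

definition swap2 :: "real poly poly \<Rightarrow> real poly poly" where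
  "swap2 F = poly (map_poly (map_poly (\<lambda>c. [:c:])) F) [:[:0, 1:]:]"

lemma swap2_pCons: "swap2 (pCons p F) = map_poly (\<lambda>c. [:c:]) p + [:[:0, 1:]:] * swap2 F"
  unfolding swap2_def by (subst Polynomial.map_poly_pCons) simp_all

lemma coeff_swap2: "coeff (coeff (swap2 F) i) j = coeff (coeff F j) i"
proof (induction F arbitrary: j)
  case 0
  then show ?case by (simp add: swap2_def)
next
  case (pCons p F)
  then show ?case
    by (cases j) (auto simp: swap2_pCons coeff_map_poly)
qed

lemma eval2_swap2: "eval2 (swap2 F) (y, x) = eval2 F (x, y)"
proof (induction F)
  case 0
  then show ?case by (simp add: swap2_def)
next
  case (pCons p F)
  have "eval2 (map_poly (\<lambda>c. [:c:]) p) (y, x) = poly p x"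
    by (induction p) (auto simp: map_poly_pCons eval2_pCons)
  with pCons show ?case
    by (simp add: swap2_pCons eval2_pCons algebra_simps)
qed

lemma swap2_mult: "swap2 (F * G) = swap2 F * swap2 G"
  by (rule eval2_eqI) (simp add: eval2_swap2)

lemma swap2_eq_0_iff [simp]: "swap2 F = 0 \<longleftrightarrow> F = 0"
proof
  assume "swap2 F = 0"
  then show "F = 0" by (intro eval2_eqI) (metis eval2_simps(1) eval2_swap2)
qed (simp add: swap2_def)

lemma degree_swap2_le:
  assumes "\<And>j. degree (coeff F j) \<le> d"
  shows "degree (swap2 F) \<le> d"
proof (rule degree_le, intro allI impI)
  fix i assume "d < i"
  then show "coeff (swap2 F) i = 0"
    using assms by (intro poly_eqI) (metis coeff_0 coeff_eq_0 coeff_swap2 le_less_trans)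
qed

lemma degree_coeff_le_swap2: "degree (coeff F j) \<le> degree (swap2 F)"
  by (rule degree_le) (metis coeff_0 coeff_eq_0 coeff_swap2)

section \<open>Zeros of real plane polynomials\<close>

lemma odd_degree_real_root:
  fixes p :: "real poly"
  assumes "odd (degree p)"
  shows "\<exists>x. poly p x = 0"
proof -
  have pos: "\<exists>x. poly p x > 0" if "lead_coeff p > 0" for p :: "real poly"
    using poly_pinfty_gt_lc[OF that] that by (meson less_le_trans order_refl)
  have *: "\<exists>x. poly p x = 0" if odd: "odd (degree p)" and lc: "lead_coeff p > 0" for p :: "real poly"
  proof -
    obtain x where x: "poly p x > 0" using pos[OF lc] by blast
    define q where "q = - pcompose p [:0, -1:]"
    have "lead_coeff q > 0"
      using lead_coeff_comp[of "[:0, -1::real:]" p] lc odd by (simp add: q_def)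
    then obtain y where "poly q y > 0" using pos by blast
    then have y: "poly p (- y) < 0" by (simp add: q_def poly_pcompose)
    show ?thesis
      using poly_IVT_pos[of x "- y" p] poly_IVT_neg[of x "- y" p]
        poly_IVT_pos[of "- y" x p] poly_IVT_neg[of "- y" x p] x y
      by (metis linorder_less_linear order_less_irrefl order_less_trans)
  qed
  show ?thesis
  proof (cases "lead_coeff p > 0")
    case True
    then show ?thesis using * assms by blast
  next
    case False
    then have "lead_coeff (- p) > 0" using assms by (cases "p = 0") (auto simp: less_le)
    then show ?thesis using *[of "- p"] assms by simp
  qed
qed

lemma infinite_nonroots:
  fixes p :: "real poly"
  assumes "p \<noteq> 0"
  shows "infinite {x. poly p x \<noteq> 0}"
proof
  assume "finite {x. poly p x \<noteq> 0}"
  then have "finite ({x. poly p x \<noteq> 0} \<union> {x. poly p x = 0})"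
    using poly_roots_finite[OF assms] by simp
  moreover have "{x. poly p x \<noteq> 0} \<union> {x. poly p x = 0} = UNIV" by auto
  ultimately show False using infinite_UNIV_char_0[where 'a = real] by metis
qed

lemma infinite_zeros_if_fibres:
  assumes "infinite S" and "\<And>x. x \<in> S \<Longrightarrow> \<exists>y. eval2 F (x, y) = 0"
  shows "infinite {P. eval2 F P = 0}"
proof
  assume "finite {P. eval2 F P = 0}"
  then have "finite (fst ` {P. eval2 F P = 0})" by simp
  moreover have "S \<subseteq> fst ` {P. eval2 F P = 0}"
    using assms(2) by (force simp: image_iff)
  ultimately show False using assms(1) finite_subset by blast
qed

text \<open>A real polynomial of odd degree in one variable has a root, so an odd degree in y would
  give a zero over every x off the roots of the leading coefficient.\<close>

lemma finite_zeros_even_degree: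
  assumes "finite {P. eval2 F P = 0}"
  shows "even (degree F)"
proof (rule ccontr)
  assume odd: "odd (degree F)"
  then have "lead_coeff F \<noteq> 0" by auto
  have "\<exists>y. eval2 F (x, y) = 0" if "poly (lead_coeff F) x \<noteq> 0" for x
  proof -
    have "degree (map_poly (\<lambda>p. poly p x) F) = degree F"
      using that by (intro map_poly_degree_eq) simp
    then show ?thesis
      using odd_degree_real_root[of "map_poly (\<lambda>p. poly p x) F"] odd by (simp add: eval2_conv_poly)
  qed
  then show False
    using infinite_zeros_if_fibres[OF infinite_nonroots[OF \<open>lead_coeff F \<noteq> 0\<close>], of F] assms by blast
qed

lemma finite_zeros_degree_pos:
  assumes "finite {P. eval2 F P = 0}" and "eval2 F (0, 0) = 0"
  shows "degree F \<noteq> 0"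
proof
  assume "degree F = 0"
  then obtain p where F: "F = [:p:]" by (meson degree_eq_zeroE)
  then have "range (\<lambda>y::real. (0::real, y)) \<subseteq> {P. eval2 F P = 0}"
    using assms(2) by (auto simp: eval2_pCons)
  then have "finite (range (\<lambda>y::real. (0::real, y)))" using assms(1) finite_subset by blast
  then show False using infinite_UNIV_char_0[where 'a = real] by (auto dest!: finite_imageD simp: inj_on_def)
qed

text \<open>A nonzero y-derivative at a zero yields a change of sign on a short vertical segment.
  The change persists on neighbouring vertical lines, and the intermediate value theorem gives a
  zero on each. Together with the version for x, such a polynomial has order at least 2 at the
  origin.\<close>

lemma finite_zeros_partial_y:
  assumes fin: "finite {P. eval2 F P = 0}" and "eval2 F (0, 0) = 0"
  shows "coeff (coeff F 1) 0 = 0"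
proof (rule ccontr)
  have pos: False if fin: "finite {P. eval2 F P = 0}" and z: "eval2 F (0, 0) = 0"
    and lc: "coeff (coeff F 1) 0 > 0" for F
  proof -
    let ?f = "\<lambda>x y. eval2 F (x, y)"
    have "((\<lambda>y. ?f 0 y) has_real_derivative coeff (coeff F 1) 0) (at 0)"
    proof -
      have "(poly (map_poly (\<lambda>p. poly p 0) F) has_real_derivative
        poly (pderiv (map_poly (\<lambda>p. poly p 0) F)) 0) (at 0)"
        by (rule poly_DERIV)
      moreover have "poly (pderiv (map_poly (\<lambda>p. poly p 0) F)) 0 = coeff (coeff F 1) 0"
        by (simp add: poly_0_coeff_0 coeff_pderiv coeff_map_poly)
      ultimately show ?thesis by (simp add: eval2_conv_poly[abs_def])
    qed
    from DERIV_pos_inc_right[OF this lc] DERIV_pos_inc_left[OF this lc]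
    obtain d where d: "d > 0" "?f 0 d > 0" "?f 0 (- d) < 0"
    proof -
      obtain d1 where d1: "d1 > 0" "\<And>h. 0 < h \<Longrightarrow> h < d1 \<Longrightarrow> ?f 0 0 < ?f 0 (0 + h)"
        using DERIV_pos_inc_right[OF \<open>((\<lambda>y. ?f 0 y) has_real_derivative _) (at 0)\<close> lc] by auto
      obtain d2 where d2: "d2 > 0" "\<And>h. 0 < h \<Longrightarrow> h < d2 \<Longrightarrow> ?f 0 (0 - h) < ?f 0 0"
        using DERIV_pos_inc_left[OF \<open>((\<lambda>y. ?f 0 y) has_real_derivative _) (at 0)\<close> lc] by auto
      show thesis
        using that[of "min d1 d2 / 2"] d1 d2 z by auto
    qed
    have cont: "isCont (\<lambda>x. ?f x y) x" for x y
      by (simp add: eval2_def)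
    have "eventually (\<lambda>x. ?f x d > 0) (at 0)"
      using cont[of 0 d] d(2) by (simp add: isCont_def order_tendstoD)
    moreover have "eventually (\<lambda>x. ?f x (- d) < 0) (at 0)"
      using cont[of 0 "- d"] d(3) by (simp add: isCont_def order_tendstoD)
    ultimately have "eventually (\<lambda>x. ?f x d > 0 \<and> ?f x (- d) < 0) (at 0)"
      by eventually_elim simp
    then obtain e where e: "e > 0" "\<And>x. x \<noteq> 0 \<Longrightarrow> \<bar>x\<bar> < e \<Longrightarrow> ?f x d > 0 \<and> ?f x (- d) < 0"
      by (auto simp: eventually_at)
    have "\<exists>y. ?f x y = 0" if "x \<in> {0<..<e}" for x
    proof -
      have "?f x d > 0" "?f x (- d) < 0" using e(2)[of x] that by auto
      then show ?thesis
        using poly_IVT_pos[of "- d" d "map_poly (\<lambda>p. poly p x) F"] d(1)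
        by (auto simp: eval2_conv_poly)
    qed
    then show False
      using infinite_zeros_if_fibres[of "{0<..<e}" F] fin e(1) infinite_Ioo by blast
  qed
  assume "coeff (coeff F 1) 0 \<noteq> 0"
  then show False
    using pos[of F] pos[of "- F"] assms by (cases "coeff (coeff F 1) 0 > 0") auto
qed

lemma finite_zeros_swap2:
  assumes "finite {P. eval2 F P = 0}"
  shows "finite {P. eval2 (swap2 F) P = 0}"
proof -
  have "{P. eval2 (swap2 F) P = 0} = prod.swap ` {P. eval2 F P = 0}"
    by (auto simp: eval2_swap2 image_iff) 
  with assms show ?thesis by simp
qed

lemma finite_zeros_partial_x:
  assumes fin: "finite {P. eval2 F P = 0}" and "eval2 F (0, 0) = 0"
  shows "coeff (coeff F 0) 1 = 0"
  using finite_zeros_partial_y[OF finite_zeros_swap2[OF fin]] assms(2)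
  by (simp add: eval2_swap2 coeff_swap2)

section \<open>Common zeros of plane polynomials, and their prime factors\<close>

lemma prime_linear_combination:
  fixes h F :: "real poly poly"
  assumes h: "prime_elem h" "degree h > 0" and nd: "\<not> h dvd F"
  shows "\<exists>u v d. d \<noteq> 0 \<and> u * h + v * F = [:d:]"
proof -
  define I where "I = {u * h + v * F | u v. True}"
  have comb: "a * x + b * y \<in> I" if xy: "x \<in> I" "y \<in> I" for a b x y
  proof -
    obtain u v u' v' where "x = u * h + v * F" "y = u' * h + v' * F"
      using xy unfolding I_def by blast
    then have "a * x + b * y = (a * u + b * u') * h + (a * v + b * v') * F"
      by (simp add: algebra_simps)
    then show ?thesis unfolding I_def by blast
  qed
  have "1 * h + 0 * F \<in> I" "0 * h + 1 * F \<in> I"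
    unfolding I_def by blast+
  then have hI: "h \<in> I" and FI: "F \<in> I" by auto
  have "h \<noteq> 0" using h by auto
  \<comment> \<open>By pseudo-division, a nonzero element of least outer degree in the ideal of
    \<open>h\<close> and \<open>F\<close> divides both, up to factors from the coefficient ring.
    Primality of \<open>h\<close> then leaves only degree 0 for it.\<close>
  define G where "G = arg_min degree (\<lambda>G. G \<in> I \<and> G \<noteq> 0)"
  have G: "G \<in> I" "G \<noteq> 0" and min: "\<And>x. x \<in> I \<Longrightarrow> x \<noteq> 0 \<Longrightarrow> degree G \<le> degree x"
    using arg_min_nat_lemma[of "\<lambda>G. G \<in> I \<and> G \<noteq> 0" h degree] hI \<open>h \<noteq> 0\<close> by (auto simp: G_def)
  have div: "\<exists>c q. c \<noteq> 0 \<and> Polynomial.smult c x = G * q" if "x \<in> I" for x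
  proof -
    obtain c q where cq: "c \<noteq> 0" "Polynomial.smult c x = G * q + pseudo_mod x G"
      using pseudo_mod(1)[OF G(2)] by blast
    then have "pseudo_mod x G = [:c:] * x + (- q) * G" by (simp add: algebra_simps)
    then have "pseudo_mod x G \<in> I" using comb[OF that G(1), of "[:c:]" "- q"] by simp
    then have "pseudo_mod x G = 0"
      using min pseudo_mod(2)[OF G(2), of x] by fastforce
    with cq show ?thesis by auto
  qed
  have "degree G = 0"
  proof (rule ccontr)
    assume dG: "degree G \<noteq> 0"
    obtain c q where cq: "c \<noteq> 0" "Polynomial.smult c h = G * q" using div[OF hI] by blast
    then have "h dvd G * q" by (metis dvd_refl dvd_smult)
    then consider "h dvd G" | "h dvd q" using h(1) by (meson prime_elem_dvd_multD)
    then show False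
    proof cases
      case 1
      obtain c' q' where cq': "c' \<noteq> 0" "Polynomial.smult c' F = G * q'" using div[OF FI] by blast
      then have "h dvd [:c':] * F" using 1 by simp
      then have "h dvd [:c':]" using h(1) nd by (meson prime_elem_dvd_multD)
      then have "degree h \<le> 0" using cq'(1) by (metis degree_pCons_0 dvd_imp_degree_le pCons_eq_0_iff)
      then show False using h(2) by simp
    next
      case 2
      then obtain s where "q = h * s" by blast
      with cq have "h * [:c:] = h * (G * s)" by (simp add: ac_simps)
      then have "[:c:] = G * s" using \<open>h \<noteq> 0\<close> by (metis mult_left_cancel)
      moreover from this have "s \<noteq> 0" using cq(1) by auto
      ultimately have "degree [:c:] = degree G + degree s" using G(2) by (metis degree_mult_eq)
      then show False using dG by simp
    qed
  qed
  then obtain d where "G = [:d:]" by (meson degree_eq_zeroE)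
  with G show ?thesis by (auto simp: I_def) (metis pCons_0_0)
qed

lemma fibre_zero_dvd:
  assumes "\<And>y. eval2 F (x, y) = 0"
  shows "[:[:- x, 1:]:] dvd F"
proof -
  have "map_poly (\<lambda>p. poly p x) F = 0"
    using assms poly_all_0_iff_0[of "map_poly (\<lambda>p. poly p x) F"] by (simp add: eval2_conv_poly)
  then have "poly (coeff F n) x = 0" for n
    by (metis coeff_0 coeff_map_poly poly_0)
  then show ?thesis
    by (simp add: const_poly_dvd_iff poly_eq_0_iff_dvd)
qed

text \<open>Elimination leaves finitely many abscissae. An infinite fibre over one of them would put
  a vertical line into both curves, so the prime \<open>h\<close> would be that line and divide
  \<open>F\<close>.\<close>

lemma finite_common_zeros:
  assumes h: "prime_elem h" and nd: "\<not> h dvd F"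
  shows "finite {P. eval2 h P = 0 \<and> eval2 F P = 0}"
proof -
  have "\<exists>d. d \<noteq> 0 \<and> (\<forall>P. eval2 h P = 0 \<and> eval2 F P = 0 \<longrightarrow> poly d (fst P) = 0)"
  proof (cases "degree h = 0")
    case True
    then obtain d where "h = [:d:]" by (meson degree_eq_zeroE)
    moreover from this have "d \<noteq> 0" using h by auto
    ultimately show ?thesis by (auto simp: eval2_pCons)
  next
    case False
    then obtain u v d where d: "d \<noteq> 0" "u * h + v * F = [:d:]"
      using prime_linear_combination[OF h _ nd] by auto
    have "poly d x = 0" if "eval2 h (x, y) = 0" "eval2 F (x, y) = 0" for x y
      using arg_cong[OF d(2), of "\<lambda>G. eval2 G (x, y)"] that by (simp add: eval2_pCons)
    with d(1) show ?thesis by auto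
  qed
  then obtain d where d: "d \<noteq> 0" "\<And>P. eval2 h P = 0 \<Longrightarrow> eval2 F P = 0 \<Longrightarrow> poly d (fst P) = 0"
    by blast
  have fibre: "finite {y. eval2 h (x, y) = 0 \<and> eval2 F (x, y) = 0}" for x
  proof (rule ccontr)
    assume inf: "infinite {y. eval2 h (x, y) = 0 \<and> eval2 F (x, y) = 0}"
    have "eval2 G (x, y) = 0" if "infinite {y. eval2 G (x, y) = 0}" for G y
      using that poly_roots_finite[of "map_poly (\<lambda>p. poly p x) G"]
      by (cases "map_poly (\<lambda>p. poly p x) G = 0") (auto simp: eval2_conv_poly)
    moreover have "infinite {y. eval2 h (x, y) = 0}" "infinite {y. eval2 F (x, y) = 0}"
      using inf by (auto elim!: infinite_super[rotated])
    ultimately have l: "[:[:- x, 1:]:] dvd h" "[:[:- x, 1:]:] dvd F"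
      by (auto intro!: fibre_zero_dvd)
    have "\<not> [:[:- x, 1:]:] dvd 1"
      by (auto simp: is_unit_poly_iff)
    then have "h dvd [:[:- x, 1:]:]"
      using l(1) h by (metis irreducibleD' prime_elem_imp_irreducible)
    then show False using l(2) nd dvd_trans by blast
  qed
  have "{P. eval2 h P = 0 \<and> eval2 F P = 0} \<subseteq>
      (SIGMA x:{x. poly d x = 0}. {y. eval2 h (x, y) = 0 \<and> eval2 F (x, y) = 0})"
    using d(2) by auto
  then show ?thesis
    using fibre poly_roots_finite[OF d(1)] by (meson finite_SigmaI finite_subset)
qed

lemma islimpt_zeros_mult:
  assumes "(0, 0) islimpt {P. eval2 (F * G) P = 0}"
  shows "(0, 0) islimpt {P. eval2 F P = 0} \<or> (0, 0) islimpt {P. eval2 G P = 0}"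
proof -
  have "{P. eval2 (F * G) P = 0} = {P. eval2 F P = 0} \<union> {P. eval2 G P = 0}" by auto
  then show ?thesis using assms by (simp add: islimpt_Un)
qed

lemma unit_eval2: "is_unit F \<Longrightarrow> eval2 F P \<noteq> 0"
  by (metis dvd_def eval2_simps(2,6) mult_zero_left zero_neq_one)

lemma prime_factor_islimpt:
  assumes "F \<noteq> 0" and "(0, 0) islimpt {P. eval2 F P = 0}"
  shows "\<exists>p. prime_elem p \<and> p dvd F \<and> (0, 0) islimpt {P. eval2 p P = 0}"
  using assms
proof (induction F rule: prime_divisors_induct)
  case (factor p F)
  then show ?case
    by (metis dvd_mult dvd_triv_left islimpt_zeros_mult mult_zero_right prime_imp_prime_elem)
qed (auto simp: unit_eval2)

lemma prime_factor_zero: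
  assumes "F \<noteq> 0" and "eval2 F P = 0"
  shows "\<exists>p. prime_elem p \<and> p dvd F \<and> eval2 p P = 0"
  using assms
proof (induction F rule: prime_divisors_induct)
  case (factor p F)
  then show ?case
    by (metis dvd_mult dvd_triv_left eval2_simps(6) mult_eq_0_iff prime_imp_prime_elem)
qed (auto simp: unit_eval2)

section \<open>Finite generation of ideals\<close>

text \<open>A ring as a module over itself: \<open>subspace\<close> means ideal and
  \<open>span\<close> the generated ideal. Since \<open>singular_point\<close> asks for a finite
  system of generators, finite generation has to be proved.\<close>

interpretation ring_ideal: Modules.module "(*) :: 'a::comm_ring_1 \<Rightarrow> 'a \<Rightarrow> 'a"
  by standard (simp_all add: algebra_simps)

declare ring_ideal.scale_scale [simp del] \<comment> \<open>loops with \<open>mult.assoc\<close>\<close>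

text \<open>Coefficients are attached to indices and not to values, so that repetitions in the
  sequence do no harm.\<close>

lemma ideal_span_image_lessThan:
  assumes "x \<in> ring_ideal.span (a ` {..<n::nat})"
  shows "\<exists>u. x = (\<Sum>k<n. u k * a k)"
proof -
  let ?S = "{\<Sum>k<n. u k * a k | u. True}"
  have "ring_ideal.subspace ?S"
  proof (rule ring_ideal.subspaceI)
    show "0 \<in> ?S" by (intro CollectI exI[of _ "\<lambda>_. 0"]) simp
  next
    fix x y assume "x \<in> ?S" "y \<in> ?S"
    then obtain u v where "x = (\<Sum>k<n. u k * a k)" "y = (\<Sum>k<n. v k * a k)" by blast
    then have "x + y = (\<Sum>k<n. (\<lambda>k. u k + v k) k * a k)"
      by (simp add: algebra_simps sum.distrib)
    then show "x + y \<in> ?S" by (intro CollectI exI[of _ "\<lambda>k. u k + v k"]) simp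
  next
    fix c x assume "x \<in> ?S"
    then obtain u where "x = (\<Sum>k<n. u k * a k)" by blast
    then have "c * x = (\<Sum>k<n. (\<lambda>k. c * u k) k * a k)"
      by (simp add: sum_distrib_left mult.assoc)
    then show "c * x \<in> ?S" by (intro CollectI exI[of _ "\<lambda>k. c * u k"]) simp
  qed
  moreover have "a i \<in> ?S" if "i < n" for i
  proof -
    have "a i = (\<Sum>k<n. (\<lambda>k. if k = i then 1 else 0) k * a k)"
      using that by (simp add: if_distrib[of "\<lambda>c. c * _"] cong: if_cong)
    then show ?thesis by (intro CollectI exI[of _ "\<lambda>k. if k = i then 1 else 0"]) simp
  qed
  ultimately have "ring_ideal.span (a ` {..<n}) \<subseteq> ?S"
    by (intro ring_ideal.span_minimal) auto
  then show ?thesis using assms by blast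
qed

lemma noetherian_stationary:
  fixes a :: "nat \<Rightarrow> 'a::comm_ring_1"
  assumes "\<And>I :: 'a set. ring_ideal.subspace I \<Longrightarrow> \<exists>G. finite G \<and> ring_ideal.span G = I"
  shows "\<exists>n. a n \<in> ring_ideal.span (a ` {..<n})"
proof -
  obtain B where B: "finite B" "ring_ideal.span B = ring_ideal.span (range a)"
    using assms[OF ring_ideal.subspace_span] by blast
  have "\<exists>n. b \<in> ring_ideal.span (a ` {..<n})" if "b \<in> B" for b
  proof -
    have "b \<in> ring_ideal.span (range a)" using B(2) that ring_ideal.span_base by blast
    then obtain t c where t: "finite t" "t \<subseteq> range a" "b = (\<Sum>x\<in>t. c x * x)"
      unfolding ring_ideal.span_explicit by blast
    then obtain K where K: "finite K" "t = a ` K" by (meson finite_subset_image)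
    then obtain n where "K \<subseteq> {..<n}" by (metis finite_nat_iff_bounded)
    then have "t \<subseteq> a ` {..<n}" using K by blast
    then have "b \<in> ring_ideal.span (a ` {..<n})"
      unfolding t(3) by (intro ring_ideal.span_sum ring_ideal.span_scale ring_ideal.span_base) auto
    then show ?thesis by blast
  qed
  then obtain n where n: "\<And>b. b \<in> B \<Longrightarrow> b \<in> ring_ideal.span (a ` {..<n b})" by metis
  define N where "N = Max (insert 0 (n ` B))"
  have "n b \<le> N" if "b \<in> B" for b using B(1) that by (auto simp: N_def)
  then have "B \<subseteq> ring_ideal.span (a ` {..<N})"
    using n ring_ideal.span_mono[OF image_mono, of "{..<n _}" "{..<N}" a] by fastforce
  then have "ring_ideal.span (range a) \<subseteq> ring_ideal.span (a ` {..<N})"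
    unfolding B(2)[symmetric] by (intro ring_ideal.span_minimal ring_ideal.subspace_span)
  moreover have "a N \<in> ring_ideal.span (range a)" by (rule ring_ideal.span_base) simp
  ultimately show ?thesis by blast
qed

text \<open>Hilbert's argument: pick successively elements of least degree outside the ideal
  generated so far. Once a leading coefficient is a combination of the earlier ones, subtracting
  shifted multiples lowers the degree, against the choice.\<close>

theorem hilbert_basis:
  fixes J :: "'a::comm_ring_1 poly set"
  assumes noeth: "\<And>I :: 'a set. ring_ideal.subspace I \<Longrightarrow> \<exists>G. finite G \<and> ring_ideal.span G = I"
    and J: "ring_ideal.subspace J"
  shows "\<exists>G. finite G \<and> ring_ideal.span G = J"
proof (rule ccontr)
  assume no: "\<not> ?thesis"
  define nxt where "nxt G = arg_min degree (\<lambda>f. f \<in> J \<and> f \<notin> ring_ideal.span G)" for G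
  have nxt: "nxt G \<in> J" "nxt G \<notin> ring_ideal.span G"
      "\<And>f. f \<in> J \<Longrightarrow> f \<notin> ring_ideal.span G \<Longrightarrow> degree (nxt G) \<le> degree f"
    if G: "finite G" "G \<subseteq> J" for G
  proof -
    have "ring_ideal.span G \<subseteq> J" using G(2) J by (rule ring_ideal.span_minimal)
    then obtain f where "f \<in> J" "f \<notin> ring_ideal.span G" using no G(1) by blast
    then have *: "f \<in> J \<and> f \<notin> ring_ideal.span G" by simp
    show "nxt G \<in> J" "nxt G \<notin> ring_ideal.span G"
      "\<And>f. f \<in> J \<Longrightarrow> f \<notin> ring_ideal.span G \<Longrightarrow> degree (nxt G) \<le> degree f"
      using arg_min_nat_lemma[of "\<lambda>f. f \<in> J \<and> f \<notin> ring_ideal.span G" f degree, OF *]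
      by (auto simp: nxt_def)
  qed
  define S where "S = rec_nat {} (\<lambda>_ G. insert (nxt G) G)"
  define f where "f n = nxt (S n)" for n
  have S_simps: "S 0 = {}" "S (Suc n) = insert (f n) (S n)" for n
    by (simp_all add: S_def f_def)
  have S: "S n = f ` {..<n}" for n
    by (induction n) (simp_all add: S_simps lessThan_Suc)
  have fin: "finite (S n)" for n by (simp add: S)
  have fJ: "S n \<subseteq> J" for n
  proof (induction n)
    case (Suc n)
    then show ?case using fin[of n] nxt(1) by (simp add: S_simps f_def)
  qed (simp add: S_simps)
  have f: "f n \<in> J" "f n \<notin> ring_ideal.span (S n)"
      "\<And>g. g \<in> J \<Longrightarrow> g \<notin> ring_ideal.span (S n) \<Longrightarrow> degree (f n) \<le> degree g" for n
    using nxt[of "S n", OF _ fJ] fin[of n] unfolding f_def by blast+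
  have deg: "degree (f k) \<le> degree (f n)" if "k < n" for k n
  proof (rule f(3)[OF f(1)])
    have "S k \<subseteq> S n" using that by (auto simp: S)
    then show "f n \<notin> ring_ideal.span (S k)" using f(2)[of n] ring_ideal.span_mono by blast
  qed
  obtain N where "lead_coeff (f N) \<in> ring_ideal.span ((\<lambda>n. lead_coeff (f n)) ` {..<N})"
    using noetherian_stationary[of "\<lambda>n. lead_coeff (f n)", OF noeth] by blast
  then obtain u where u: "lead_coeff (f N) = (\<Sum>k<N. u k * lead_coeff (f k))"
    using ideal_span_image_lessThan by blast
  \<comment> \<open>The monomial lifts \<open>f k\<close> to the degree of \<open>f N\<close>; by
    \<open>deg\<close> the difference of degrees is not truncated.\<close>
  define m where "m k = monom (u k) (degree (f N) - degree (f k)) * f k" for k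
  define g where "g = f N - (\<Sum>k<N. m k)"
  have m_span: "(\<Sum>k<N. m k) \<in> ring_ideal.span (S N)"
    unfolding m_def by (intro ring_ideal.span_sum ring_ideal.span_scale ring_ideal.span_base) (simp add: S)
  have "g \<notin> ring_ideal.span (S N)"
    using f(2)[of N] ring_ideal.span_add[OF _ m_span, of g] by (auto simp: g_def)
  moreover have "g \<in> J"
    unfolding g_def using m_span ring_ideal.span_minimal[OF fJ J]
    by (intro ring_ideal.subspace_diff[OF J f(1)]) auto
  ultimately have le: "degree (f N) \<le> degree g" by (intro f(3))
  have "degree (m k) \<le> degree (f N)" if "k < N" for k
    using degree_mult_le[of "monom (u k) (degree (f N) - degree (f k))" "f k"]
      degree_monom_le[of "u k" "degree (f N) - degree (f k)"] deg[OF that]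
    by (simp add: m_def)
  then have "degree g \<le> degree (f N)"
    unfolding g_def by (intro degree_diff_le degree_sum_le) auto
  moreover have "coeff (m k) (degree (f N)) = u k * lead_coeff (f k)" if "k < N" for k
    using deg[OF that] by (simp add: m_def coeff_monom_mult)
  then have "coeff g (degree (f N)) = 0"
    by (simp add: g_def coeff_sum u)
  ultimately have "g = 0" using le by (metis antisym leading_coeff_0_iff)
  with \<open>g \<notin> ring_ideal.span (S N)\<close> show False by (simp add: ring_ideal.span_zero)
qed

lemma real_ideal_finitely_generated:
  fixes I :: "real set"
  assumes "ring_ideal.subspace I"
  shows "\<exists>G. finite G \<and> ring_ideal.span G = I"
proof (cases "I = {0}")
  case True
  then show ?thesis using ring_ideal.span_empty by blast
next
  case False
  then obtain x where "x \<in> I" "x \<noteq> 0" using assms ring_ideal.subspace_0 by blast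
  then have "y \<in> I" for y
    using ring_ideal.subspace_scale[OF assms, of x "y / x"] by simp
  moreover have "y \<in> ring_ideal.span {1}" for y :: real
    using ring_ideal.span_scale[OF ring_ideal.span_base, of 1 "{1}" y] by simp
  ultimately have "ring_ideal.span {1} = I" by blast
  then show ?thesis by blast
qed

lemma real_poly3_ideal_generates:
  assumes "ring_ideal.subspace I"
  shows "\<exists>G. generates G I"
proof -
  obtain G where "finite G" "ring_ideal.span G = I"
    using hilbert_basis[OF hilbert_basis[OF hilbert_basis[OF real_ideal_finitely_generated]] assms]
    by blast
  then show ?thesis
    by (auto simp: generates_def ring_ideal.span_finite image_def)
qed

section \<open>Gradients\<close>

lemma grad2_pCons:
  "grad2 (pCons p F) (x, y) = (poly (pderiv p) x + y * fst (grad2 F (x, y)),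
     eval2 F (x, y) + y * snd (grad2 F (x, y)))"
  by (simp add: grad2_def Polynomial.map_poly_pCons pderiv_pCons eval2_pCons)

lemma eval2_has_derivative:
  "(eval2 F has_derivative (\<lambda>v. inner (grad2 F P) v)) (at P)"
proof (induction F)
  case 0
  then show ?case by (simp add: eval2_def grad2_def inner_prod_def case_prod_beta)
next
  case (pCons p F)
  have p: "((\<lambda>v. poly p (fst v)) has_derivative (\<lambda>v. fst v * poly (pderiv p) (fst P))) (at P)"
    by (rule DERIV_compose_FDERIV[where g = fst]) (auto intro!: derivative_eq_intros poly_DERIV)
  have "eval2 (pCons p F) = (\<lambda>v. poly p (fst v) + snd v * eval2 F v)"
    by (auto simp: eval2_pCons fun_eq_iff)
  moreover have "((\<lambda>v. poly p (fst v) + snd v * eval2 F v) has_derivative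
     (\<lambda>v. fst v * poly (pderiv p) (fst P) + (snd P * inner (grad2 F P) v + snd v * eval2 F P))) (at P)"
    by (intro has_derivative_add p has_derivative_mult pCons has_derivative_snd has_derivative_ident)
  moreover have "inner (grad2 (pCons p F) P) =
      (\<lambda>v. fst v * poly (pderiv p) (fst P) + (snd P * inner (grad2 F P) v + snd v * eval2 F P))"
    by (cases P) (simp add: grad2_pCons fun_eq_iff inner_prod_def distrib_left distrib_right ac_simps)
  ultimately show ?case by simp
qed

lemma eval3_simps [simp]:
  "eval3 0 P = 0"
  "eval3 (F + G) P = eval3 F P + eval3 G P"
  "eval3 (F * G) P = eval3 F P * eval3 G P"
  by (auto simp: eval3_def split: prod.splits)

lemma eval3_pCons: "eval3 (pCons p F) (x, y, z) = eval2 p (x, y) + z * eval3 F (x, y, z)"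
  by (simp add: eval3_def eval2_pCons)

lemma grad3_pCons:
  "grad3 (pCons p F) (x, y, z) =
    (fst (grad2 p (x, y)) + z * fst (grad3 F (x, y, z)),
     snd (grad2 p (x, y)) + z * fst (snd (grad3 F (x, y, z))),
     eval3 F (x, y, z) + z * snd (snd (grad3 F (x, y, z))))"
proof -
  have "map_poly (map_poly pderiv) (pCons p F) = pCons (map_poly pderiv p) (map_poly (map_poly pderiv) F)"
    by (rule Polynomial.map_poly_pCons) simp
  then show ?thesis
    by (simp add: grad3_def grad2_def Polynomial.map_poly_pCons pderiv_pCons eval3_pCons)
qed

lemma eval3_has_derivative:
  "(eval3 F has_derivative (\<lambda>v. inner (grad3 F P) v)) (at P)"
proof (induction F)
  case 0
  then show ?case by (simp add: eval3_def grad3_def inner_prod_def case_prod_beta)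
next
  case (pCons p F)
  let ?pr = "\<lambda>v :: real \<times> real \<times> real. (fst v, fst (snd v))"
  have "(?pr has_derivative ?pr) (at P)"
    by (auto intro!: derivative_eq_intros)
  then have p: "((\<lambda>v. eval2 p (?pr v)) has_derivative (\<lambda>v. inner (grad2 p (?pr P)) (?pr v))) (at P)"
    using eval2_has_derivative by (rule has_derivative_compose)
  have "eval3 (pCons p F) = (\<lambda>v. eval2 p (?pr v) + snd (snd v) * eval3 F v)"
    by (auto simp: eval3_pCons fun_eq_iff)
  moreover have "((\<lambda>v. eval2 p (?pr v) + snd (snd v) * eval3 F v) has_derivative
     (\<lambda>v. inner (grad2 p (?pr P)) (?pr v) +
        (snd (snd P) * inner (grad3 F P) v + snd (snd v) * eval3 F P))) (at P)"
    by (intro has_derivative_add p has_derivative_mult pCons has_derivative_snd has_derivative_ident)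
  moreover have "inner (grad3 (pCons p F) P) =
      (\<lambda>v. inner (grad2 p (?pr P)) (?pr v) +
        (snd (snd P) * inner (grad3 F P) v + snd (snd v) * eval3 F P))"
    by (cases P) (simp add: grad3_pCons fun_eq_iff inner_prod_def distrib_left distrib_right ac_simps)
  ultimately show ?case by simp
qed

text \<open>Both sides represent the Frechet derivative of the product, which is unique; no
  computation with nested \<open>map_poly\<close> is required.\<close>

lemma grad3_mult:
  "grad3 (F * G) P = eval3 F P *\<^sub>R grad3 G P + eval3 G P *\<^sub>R grad3 F P"
proof -
  have "(eval3 (F * G) has_derivative
      (\<lambda>v. eval3 F P * inner (grad3 G P) v + inner (grad3 F P) v * eval3 G P)) (at P)"
    using has_derivative_mult[OF eval3_has_derivative[of F P] eval3_has_derivative[of G P]]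
    by (simp flip: eval3_simps(3))
  then have "(\<lambda>v. inner (grad3 (F * G) P) v) =
      (\<lambda>v. eval3 F P * inner (grad3 G P) v + inner (grad3 F P) v * eval3 G P)"
    using eval3_has_derivative has_derivative_unique by blast
  then have "inner (grad3 (F * G) P) v =
      inner (eval3 F P *\<^sub>R grad3 G P + eval3 G P *\<^sub>R grad3 F P) v" for v
    by (metis (no_types, lifting) inner_add_left inner_scaleR_left mult.commute)
  then show ?thesis using vector_eq_rdot by blast
qed

lemma grad3_add: "grad3 (F + G) P = grad3 F P + grad3 G P"
proof -
  have "(eval3 (F + G) has_derivative (\<lambda>v. inner (grad3 F P) v + inner (grad3 G P) v)) (at P)"
    using has_derivative_add[OF eval3_has_derivative[of F P] eval3_has_derivative[of G P]]
    by (simp flip: eval3_simps(2))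
  then have "(\<lambda>v. inner (grad3 (F + G) P) v) = (\<lambda>v. inner (grad3 F P) v + inner (grad3 G P) v)"
    using eval3_has_derivative has_derivative_unique by blast
  then have "inner (grad3 (F + G) P) v = inner (grad3 F P + grad3 G P) v" for v
    by (metis inner_add_left)
  then show ?thesis using vector_eq_rdot by blast
qed

lemma grad3_0: "grad3 0 P = 0"
  by (simp add: grad3_def zero_prod_def)

lemma grad3_sum: "grad3 (sum f A) P = (\<Sum>a\<in>A. grad3 (f a) P)"
  by (induction A rule: infinite_finite_induct) (simp_all add: grad3_add grad3_0)

lemma grad2_add: "grad2 (F + G) P = grad2 F P + grad2 G P"
  and grad2_diff: "grad2 (F - G) P = grad2 F P - grad2 G P"
  and grad2_mult: "grad2 (F * G) P = eval2 F P *\<^sub>R grad2 G P + eval2 G P *\<^sub>R grad2 F P"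
proof -
  have eqI: "grad2 F P = w" if "(eval2 F has_derivative (\<lambda>v. inner w v)) (at P)" for F w
  proof -
    have "(\<lambda>v. inner (grad2 F P) v) = (\<lambda>v. inner w v)"
      using eval2_has_derivative[of F P] that by (rule has_derivative_unique)
    then show ?thesis by (metis vector_eq_rdot)
  qed
  note F = eval2_has_derivative[of F P] and G = eval2_has_derivative[of G P]
  have "(eval2 (F + G) has_derivative (\<lambda>v. inner (grad2 F P + grad2 G P) v)) (at P)"
    using has_derivative_add[OF F G] by (simp add: inner_add_left flip: eval2_simps(3))
  then show "grad2 (F + G) P = grad2 F P + grad2 G P" by (rule eqI)
  have "(eval2 (F - G) has_derivative (\<lambda>v. inner (grad2 F P - grad2 G P) v)) (at P)"
    using has_derivative_diff[OF F G] by (simp add: inner_diff_left flip: eval2_simps(4))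
  then show "grad2 (F - G) P = grad2 F P - grad2 G P" by (rule eqI)
  have "(eval2 (F * G) has_derivative
      (\<lambda>v. inner (eval2 F P *\<^sub>R grad2 G P + eval2 G P *\<^sub>R grad2 F P) v)) (at P)"
    using has_derivative_mult[OF F G]
    by (simp add: inner_add_left mult.commute flip: eval2_simps(6))
  then show "grad2 (F * G) P = eval2 F P *\<^sub>R grad2 G P + eval2 G P *\<^sub>R grad2 F P" by (rule eqI)
qed

lemma grad2_const2: "grad2 (const2 c) P = 0"
  and grad2_X2: "grad2 X2 P = (1, 0)"
  and grad2_Y2: "grad2 Y2 P = (0, 1)"
  by (cases P; simp add: grad2_def const2_def X2_def Y2_def eval2_def
      Polynomial.map_poly_pCons pderiv_pCons zero_prod_def)+

lemmas grad2_simps = grad2_add grad2_diff grad2_mult grad2_const2 grad2_X2 grad2_Y2 power2_eq_square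

lemma eval2_quad2:
  "eval2 (quad2 a b d g h j) (x, y) = a * x\<^sup>2 + b * y\<^sup>2 + d * x * y + g * x + h * y + j"
  by (simp add: quad2_def)

lemma eval2_lin2: "eval2 (lin2 e f i) (x, y) = e * x + f * y + i"
  by (simp add: lin2_def)

lemma grad2_quad2:
  "grad2 (quad2 a b d g h j) (x, y) = (2 * a * x + d * y + g, 2 * b * y + d * x + h)"
  by (simp add: quad2_def grad2_simps)

lemma eval3_torus: "eval3 (torus_poly R r) (x, y, z) = (x\<^sup>2 + y\<^sup>2 + z\<^sup>2 + R\<^sup>2 - r\<^sup>2)\<^sup>2 - 4 * R\<^sup>2 * (x\<^sup>2 + y\<^sup>2)"
  by (simp add: torus_poly_def eval3_pCons torus_p0_def torus_p2_def) Groebner_Basis.algebra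

lemma eval3_quadric: "eval3 (quadric_poly q1 q0) (x, y, z) = z\<^sup>2 + eval2 q1 (x, y) * z + eval2 q0 (x, y)"
  by (simp add: quadric_poly_def eval3_pCons) Groebner_Basis.algebra

lemma grad3_torus: "grad3 (torus_poly R r) (x, y, 0) =
    (fst (grad2 (torus_p0 R r) (x, y)), snd (grad2 (torus_p0 R r) (x, y)), 0)"
  by (simp add: torus_poly_def grad3_pCons eval3_pCons)

lemma grad3_quadric: "grad3 (quadric_poly q1 q0) (x, y, 0) =
    (fst (grad2 q0 (x, y)), snd (grad2 q0 (x, y)), eval2 q1 (x, y))"
  by (simp add: quadric_poly_def grad3_pCons eval3_pCons)

section \<open>Rank of the Jacobian and isolated points\<close>

lemma vanishing_ideal_subspace: "ring_ideal.subspace (vanishing_ideal C)"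
  by (rule ring_ideal.subspaceI) (auto simp: vanishing_ideal_def)

lemma generates_memberD:
  assumes "generates G I" "F \<in> G"
  shows "F \<in> I"
proof -
  have "F = (\<Sum>K\<in>G. (if K = F then 1 else 0) * K)"
    using assms by (simp add: generates_def if_distrib[of "\<lambda>c. c * _"] cong: if_cong)
  moreover have I: "I = {\<Sum>K\<in>G. c K * K | c. True}" using assms(1) by (simp add: generates_def)
  ultimately show ?thesis
    unfolding I by (intro CollectI exI[of _ "\<lambda>K. if K = F then 1 else 0"] conjI TrueI)
qed

text \<open>All generators vanish at \<open>P\<close>, so in the product rule only the terms with a
  differentiated generator survive.\<close>

lemma grad3_in_span:
  assumes G: "generates G (vanishing_ideal C)" and P: "P \<in> C" and F: "F \<in> vanishing_ideal C"
  shows "grad3 F P \<in> span ((\<lambda>F. grad3 F P) ` G)"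
proof -
  obtain c where c: "F = (\<Sum>K\<in>G. c K * K)" using G F unfolding generates_def by blast
  have "grad3 (c K * K) P = eval3 (c K) P *\<^sub>R grad3 K P" if "K \<in> G" for K
    using generates_memberD[OF G that] P by (simp add: grad3_mult vanishing_ideal_def)
  then have "grad3 F P = (\<Sum>K\<in>G. eval3 (c K) P *\<^sub>R grad3 K P)"
    by (simp add: c grad3_sum)
  moreover have "(\<Sum>K\<in>G. eval3 (c K) P *\<^sub>R grad3 K P) \<in> span ((\<lambda>F. grad3 F P) ` G)"
    by (intro span_sum span_scale span_base imageI)
  ultimately show ?thesis by simp
qed

lemma rank_two_not_singular:
  assumes P: "P \<in> C" and S: "S \<in> vanishing_ideal C" and T: "T \<in> vanishing_ideal C"
    and ind: "grad3 T P \<noteq> 0" "\<And>c. grad3 S P \<noteq> c *\<^sub>R grad3 T P"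
    and G: "generates G (vanishing_ideal C)"
  shows "jacobian_rank G P \<ge> 2"
proof -
  let ?V = "span ((\<lambda>F. grad3 F P) ` G)"
  have "grad3 S P \<notin> span {grad3 T P}" using ind(2) by (auto simp: span_singleton)
  then have "independent {grad3 S P, grad3 T P}"
    using ind(1) by (simp add: independent_insert)
  moreover have "{grad3 S P, grad3 T P} \<subseteq> ?V"
    using grad3_in_span[OF G P] S T by simp
  ultimately have "card {grad3 S P, grad3 T P} \<le> dim ?V" using independent_card_le_dim by blast
  moreover have "grad3 S P \<noteq> grad3 T P" using ind(2)[of 1] by simp
  ultimately show ?thesis by (simp add: jacobian_rank_def)
qed

text \<open>Hilbert's basis theorem enters here: it supplies the generating system whose existence
  is part of the claim.\<close>

lemma rank_one_if_gradients_parallel: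
  assumes "\<And>F. F \<in> vanishing_ideal C \<Longrightarrow> grad3 F P \<in> span {w}"
  shows "\<exists>G. generates G (vanishing_ideal C) \<and> jacobian_rank G P \<le> 1"
proof -
  obtain G where G: "generates G (vanishing_ideal C)"
    using real_poly3_ideal_generates[OF vanishing_ideal_subspace] by blast
  have "(\<lambda>F. grad3 F P) ` G \<subseteq> span {w}"
    using assms generates_memberD[OF G] by blast
  then have "dim ((\<lambda>F. grad3 F P) ` G) \<le> card {w}" by (rule dim_le_card) simp
  then show ?thesis using G by (auto simp: jacobian_rank_def)
qed

text \<open>Both gradients are horizontal and independent, so the height z completes S and T to a
  map with invertible derivative. The image of a small ball then contains a point (0, 0, h) with h >
  0, and its preimage is a point of the curve other than the given one.\<close>

lemma transversal_zeros_not_isolated: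
  fixes S T :: "real poly poly poly"
  assumes P: "eval3 S (x, y, 0) = 0" "eval3 T (x, y, 0) = 0"
    and S: "grad3 S (x, y, 0) = (s1, s2, 0)" and T: "grad3 T (x, y, 0) = (t1, t2, 0)"
    and det: "s1 * t2 - s2 * t1 \<noteq> 0"
  shows "\<not> (x, y, 0) isolated_in (zero_set3 S \<inter> zero_set3 T)"
proof
  let ?P = "(x, y, 0 :: real)" and ?C = "zero_set3 S \<inter> zero_set3 T"
  assume "?P isolated_in ?C"
  then obtain e where e: "e > 0" "\<And>M. M \<in> ?C \<Longrightarrow> dist ?P M < e \<Longrightarrow> M = ?P"
    unfolding isolated_in_dist_Ex_iff by blast
  define f where "f M = (eval3 S M, eval3 T M, snd (snd M))" for M
  define f' where "f' v = (inner (s1, s2, 0) v, inner (t1, t2, 0) v, snd (snd v))" for v :: "real \<times> real \<times> real"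
  define D where "D = s1 * t2 - s2 * t1"
  \<comment> \<open>The right inverse of the derivative required by the open mapping theorem, from
    Cramer's rule.\<close>
  define g' where "g' v = ((t2 * fst v - s2 * fst (snd v)) / D, (s1 * fst (snd v) - t1 * fst v) / D, snd (snd v))"
    for v :: "real \<times> real \<times> real"
  have der: "(f has_derivative f') (at ?P)"
    unfolding f_def[abs_def] f'_def[abs_def] S[symmetric] T[symmetric]
    by (intro has_derivative_Pair eval3_has_derivative has_derivative_snd has_derivative_ident)
  have cont: "continuous_on UNIV f"
  proof -
    have "isCont (eval3 K) M" for K M
      using eval3_has_derivative has_derivative_continuous by blast
    then have "continuous_on UNIV (eval3 K)" for K
      by (simp add: continuous_on_eq_continuous_at)
    then show ?thesis unfolding f_def[abs_def]
      by (intro continuous_intros)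
  qed
  have "bounded_linear g'"
  proof -
    have "linear g'"
      by (rule linearI) (auto simp: g'_def algebra_simps add_divide_distrib diff_divide_distrib)
    then show ?thesis by (simp add: linear_conv_bounded_linear)
  qed
  moreover have "f' \<circ> g' = id"
  proof
    fix v
    have D: "D \<noteq> 0" using det by (simp add: D_def)
    have "s1 * ((t2 * p - s2 * q) / D) + s2 * ((s1 * q - t1 * p) / D) = p"
      "t1 * ((t2 * p - s2 * q) / D) + t2 * ((s1 * q - t1 * p) / D) = q" for p q
    proof -
      have "s1 * (t2 * p - s2 * q) + s2 * (s1 * q - t1 * p) = p * D"
        "t1 * (t2 * p - s2 * q) + t2 * (s1 * q - t1 * p) = q * D"
        unfolding D_def by Groebner_Basis.algebra+
      then show "s1 * ((t2 * p - s2 * q) / D) + s2 * ((s1 * q - t1 * p) / D) = p"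
        "t1 * ((t2 * p - s2 * q) / D) + t2 * ((s1 * q - t1 * p) / D) = q"
        using D by (simp_all add: add_divide_distrib[symmetric])
    qed
    then show "(f' \<circ> g') v = id v"
      by (cases v) (simp add: f'_def g'_def inner_prod_def)
  qed
  moreover have "?P \<in> interior (ball ?P e)" using e(1) by simp
  ultimately have "f ?P \<in> interior (f ` ball ?P e)"
    using sussmann_open_mapping[OF open_UNIV cont UNIV_I der] by blast
  then obtain \<delta> where d: "\<delta> > 0" "ball (f ?P) \<delta> \<subseteq> f ` ball ?P e"
    by (meson mem_interior)
  have fP: "f ?P = (0, 0, 0)" using P by (simp add: f_def)
  have "(0, 0, \<delta> / 2) \<in> ball (f ?P) \<delta>"
    using d(1) by (simp add: fP dist_Pair_Pair)
  then obtain M where M: "M \<in> ball ?P e" "f M = (0, 0, \<delta> / 2)" using d(2) by (metis imageE subsetD)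
  then have "M \<in> ?C" "snd (snd M) = \<delta> / 2" by (auto simp: f_def zero_set3_def)
  then have "M = ?P" using e(2) M(1) by simp
  then show False using \<open>snd (snd M) = \<delta> / 2\<close> d(1) by simp
qed

section \<open>Auxiliary facts on polynomials\<close>

text \<open>Meant for the restriction of factors of \<open>H\<close> to t = i m, where
  \<open>u\<close> and \<open>v\<close> are s - i and s + i. Cancelling one prime at a time works in
  any integral domain.\<close>

lemma prime_powers_factor:
  fixes p q c u v :: "'a::idom"
  assumes "prime_elem u" "prime_elem v" and "p * q = c * u ^ A * v ^ B"
  shows "\<exists>a b a' b' k l. k * l = c \<and> a + a' = A \<and> b + b' = B \<and>
    p = k * u ^ a * v ^ b \<and> q = l * u ^ a' * v ^ b'"
  using assms(3)
proof (induction "A + B" arbitrary: p q A B)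
  case 0
  then have "p * q = c" by simp
  then show ?case using 0 by (intro exI[of _ 0] exI[of _ p] exI[of _ q]) auto
next
  case (Suc n)
  obtain w A' B' where w: "A' + B' = n"
    "(w = u \<and> A = Suc A' \<and> B = B') \<or> (w = v \<and> A = A' \<and> B = Suc B')"
  proof (cases A)
    case 0
    then show ?thesis using Suc.hyps(2) that[of A "B - 1" v] by simp
  next
    case (Suc A')
    then show ?thesis using Suc.hyps(2) that[of A' B u] by simp
  qed
  have w_prime: "prime_elem w" using w(2) assms(1,2) by auto
  then have "w \<noteq> 0" by auto
  have pq: "p * q = w * (c * u ^ A' * v ^ B')"
    using Suc.prems w(2) by (elim disjE conjE) (simp_all add: mult.assoc mult.left_commute[of c w] mult.left_commute[of _ w])
  then have "w dvd p \<or> w dvd q" using w_prime by (metis dvd_triv_left prime_elem_dvd_multD)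
  then show ?case
  proof
    assume "w dvd p"
    then obtain p' where p: "p = w * p'" by blast
    with pq have "w * (p' * q) = w * (c * u ^ A' * v ^ B')" by (simp only: mult.assoc)
    then have "p' * q = c * u ^ A' * v ^ B'" using \<open>w \<noteq> 0\<close> by (metis mult_left_cancel)
    from Suc.hyps(1)[OF w(1)[symmetric] this] obtain a b a' b' k l where
      *: "k * l = c" "a + a' = A'" "b + b' = B'" "p' = k * u ^ a * v ^ b" "q = l * u ^ a' * v ^ b'"
      by blast
    from w(2) show ?thesis
    proof (elim disjE conjE)
      assume "w = u" "A = Suc A'" "B = B'"
      then show ?thesis using * p
        by (intro exI[of _ "Suc a"] exI[of _ b] exI[of _ a'] exI[of _ b'] exI[of _ k] exI[of _ l])
          (simp add: mult.left_commute)
    next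
      assume "w = v" "A = A'" "B = Suc B'"
      then show ?thesis using * p
        by (intro exI[of _ a] exI[of _ "Suc b"] exI[of _ a'] exI[of _ b'] exI[of _ k] exI[of _ l])
          (simp add: mult.left_commute)
    qed
  next
    assume "w dvd q"
    then obtain q' where q: "q = w * q'" by blast
    with pq have "w * (p * q') = w * (c * u ^ A' * v ^ B')" by (simp only: mult.left_commute)
    then have "p * q' = c * u ^ A' * v ^ B'" using \<open>w \<noteq> 0\<close> by (metis mult_left_cancel)
    from Suc.hyps(1)[OF w(1)[symmetric] this] obtain a b a' b' k l where
      *: "k * l = c" "a + a' = A'" "b + b' = B'" "p = k * u ^ a * v ^ b" "q' = l * u ^ a' * v ^ b'"
      by blast
    from w(2) show ?thesis
    proof (elim disjE conjE)
      assume "w = u" "A = Suc A'" "B = B'"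
      then show ?thesis using * q
        by (intro exI[of _ a] exI[of _ b] exI[of _ "Suc a'"] exI[of _ b'] exI[of _ k] exI[of _ l])
          (simp add: mult.left_commute)
    next
      assume "w = v" "A = A'" "B = Suc B'"
      then show ?thesis using * q
        by (intro exI[of _ a] exI[of _ b] exI[of _ a'] exI[of _ "Suc b'"] exI[of _ k] exI[of _ l])
          (simp add: mult.left_commute)
    qed
  qed
qed

definition cpoly :: "real poly \<Rightarrow> complex poly" where
  "cpoly = map_poly complex_of_real"

lemma cpoly_pCons [simp]: "cpoly (pCons a p) = pCons (of_real a) (cpoly p)"
  by (simp add: cpoly_def Polynomial.map_poly_pCons)

lemma cpoly_0 [simp]: "cpoly 0 = 0"
  by (simp add: cpoly_def)

lemma cpoly_add [simp]: "cpoly (p + q) = cpoly p + cpoly q"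
  by (rule poly_eqI) (simp add: cpoly_def coeff_map_poly)

lemma cpoly_smult [simp]: "cpoly (Polynomial.smult c p) = Polynomial.smult (of_real c) (cpoly p)"
  by (rule poly_eqI) (simp add: cpoly_def coeff_map_poly)

lemma cpoly_mult [simp]: "cpoly (p * q) = cpoly p * cpoly q"
  by (induction p) auto

lemma poly_cpoly_of_real [simp]: "poly (cpoly p) (of_real x) = of_real (poly p x)"
  by (induction p) auto

lemma degree_cpoly [simp]: "degree (cpoly p) = degree p"
  by (simp add: cpoly_def degree_map_poly)

lemma poly_eqI_infinite:
  fixes p q :: "real poly"
  assumes "infinite S" and "\<And>x. x \<in> S \<Longrightarrow> poly p x = poly q x"
  shows "p = q"
proof (rule ccontr)
  assume "p \<noteq> q"
  then have "finite {x. poly (p - q) x = 0}" by (intro poly_roots_finite) simp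
  moreover have "S \<subseteq> {x. poly (p - q) x = 0}" using assms(2) by auto
  ultimately show False using assms(1) finite_subset by blast
qed

lemma poly2_coeffs:
  assumes "degree u \<le> 2"
  shows "u = [:coeff u 0, coeff u 1, coeff u 2:]"
proof (rule poly_eqI)
  fix n
  show "coeff u n = coeff [:coeff u 0, coeff u 1, coeff u 2:] n"
    using assms coeff_eq_0[of u n] by (cases "n = 0"; cases "n = 1"; cases "n = 2")
      (auto simp: coeff_pCons numeral_eq_Suc split: nat.splits)
qed

lemma poly_coeffs_zero:
  fixes p :: "real poly"
  assumes "\<And>x. poly p x = 0"
  shows "coeff p k = 0"
proof -
  have "p = 0" using assms by (metis poly_all_0_iff_0)
  then show ?thesis by simp
qed

lemma prime_elem_linear_complex: "prime_elem [:w, 1::complex:]"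
  by (intro irreducible_imp_prime_elem_gcd irreducible_linear_poly) auto

text \<open>\<open>coeff (coeff F j) i\<close> belongs to s^i t^j. Here \<open>v\<close> has order
  at least 2 and \<open>M\<close> order at least 1 at the origin, so their product has order at
  least 3.\<close>

lemma coeff_coeff_mult_order:
  fixes v M :: "real poly poly"
  assumes "coeff (coeff v 0) 0 = 0" "coeff (coeff v 0) 1 = 0" "coeff (coeff v 1) 0 = 0"
    and "coeff (coeff M 0) 0 = 0"
  shows "coeff (coeff (v * M) 0) 2 = 0" "coeff (coeff (v * M) 1) 1 = 0" "coeff (coeff (v * M) 2) 0 = 0"
  using assms by (simp_all add: coeff_mult numeral_eq_Suc)

section \<open>The quadric in half-angle coordinates of the torus\<close>

text \<open>
  If a conic meets a meridian circle of the torus in two double points, it lies in the pencil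
  spanned by the circle and a double line; \<open>m\<close> measures the share of the double line.
\<close>

lemma double_contact_pencil:
  fixes A B D L G E i j k n u0 u1 u2 m :: real
  assumes D: "D = A - B" "D \<noteq> 0" and n: "n \<noteq> 0"
    and e0: "A\<^sup>2 * L + A * G * n + j * n\<^sup>2 = k * u0\<^sup>2"
    and e1: "D * n * (A * E + i * n) = 2 * k * u0 * u1"
    and e2: "D\<^sup>2 * n\<^sup>2 + 2 * A * B * L + (A + B) * G * n + 2 * j * n\<^sup>2 = k * (u1\<^sup>2 + 2 * u0 * u2)"
    and e3: "D * n * (B * E + i * n) = 2 * k * u1 * u2"
    and e4: "B\<^sup>2 * L + B * G * n + j * n\<^sup>2 = k * u2\<^sup>2"
    and m: "m = k * u1\<^sup>2 / (D\<^sup>2 * n\<^sup>2)"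
  shows "E\<^sup>2 = 4 * m * (L - n\<^sup>2 + m * n\<^sup>2)"
    and "i\<^sup>2 = 4 * m * (j - A * B + A * B * m)"
    and "E * i = 2 * m * (G + (A + B) * n * (1 - m))"
proof -
  \<comment> \<open>On the circle, z = D t / (1 + t^2). The conic is (1 - m) times the circle plus m
    times the square of a line z + \<beta> \<rho> + \<gamma>, so its restriction is m times that
    square. After multiplication by 1 + t^2 the line has t-coefficient D, and comparison with
    \<open>u1\<close> gives this value of \<open>m\<close>.\<close>
  have K: "k * u1\<^sup>2 = D\<^sup>2 * n\<^sup>2 * m" using D n m by simp
  have E: "D\<^sup>2 * n * E = 2 * k * u1 * (u0 - u2)"
  proof -
    have "D\<^sup>2 * n * E = D * n * (A * E + i * n) - D * n * (B * E + i * n)"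
      unfolding D(1) by Groebner_Basis.algebra
    also have "\<dots> = 2 * k * u1 * (u0 - u2)"
      unfolding e1 e3 by Groebner_Basis.algebra
    finally show ?thesis .
  qed
  have I: "D\<^sup>2 * n\<^sup>2 * i = - (2 * k * u1 * (B * u0 - A * u2))"
  proof -
    have "D\<^sup>2 * n\<^sup>2 * i = A * (D * n * (B * E + i * n)) - B * (D * n * (A * E + i * n))"
      unfolding D(1) by Groebner_Basis.algebra
    also have "\<dots> = - (2 * k * u1 * (B * u0 - A * u2))"
      unfolding e1 e3 by Groebner_Basis.algebra
    finally show ?thesis .
  qed
  \<comment> \<open>In a multiple of D t + \<beta> (A + B t^2) + \<gamma> (1 + t^2) the expressions
    \<open>u0 - u2\<close> and \<open>B * u0 - A * u2\<close> isolate \<beta> and \<gamma>. The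
    three claims compare the coefficients of \<rho>^2, 1 and \<rho> in the pencil.\<close>
  have S1: "k * (u0 - u2)\<^sup>2 = D\<^sup>2 * (L - n\<^sup>2 + n\<^sup>2 * m)"
  proof -
    have "k * (u0 - u2)\<^sup>2 = k * u0\<^sup>2 + k * u2\<^sup>2 - k * (u1\<^sup>2 + 2 * u0 * u2) + k * u1\<^sup>2"
      by Groebner_Basis.algebra
    also have "\<dots> = D\<^sup>2 * (L - n\<^sup>2 + n\<^sup>2 * m)"
      unfolding K e0[symmetric] e2[symmetric] e4[symmetric] D(1) by Groebner_Basis.algebra
    finally show ?thesis .
  qed
  have S2: "k * (B * u0 - A * u2)\<^sup>2 = D\<^sup>2 * n\<^sup>2 * (j - A * B + A * B * m)"
  proof -
    have "k * (B * u0 - A * u2)\<^sup>2 =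
        B\<^sup>2 * (k * u0\<^sup>2) + A\<^sup>2 * (k * u2\<^sup>2) - A * B * (k * (u1\<^sup>2 + 2 * u0 * u2)) + A * B * (k * u1\<^sup>2)"
      by Groebner_Basis.algebra
    also have "\<dots> = D\<^sup>2 * n\<^sup>2 * (j - A * B + A * B * m)"
      unfolding K e0[symmetric] e2[symmetric] e4[symmetric] D(1) by Groebner_Basis.algebra
    finally show ?thesis .
  qed
  have S3: "2 * (k * (u0 - u2) * (B * u0 - A * u2)) = - (D\<^sup>2 * n * (G + (A + B) * n * (1 - m)))"
  proof -
    have "2 * (k * (u0 - u2) * (B * u0 - A * u2)) =
        2 * (B * (k * u0\<^sup>2) + A * (k * u2\<^sup>2)) - (A + B) * (k * (u1\<^sup>2 + 2 * u0 * u2)) + (A + B) * (k * u1\<^sup>2)"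
      by Groebner_Basis.algebra
    also have "\<dots> = - (D\<^sup>2 * n * (G + (A + B) * n * (1 - m)))"
      unfolding K e0[symmetric] e2[symmetric] e4[symmetric] D(1) by Groebner_Basis.algebra
    finally show ?thesis .
  qed
  have "(D\<^sup>2 * n * E)\<^sup>2 = 4 * (k * u1\<^sup>2) * (k * (u0 - u2)\<^sup>2)"
    unfolding E by Groebner_Basis.algebra
  also have "\<dots> = (D\<^sup>2 * n)\<^sup>2 * (4 * m * (L - n\<^sup>2 + m * n\<^sup>2))"
    unfolding K S1 by Groebner_Basis.algebra
  finally show "E\<^sup>2 = 4 * m * (L - n\<^sup>2 + m * n\<^sup>2)"
    using D(2) n by (simp add: power_mult_distrib)
  have "(D\<^sup>2 * n\<^sup>2 * i)\<^sup>2 = 4 * (k * u1\<^sup>2) * (k * (B * u0 - A * u2)\<^sup>2)"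
    unfolding I by Groebner_Basis.algebra
  also have "\<dots> = (D\<^sup>2 * n\<^sup>2)\<^sup>2 * (4 * m * (j - A * B + A * B * m))"
    unfolding K S2 by Groebner_Basis.algebra
  finally show "i\<^sup>2 = 4 * m * (j - A * B + A * B * m)"
    using D(2) n by (simp add: power_mult_distrib)
  have "(D\<^sup>2 * n * E) * (D\<^sup>2 * n\<^sup>2 * i) = - 2 * (k * u1\<^sup>2) * (2 * (k * (u0 - u2) * (B * u0 - A * u2)))"
    unfolding E I by Groebner_Basis.algebra
  also have "\<dots> = (D\<^sup>2 * n) * (D\<^sup>2 * n\<^sup>2) * (2 * m * (G + (A + B) * n * (1 - m)))"
    unfolding K S3 by Groebner_Basis.algebra
  finally have "(D\<^sup>2 * n) * (D\<^sup>2 * n\<^sup>2) * (E * i) = (D\<^sup>2 * n) * (D\<^sup>2 * n\<^sup>2) * (2 * m * (G + (A + B) * n * (1 - m)))"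
    by (simp only: ac_simps)
  then show "E * i = 2 * m * (G + (A + B) * n * (1 - m))"
    using D(2) n by simp
qed

text \<open>
  Coordinates are rotated so that the point under consideration is \<open>(A, 0, 0)\<close>; \<open>A\<close> and \<open>B\<close> are
  \<open>R + r\<close> and \<open>R - r\<close> in either order. The polynomial \<open>H\<close> below is
  \<open>(1 + s\<^sup>2)\<^sup>2 (1 + t\<^sup>2)\<^sup>2 Q\<close> at \<open>x = \<rho> (1 - s\<^sup>2) / (1 + s\<^sup>2)\<close>,
  \<open>y = 2 \<rho> s / (1 + s\<^sup>2)\<close>, \<open>z = (A - B) t / (1 + t\<^sup>2)\<close>, where
  \<open>\<rho> = (A + B t\<^sup>2) / (1 + t\<^sup>2)\<close>; its outer variable is \<open>t\<close>.
\<close>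

locale torus_quadric =
  fixes A B a b d e f g h i j :: real
  assumes A: "A > 0" and B: "B > 0" and AB: "A \<noteq> B"
    and q1_P: "e * A + i = 0" and q0_P: "a * A\<^sup>2 + g * A + j = 0" and dq0_P: "d * A + h = 0"
    and q1_nonzero: "e \<noteq> 0 \<or> f \<noteq> 0"
    and no_factor: "\<And>p q s p' q' s'.
      \<lbrakk>\<And>x y. e * x + f * y + i = - ((p * x + q * y + s) + (p' * x + q' * y + s'));
       \<And>x y. a * x\<^sup>2 + b * y\<^sup>2 + d * x * y + g * x + h * y + j
          = (p * x + q * y + s) * (p' * x + q' * y + s')\<rbrakk> \<Longrightarrow> False"
begin

definition HA :: "real \<Rightarrow> real poly" where
  "HA k = [:k\<^sup>2 * a + k * g + j, 2 * d * k\<^sup>2 + 2 * h * k, k\<^sup>2 * (4 * b - 2 * a) + 2 * j,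
     - 2 * d * k\<^sup>2 + 2 * h * k, k\<^sup>2 * a - k * g + j:]"

definition HB :: "real \<Rightarrow> real poly" where
  "HB k = Polynomial.smult (A - B) [:e * k + i, 2 * f * k, 2 * i, 2 * f * k, i - e * k:]"

definition HC :: "real poly" where
  "HC = [:(A - B)\<^sup>2 + 2 * A * B * a + (A + B) * g + 2 * j, 4 * d * A * B + 2 * (A + B) * h,
     2 * (A - B)\<^sup>2 + 2 * A * B * (4 * b - 2 * a) + 4 * j, - 4 * d * A * B + 2 * (A + B) * h,
     (A - B)\<^sup>2 + 2 * A * B * a - (A + B) * g + 2 * j:]"

definition H :: "real poly poly" where
  "H = [:HA A, HB A, HC, HB B, HA B:]"

lemma H_coeffs [simp]:
  "coeff H 0 = HA A" "coeff H 1 = HB A" "coeff H (Suc 0) = HB A" "coeff H 2 = HC"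
  "coeff H 3 = HB B" "coeff H 4 = HA B"
  by (simp_all add: H_def numeral_eq_Suc)

lemma degree_H_le: "degree H \<le> 4"
  by (auto simp: H_def)

lemma poly_HA: "poly (HA k) s = k\<^sup>2 * (a * (1 - s\<^sup>2)\<^sup>2 + 4 * b * s\<^sup>2 + 2 * d * s * (1 - s\<^sup>2))
    + k * (g * (1 - s\<^sup>2) + 2 * h * s) * (1 + s\<^sup>2) + j * (1 + s\<^sup>2)\<^sup>2"
  by (simp add: HA_def) Groebner_Basis.algebra

lemma poly_HB: "poly (HB k) s = (A - B) * (1 + s\<^sup>2) * (k * (e * (1 - s\<^sup>2) + 2 * f * s) + i * (1 + s\<^sup>2))"
  by (simp add: HB_def) Groebner_Basis.algebra

lemma poly_HC: "poly HC s = (A - B)\<^sup>2 * (1 + s\<^sup>2)\<^sup>2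
    + 2 * A * B * (a * (1 - s\<^sup>2)\<^sup>2 + 4 * b * s\<^sup>2 + 2 * d * s * (1 - s\<^sup>2))
    + (A + B) * (g * (1 - s\<^sup>2) + 2 * h * s) * (1 + s\<^sup>2) + 2 * j * (1 + s\<^sup>2)\<^sup>2"
  by (simp add: HC_def) Groebner_Basis.algebra

lemma HB_A_nonzero: "HB A \<noteq> 0"
proof
  assume "HB A = 0"
  then have "f = 0" "i = 0" using A AB by (simp_all add: HB_def)
  then show False using q1_P A q1_nonzero by simp
qed

lemma H_nonzero: "H \<noteq> 0"
  using HB_A_nonzero by (simp add: H_def)

lemma H_critical:
  "coeff (coeff H 0) 0 = 0" "coeff (coeff H 0) 1 = 0" "coeff (coeff H 1) 0 = 0"
  using q1_P q0_P dq0_P A by (simp_all add: HA_def HB_def power2_eq_square) Groebner_Basis.algebra+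

section \<open>Exclusion of a repeated factor through the origin\<close>

lemma no_vertical_factor:
  assumes "H = [:p:] * K" "coeff p 0 = 0"
  shows "e = 0" "i = 0"
proof -
  \<comment> \<open>The coefficient of t^3 on the meridian s = 0 says that q1 vanishes there at
    radius \<open>B\<close>, as it does at radius \<open>A\<close>; an affine function of the radius
    with two zeros is zero.\<close>
  have "coeff (HB B) 0 = coeff (p * coeff K 3) 0"
    using arg_cong[OF assms(1), of "\<lambda>F. coeff F 3"] by simp
  then have "(A - B) * (e * B + i) = 0" using assms(2) by (simp add: HB_def coeff_mult)
  then have "e * B + i = 0" using AB by simp
  then have "e * (B - A) = 0" using q1_P by Groebner_Basis.algebra
  then show "e = 0" using AB by simp
  then show "i = 0" using q1_P by simp
qed

lemma double_factor_degree_0: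
  assumes "H = u * u * K" "eval2 u (0, 0) = 0" "degree u = 0"
  shows False
proof -
  obtain p where u: "u = [:p:]" using assms(3) by (meson degree_eq_zeroE)
  have p0: "coeff p 0 = 0" using assms(2) by (simp add: u eval2_pCons poly_0_coeff_0)
  have H: "H = [:p:] * ([:p:] * K)" by (simp add: assms(1) u mult.assoc)
  \<comment> \<open>A double factor in s also kills the coefficient of s t, which is 2 f A (A -
    B).\<close>
  have "coeff (HB A) 1 = coeff (p * (p * coeff K 1)) 1"
    using arg_cong[OF H, of "\<lambda>F. coeff F 1"] by (simp add: mult.assoc)
  also have "\<dots> = 0"
    using p0 by (simp add: coeff_mult)
  finally have "f = 0" using A AB by (simp add: HB_def)
  then show False using no_vertical_factor[OF H p0] q1_nonzero by simp
qed

text \<open>On every meridian circle the restriction is now a square up to a factor. The share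
  \<open>m\<close> of the double line turns out to be the same for infinitely many meridians and
  then to equal 1, so the quadric is the double plane (z + q1 / 2)^2.\<close>

lemma double_factor_degree_2:
  assumes "H = u * u * K" "degree u = 2"
  shows False
proof -
  have "K \<noteq> 0" "u \<noteq> 0" using H_nonzero assms(1) by auto
  then have "degree K = 0" using degree_H_le assms by (simp add: degree_mult_eq)
  then obtain k where K: "K = [:k:]" by (meson degree_eq_zeroE)
  obtain u0 u1 u2 where u: "u = [:u0, u1, u2:]"
    using poly2_coeffs[of u] assms(2) by auto
  have H: "HA A = k * u0\<^sup>2" "HB A = 2 * k * u0 * u1" "HC = k * (u1\<^sup>2 + 2 * u0 * u2)"
    "HB B = 2 * k * u1 * u2" "HA B = k * u2\<^sup>2"
    using assms(1) unfolding H_def K u by (simp_all add: power2_eq_square algebra_simps)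
  let ?n = "\<lambda>s::real. 1 + s\<^sup>2"
  let ?E = "\<lambda>s. e * (1 - s\<^sup>2) + 2 * f * s"
  let ?G = "\<lambda>s. g * (1 - s\<^sup>2) + 2 * h * s"
  let ?L = "\<lambda>s. a * (1 - s\<^sup>2)\<^sup>2 + 4 * b * s\<^sup>2 + 2 * d * s * (1 - s\<^sup>2)"
  define m where "m s = poly k s * (poly u1 s)\<^sup>2 / ((A - B)\<^sup>2 * (?n s)\<^sup>2)" for s
  have n: "?n s \<noteq> 0" for s :: real
    by (metis add_pos_nonneg less_numeral_extra(1) less_irrefl zero_le_power2)
  have pen: "(?E s)\<^sup>2 = 4 * m s * (?L s - (?n s)\<^sup>2 + m s * (?n s)\<^sup>2)"
      "i\<^sup>2 = 4 * m s * (j - A * B + A * B * m s)"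
      "?E s * i = 2 * m s * (?G s + (A + B) * ?n s * (1 - m s))" for s
  proof -
    have e0: "A\<^sup>2 * ?L s + A * ?G s * ?n s + j * (?n s)\<^sup>2 = poly k s * (poly u0 s)\<^sup>2"
      using arg_cong[OF H(1), of "\<lambda>p. poly p s"] by (simp add: poly_HA)
    have e4: "B\<^sup>2 * ?L s + B * ?G s * ?n s + j * (?n s)\<^sup>2 = poly k s * (poly u2 s)\<^sup>2"
      using arg_cong[OF H(5), of "\<lambda>p. poly p s"] by (simp add: poly_HA)
    have e1: "(A - B) * ?n s * (A * ?E s + i * ?n s) = 2 * poly k s * poly u0 s * poly u1 s"
      using arg_cong[OF H(2), of "\<lambda>p. poly p s"] by (simp add: poly_HB)
    have e3: "(A - B) * ?n s * (B * ?E s + i * ?n s) = 2 * poly k s * poly u1 s * poly u2 s"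
      using arg_cong[OF H(4), of "\<lambda>p. poly p s"] by (simp add: poly_HB)
    have e2: "(A - B)\<^sup>2 * (?n s)\<^sup>2 + 2 * A * B * ?L s + (A + B) * ?G s * ?n s + 2 * j * (?n s)\<^sup>2
        = poly k s * ((poly u1 s)\<^sup>2 + 2 * poly u0 s * poly u2 s)"
      using arg_cong[OF H(3), of "\<lambda>p. poly p s"] by (simp add: poly_HC)
    note * = double_contact_pencil[OF refl _ n e0 e1 e2 e3 e4 m_def]
    show "(?E s)\<^sup>2 = 4 * m s * (?L s - (?n s)\<^sup>2 + m s * (?n s)\<^sup>2)"
      "i\<^sup>2 = 4 * m s * (j - A * B + A * B * m s)"
      "?E s * i = 2 * m s * (?G s + (A + B) * ?n s * (1 - m s))"
      using * AB by simp_all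
  qed
  \<comment> \<open>Where \<open>?E\<close> does not vanish, the first identity of
    \<open>pen\<close> makes the share nonzero.\<close>
  define S where "S = {s. poly [:e, 2 * f, - e:] s \<noteq> 0}"
  have "infinite S"
    unfolding S_def using q1_nonzero by (intro infinite_nonroots) auto
  have S: "?E s \<noteq> 0" if "s \<in> S" for s
    using that by (simp add: S_def power2_eq_square algebra_simps)
  have "m ` S \<subseteq> {t. poly [:- i\<^sup>2, 4 * (j - A * B), 4 * (A * B):] t = 0}"
    using pen(2) by (auto simp: algebra_simps)
  moreover have "finite {t. poly [:- i\<^sup>2, 4 * (j - A * B), 4 * (A * B):] t = 0}"
    using A B by (intro poly_roots_finite) simp
  ultimately have "finite (m ` S)" by (rule finite_subset)
  \<comment> \<open>The second identity of \<open>pen\<close> is a quadratic equation for the share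
    with coefficients independent of the angle. So there are finitely many values, and one of them
    is taken infinitely often.\<close>
  then obtain s0 where s0: "s0 \<in> S" "infinite {s \<in> S. m s = m s0}"
    using pigeonhole_infinite \<open>infinite S\<close> by blast
  let ?m = "m s0"
  have m0: "?m \<noteq> 0" using pen(1)[of s0] S[OF s0(1)] by auto
  have 1: "[:e * i, 2 * f * i, - e * i:] =
      [:2 * ?m * (g + (A + B) * (1 - ?m)), 4 * ?m * h, 2 * ?m * (- g + (A + B) * (1 - ?m)):]"
  proof (rule poly_eqI_infinite[OF s0(2)])
    fix s assume "s \<in> {s \<in> S. m s = ?m}"
    then have "?E s * i = 2 * ?m * (?G s + (A + B) * ?n s * (1 - ?m))" using pen(3)[of s] by simp
    then show "poly [:e * i, 2 * f * i, - e * i:] s =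
      poly [:2 * ?m * (g + (A + B) * (1 - ?m)), 4 * ?m * h, 2 * ?m * (- g + (A + B) * (1 - ?m)):] s"
      by simp Groebner_Basis.algebra
  qed
  \<comment> \<open>Sum of the first and the last coefficient, in which e i and g cancel.\<close>
  then have "4 * ?m * ((A + B) * (1 - ?m)) = 0" by (simp add: algebra_simps)
  then have m1: "?m = 1" using m0 A B by simp
  have 2: "[:e\<^sup>2, 4 * e * f, 4 * f\<^sup>2 - 2 * e\<^sup>2, - 4 * e * f, e\<^sup>2:] =
      [:4 * a, 8 * d, 16 * b - 8 * a, - 8 * d, 4 * a:]"
  proof (rule poly_eqI_infinite[OF s0(2)])
    fix s assume "s \<in> {s \<in> S. m s = ?m}"
    then have "(?E s)\<^sup>2 = 4 * ?L s" using pen(1)[of s] m1 by simp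
    then show "poly [:e\<^sup>2, 4 * e * f, 4 * f\<^sup>2 - 2 * e\<^sup>2, - 4 * e * f, e\<^sup>2:] s =
      poly [:4 * a, 8 * d, 16 * b - 8 * a, - 8 * d, 4 * a:] s"
      by simp Groebner_Basis.algebra
  qed
  have q: "e\<^sup>2 = 4 * a" "f\<^sup>2 = 4 * b" "e * f = 2 * d" "e * i = 2 * g" "f * i = 2 * h" "i\<^sup>2 = 4 * j"
    using 1 2 m1 pen(2)[of s0] by auto
  show False
  proof (rule no_factor[of "- e / 2" "- f / 2" "- i / 2" "- e / 2" "- f / 2" "- i / 2"])
    fix x y
    show "e * x + f * y + i = - ((- e / 2 * x + - f / 2 * y + - i / 2) + (- e / 2 * x + - f / 2 * y + - i / 2))"
      by (simp add: field_simps)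
    have "4 * (a * x\<^sup>2 + b * y\<^sup>2 + d * x * y + g * x + h * y + j) = (e * x + f * y + i)\<^sup>2"
      using q by Groebner_Basis.algebra
    then show "a * x\<^sup>2 + b * y\<^sup>2 + d * x * y + g * x + h * y + j =
        (- e / 2 * x + - f / 2 * y + - i / 2) * (- e / 2 * x + - f / 2 * y + - i / 2)"
      by (simp add: field_simps power2_eq_square)
  qed
qed

lemma eval2_H:
  "eval2 H (s, t) = (1 + s\<^sup>2)\<^sup>2 * ((A - B) * t)\<^sup>2
    + ((A + B * t\<^sup>2) * (e * (1 - s\<^sup>2) + 2 * f * s) + i * (1 + s\<^sup>2) * (1 + t\<^sup>2)) * (1 + s\<^sup>2) * ((A - B) * t)
    + (A + B * t\<^sup>2)\<^sup>2 * (a * (1 - s\<^sup>2)\<^sup>2 + 4 * b * s\<^sup>2 + 2 * d * s * (1 - s\<^sup>2))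
    + (A + B * t\<^sup>2) * (g * (1 - s\<^sup>2) + 2 * h * s) * (1 + s\<^sup>2) * (1 + t\<^sup>2)
    + j * (1 + s\<^sup>2)\<^sup>2 * (1 + t\<^sup>2)\<^sup>2"
proof -
  have "eval2 H (s, t) = poly (HA A) s + t * (poly (HB A) s + t * (poly HC s + t * (poly (HB B) s + t * poly (HA B) s)))"
    unfolding H_def by (simp add: eval2_pCons)
  then show ?thesis
    unfolding poly_HA poly_HB poly_HC by Groebner_Basis.algebra
qed

text \<open>On the line t = l s one has A + B t^2 = A (1 + s^2), so it is a Villarceau circle, lying
  in the plane z = v y with v = (A - B) l / (2 A). If the quadric touches the torus along this
  circle, it splits off that plane.\<close>

lemma villarceau_factor:
  assumes H: "H = u * u * K" and l: "A = l\<^sup>2 * B" and u: "\<And>s. eval2 u (s, l * s) = 0"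
  shows False
proof -
  have l0: "l \<noteq> 0" using l A by auto
  have l1: "l\<^sup>2 \<noteq> 1" using l AB by auto
  have lp: "1 + l\<^sup>2 \<noteq> 0"
    by (metis add_pos_nonneg less_numeral_extra(1) less_irrefl zero_le_power2)
  define N where "N s = 1 + l\<^sup>2 * s\<^sup>2" for s
  define G where "G s = (A - B)\<^sup>2 * l\<^sup>2 * s\<^sup>2 + (e * A * (1 - s\<^sup>2) + 2 * f * A * s + i * N s) * (A - B) * l * s
    + A\<^sup>2 * (a * (1 - s\<^sup>2)\<^sup>2 + 4 * b * s\<^sup>2 + 2 * d * s * (1 - s\<^sup>2))
    + A * (g * (1 - s\<^sup>2) + 2 * h * s) * N s + j * (N s)\<^sup>2" for s
  have "G s = 0" for s
  proof -
    have "0 = eval2 H (s, l * s)" using u[of s] by (simp add: H)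
    also have "\<dots> = (1 + s\<^sup>2)\<^sup>2 * G s"
    proof -
      have AB_l: "A + B * (l * s)\<^sup>2 = A * (1 + s\<^sup>2)"
      proof -
        have "A + B * (l * s)\<^sup>2 = A + (l\<^sup>2 * B) * s\<^sup>2" by Groebner_Basis.algebra
        then show ?thesis unfolding l[symmetric] by (simp add: algebra_simps)
      qed
      show ?thesis
        unfolding eval2_H G_def N_def AB_l by Groebner_Basis.algebra
    qed
    finally show "G s = 0"
      by (metis add_pos_nonneg less_numeral_extra(1) less_irrefl mult_eq_0_iff power_eq_0_iff zero_le_power2)
  qed
  moreover have "G s = poly [:A\<^sup>2 * a + A * g + j, (A - B) * l * (e * A + i) + 2 * d * A\<^sup>2 + 2 * h * A,
      (A - B)\<^sup>2 * l\<^sup>2 + 2 * f * A * (A - B) * l + A\<^sup>2 * (4 * b - 2 * a) + A * g * (l\<^sup>2 - 1) + 2 * j * l\<^sup>2,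
      (A - B) * l * (i * l\<^sup>2 - e * A) - 2 * d * A\<^sup>2 + 2 * h * A * l\<^sup>2,
      A\<^sup>2 * a - A * g * l\<^sup>2 + j * l ^ 4:] s" for s
    unfolding G_def N_def by simp Groebner_Basis.algebra
  ultimately have c: "coeff [:A\<^sup>2 * a + A * g + j, (A - B) * l * (e * A + i) + 2 * d * A\<^sup>2 + 2 * h * A,
      (A - B)\<^sup>2 * l\<^sup>2 + 2 * f * A * (A - B) * l + A\<^sup>2 * (4 * b - 2 * a) + A * g * (l\<^sup>2 - 1) + 2 * j * l\<^sup>2,
      (A - B) * l * (i * l\<^sup>2 - e * A) - 2 * d * A\<^sup>2 + 2 * h * A * l\<^sup>2,
      A\<^sup>2 * a - A * g * l\<^sup>2 + j * l ^ 4:] k = 0" for k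
    by (intro poly_coeffs_zero) simp
  have c0: "A\<^sup>2 * a + A * g + j = 0" using c[of 0] by simp
  have c2: "(A - B)\<^sup>2 * l\<^sup>2 + 2 * f * A * (A - B) * l + A\<^sup>2 * (4 * b - 2 * a) + A * g * (l\<^sup>2 - 1) + 2 * j * l\<^sup>2 = 0"
    using c[of 2] by (simp add: numeral_eq_Suc)
  have c3: "(A - B) * l * (i * l\<^sup>2 - e * A) - 2 * d * A\<^sup>2 + 2 * h * A * l\<^sup>2 = 0"
    using c[of 3] by (simp add: numeral_eq_Suc)
  have c4: "A\<^sup>2 * a - A * g * l\<^sup>2 + j * l ^ 4 = 0"
    using c[of 4] by (simp add: numeral_eq_Suc)
  have "(1 + l\<^sup>2) * (A * g + j * (1 - l\<^sup>2)) = 0" using c0 c4 by Groebner_Basis.algebra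
  then have g: "A * g = - j * (1 - l\<^sup>2)" using lp by (simp add: eq_neg_iff_add_eq_0)
  have a: "A\<^sup>2 * a = - j * l\<^sup>2" using c0 g by Groebner_Basis.algebra
  have "A * (1 + l\<^sup>2) * ((A - B) * l * e + 2 * d * A) = 0"
    using c3 q1_P dq0_P by Groebner_Basis.algebra
  then have "(A - B) * l * e + 2 * d * A = 0" using lp A by simp
  then have de: "2 * d * A = - (A - B) * l * e" by Groebner_Basis.algebra
  \<comment> \<open>Containing the circle expresses \<open>a\<close> and \<open>g\<close> by
    \<open>j\<close> but leaves \<open>j\<close> free. Tangency at the single further point s = 1
    forces it to vanish.\<close>
  have tang: "eval2 (pderiv H) (1, l) = 0"
    unfolding H using u[of 1] by (simp add: pderiv_mult)
  have "eval2 (pderiv H) (1, l) = poly (HB A) 1 + l * (2 * poly HC 1 + l * (3 * poly (HB B) 1 + l * (4 * poly (HA B) 1)))"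
    unfolding H_def by (simp add: pderiv_pCons eval2_pCons)
  then have "(A - B) * 2 * (A * 2 * f + 2 * i) + l * (2 * (4 * (A - B)\<^sup>2 + 8 * A * B * b + 4 * (A + B) * h + 8 * j)
      + l * (3 * ((A - B) * 2 * (B * 2 * f + 2 * i)) + l * (4 * (B\<^sup>2 * 4 * b + 4 * B * h + 4 * j)))) = 0"
    using tang unfolding poly_HA poly_HB poly_HC by (simp add: algebra_simps)
  then have t: "4 * (A - B) * f * A + (A - B) * i * (1 + 3 * l\<^sup>2) + 2 * l * (A - B)\<^sup>2 + 8 * l * A * B * b
      + 2 * l * h * (3 * A + B) + 4 * l * j * (1 + l\<^sup>2) = 0"
    using l by Groebner_Basis.algebra
  have hA: "2 * h * A = - ((A - B) * l * i)"
    using de dq0_P q1_P by Groebner_Basis.algebra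
  have t1: "2 * l\<^sup>2 * h * (3 * A + B) = - ((A - B) * l * i * (1 + 3 * l\<^sup>2))"
    using l hA by Groebner_Basis.algebra
  have t2: "(A - B)\<^sup>2 * l\<^sup>2 + 2 * f * A * (A - B) * l + 4 * A\<^sup>2 * b = - (j * (1 + l\<^sup>2)\<^sup>2)"
    using c2 g a by Groebner_Basis.algebra
  have "4 * (A - B) * f * A * l + (A - B) * i * l * (1 + 3 * l\<^sup>2) + 2 * l\<^sup>2 * (A - B)\<^sup>2 + 8 * A\<^sup>2 * b
      + 2 * l\<^sup>2 * h * (3 * A + B) + 4 * l\<^sup>2 * j * (1 + l\<^sup>2) = 0"
    using t l by Groebner_Basis.algebra
  then have "j * (1 + l\<^sup>2) * (l\<^sup>2 - 1) = 0"
    using t1 t2 by Groebner_Basis.algebra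
  then have j: "j = 0" using lp l1 by simp
  then have a0: "a = 0" and g0: "g = 0" using a g A by simp_all
  define v where "v = (A - B) * l / (2 * A)"
  have v: "2 * A * v = (A - B) * l" using A by (simp add: v_def)
  have v1: "d = - v * e" 
  proof -
    have "A * (d + v * e) = 0" using v de by Groebner_Basis.algebra
    then show ?thesis using A by simp
  qed
  have v2: "h = - v * i" using v1 q1_P dq0_P by Groebner_Basis.algebra
  have v3: "b = - v\<^sup>2 - v * f"
  proof -
    have "4 * A\<^sup>2 * (b + v\<^sup>2 + v * f) = 0"
      using c2 v j a0 g0 by Groebner_Basis.algebra
    then show ?thesis using A by simp
  qed
  show False
  proof (rule no_factor[of 0 v 0 "- e" "- f - v" "- i"])
    fix x y
    show "e * x + f * y + i = - ((0 * x + v * y + 0) + (- e * x + (- f - v) * y + - i))"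
      by (simp add: algebra_simps)
    show "a * x\<^sup>2 + b * y\<^sup>2 + d * x * y + g * x + h * y + j = (0 * x + v * y + 0) * (- e * x + (- f - v) * y + - i)"
      unfolding a0 g0 j v1 v2 v3 by Groebner_Basis.algebra
  qed
qed

text \<open>
  For \<open>t = \<i> m\<close> the distance to the axis vanishes, so that the pull-back of the quadric
  is constant in the angle \<open>s\<close>.
\<close>

definition node_value :: "real \<Rightarrow> complex" where
  "node_value m = Complex (j * (1 - m\<^sup>2)\<^sup>2 - (A - B)\<^sup>2 * m\<^sup>2) ((A - B) * m * i * (1 - m\<^sup>2))"

lemma H_at_node:
  assumes m: "A = m\<^sup>2 * B" and J: "J = [:\<i> * of_real m:]"
  shows "cpoly (HA A) + J * cpoly (HB A) + J\<^sup>2 * cpoly HC + J ^ 3 * cpoly (HB B) + J ^ 4 * cpoly (HA B)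
    = [:node_value m:] * [:- \<i>, 1:]\<^sup>2 * [:\<i>, 1:]\<^sup>2"
proof -
  have "[:node_value m:] * [:- \<i>, 1:]\<^sup>2 * [:\<i>, 1:]\<^sup>2 = Polynomial.smult (node_value m) [:1, 0, 2, 0, 1:]"
    by (simp add: power2_eq_square)
  moreover have "J\<^sup>2 = [:- (of_real m)\<^sup>2:]" "J ^ 3 = [:- \<i> * (of_real m) ^ 3:]" "J ^ 4 = [:(of_real m) ^ 4:]"
    by (simp_all add: J power2_eq_square power3_eq_cube power4_eq_xxxx complex_eq_iff)
  moreover have "cpoly (HA A) + [:\<i> * of_real m:] * cpoly (HB A) + [:- (of_real m)\<^sup>2:] * cpoly HC
      + [:- \<i> * (of_real m) ^ 3:] * cpoly (HB B) + [:(of_real m) ^ 4:] * cpoly (HA B)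
    = Polynomial.smult (node_value m) [:1, 0, 2, 0, 1:]"
    unfolding HA_def HB_def HC_def node_value_def
    apply (simp add: complex_eq_iff flip: of_real_power)
    unfolding m
    apply (intro conjI; (Groebner_Basis.algebra | simp add: power2_eq_square power3_eq_cube))
    done
  ultimately show ?thesis by (simp add: J)
qed

text \<open>\<open>node_value m\<close> is (1 - m^2)^2 times the value of Q at a point (0, 0, z)
  with z^2 = - A B, a double point of the complex torus. Its real part measures j - A B and its
  imaginary part \<open>i\<close>.\<close>

lemma node_value_zero:
  assumes m: "A = m\<^sup>2 * B" and z: "node_value m = 0"
  shows "i = 0" "j = A * B"
proof -
  have m0: "m \<noteq> 0" using m A by auto
  have m1: "1 - m\<^sup>2 \<noteq> 0" using m AB by auto
  show "i = 0" using z m0 m1 AB by (simp add: node_value_def complex_eq_iff)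
  have "j * (1 - m\<^sup>2)\<^sup>2 - (A - B)\<^sup>2 * m\<^sup>2 = 0"
    using z by (simp add: node_value_def complex_eq_iff)
  then have "B\<^sup>2 * (j * (1 - m\<^sup>2)\<^sup>2 - (A - B)\<^sup>2 * m\<^sup>2) = 0" by simp
  moreover have "B\<^sup>2 * (j * (1 - m\<^sup>2)\<^sup>2 - (A - B)\<^sup>2 * m\<^sup>2) = (A - B)\<^sup>2 * (j - A * B)"
    unfolding m by Groebner_Basis.algebra
  ultimately show "j = A * B" using AB by simp
qed

text \<open>When the quadric passes through both double points, \<open>H\<close> has the factor A +
  B t^2, which is nonzero at the origin and so prime to \<open>u\<close>. The quotient
  \<open>H'\<close> is quadratic in t and must be a multiple of the square of \<open>u\<close>, so
  its discriminant vanishes.\<close>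

lemma double_factor_through_nodes:
  assumes i: "i = 0" and j: "j = A * B"
    and H: "H = u * u * K" and u: "prime_elem u" "eval2 u (0, 0) = 0" "degree u = 1"
  shows False
proof -
  have e: "e = 0" using q1_P i A by simp
  then have f: "f \<noteq> 0" using q1_nonzero by simp
  define G where "G k l = [:a * k + g + l, 2 * d * k + 2 * h, k * (4 * b - 2 * a) + 2 * l,
    - 2 * d * k + 2 * h, a * k - g + l:]" for k l
  define G1 where "G1 = [:0, 2 * (A - B) * f, 0, 2 * (A - B) * f:]"
  define Rh :: "real poly poly" where "Rh = [:[:A:], 0, [:B:]:]"
  define H' where "H' = [:G A B, G1, G B A:]"
  have HR: "H = Rh * H'"
    unfolding H_def Rh_def H'_def HA_def HB_def HC_def G_def G1_def
    by (simp add: i j e algebra_simps power2_eq_square)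
  have nd: "\<not> u dvd Rh"
  proof
    assume "u dvd Rh"
    then have "eval2 Rh (0, 0) = 0" using u(2) by (auto simp: dvd_def)
    then show False using A by (simp add: Rh_def eval2_pCons)
  qed
  have "u dvd Rh * H'" using H HR by (metis dvd_triv_left mult.assoc)
  then obtain H'' where H'': "H' = u * H''" using nd u(1) by (meson dvdE prime_elem_dvd_multD)
  have u0: "u \<noteq> 0" using u(1) by auto
  have "u * (u * K) = u * (Rh * H'')" using H HR H'' by (metis mult.assoc mult.left_commute)
  then have "u * K = Rh * H''" using u0 by simp
  then have "u dvd Rh * H''" by (metis dvd_triv_left)
  then obtain K' where "H'' = u * K'" using nd u(1) by (meson dvdE prime_elem_dvd_multD)
  with H'' have K': "H' = u * u * K'" by (simp add: mult.assoc)
  have "H' \<noteq> 0" using HR H_nonzero by auto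
  then have "K' \<noteq> 0" using K' by auto
  have "degree H' \<le> 2" by (auto simp: H'_def)
  then have "degree K' = 0" using K' u0 \<open>K' \<noteq> 0\<close> u(3) by (simp add: degree_mult_eq)
  then obtain k where k: "K' = [:k:]" by (meson degree_eq_zeroE)
  define u0 u1 where "u0 = coeff u 0" and "u1 = coeff u 1"
  have ueq: "u = [:u0, u1:]"
    using poly2_coeffs[of u] u(3) by (simp add: u0_def u1_def coeff_eq_0)
  have "G A B = k * u0\<^sup>2" "G1 = 2 * k * u0 * u1" "G B A = k * u1\<^sup>2"
    using K' unfolding H'_def k ueq by (simp_all add: power2_eq_square algebra_simps)
  then have disc: "G1 * G1 = 4 * G A B * G B A"
    by (simp add: power2_eq_square)
  have cdisc: "cpoly G1 * cpoly G1 = cpoly [:4:] * cpoly (G A B) * cpoly (G B A)"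
    using arg_cong[OF disc, of cpoly] by (simp only: cpoly_mult numeral_poly)
  \<comment> \<open>At s = i the quadratic part of q0 is evaluated at a multiple of the isotropic
    vector (1, i), where it vanishes only if it is a multiple of x^2 + y^2.\<close>
  have "poly (cpoly G1) \<i> = 0"
    by (simp add: G1_def complex_eq_iff)
  then have "poly (cpoly (G A B)) \<i> * poly (cpoly (G B A)) \<i> = 0"
    using arg_cong[OF cdisc, of "\<lambda>p. poly p \<i>"] by simp
  moreover have "poly (cpoly (G k l)) \<i> = of_real k * Complex (4 * (a - b)) (4 * d)" for k l
    by (simp add: G_def complex_eq_iff algebra_simps)
  ultimately have ab: "a = b" "d = 0" using A B by (auto simp: complex_eq_iff)
  then have h: "h = 0" using dq0_P by simp
  have g: "a * A + g + B = 0"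
  proof -
    have "A * (a * A + g + B) = 0" using q0_P j by Groebner_Basis.algebra
    then show ?thesis using A by simp
  qed
  define M where "M = a * B + A"
  \<comment> \<open>The discriminant condition now reads (A - B)^2 f^2 = - 2 g (M (1 + s^2) + g (1 -
    s^2)) for s nonzero. Its cases s = 1 and s = 2 agree only if g (M - g) = 0.\<close>
  have 1: "(A - B)\<^sup>2 * f\<^sup>2 = - 4 * g * M"
  proof -
    have "16 * ((A - B)\<^sup>2 * f\<^sup>2) = 4 * (4 * (a * A + B)) * (4 * M)"
      using arg_cong[OF disc, of "\<lambda>p. poly p 1"]
      by (simp add: G1_def G_def ab(1)[symmetric] ab(2) h M_def power2_eq_square algebra_simps)
    then show ?thesis using g by Groebner_Basis.algebra
  qed
  have 2: "(A - B)\<^sup>2 * f\<^sup>2 = - 2 * g * (5 * M - 3 * g)"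
  proof -
    have "400 * ((A - B)\<^sup>2 * f\<^sup>2) = 4 * (25 * (a * A + B) - 15 * g) * (25 * M - 15 * g)"
      using arg_cong[OF disc, of "\<lambda>p. poly p 2"]
      by (simp add: G1_def G_def ab(1)[symmetric] ab(2) h M_def power2_eq_square algebra_simps)
    then show ?thesis using g by Groebner_Basis.algebra
  qed
  have "g * (M - g) = 0" using 1 2 by Groebner_Basis.algebra
  then have "(A - B)\<^sup>2 * f\<^sup>2 = - (4 * g\<^sup>2)" using 1 by (auto simp: power2_eq_square)
  moreover have "(A - B)\<^sup>2 * f\<^sup>2 > 0" using AB f by simp
  ultimately show False using zero_le_power2[of g] by linarith
qed

text \<open>The restriction \<open>U\<close> of \<open>u\<close> to t = i m is a constant times (s -
  i)^x (s + i)^y, and x, y are at most 1 because the square of \<open>U\<close> divides the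
  restriction of \<open>H\<close>. As \<open>u0\<close> vanishes at 0, equal exponents give
  \<open>u0 = 0\<close>, and unequal ones a Villarceau circle.\<close>

lemma double_factor_degree_1:
  assumes H: "H = u * u * K" and u: "prime_elem u" "eval2 u (0, 0) = 0" "degree u = 1"
  shows False
proof -
  define m where "m = sqrt (A / B)"
  have m: "m > 0" "A = m\<^sup>2 * B" using A B by (simp_all add: m_def)
  define C where "C = node_value m"
  have C: "C \<noteq> 0"
    using node_value_zero[OF m(2)] double_factor_through_nodes[OF _ _ H u] by (auto simp: C_def)
  define J where "J = [:\<i> * of_real m:]"
  define u0 u1 where "u0 = coeff u 0" and "u1 = coeff u 1"
  have ueq: "u = [:u0, u1:]"
    using poly2_coeffs[of u] u(3) by (simp add: u0_def u1_def coeff_eq_0)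
  have u00: "poly u0 0 = 0" using u(2) by (simp add: ueq eval2_pCons)
  have u0_nonzero: "u0 \<noteq> 0"
  proof
    assume "u0 = 0"
    then have "HB A = 0"
      using arg_cong[OF H, of "\<lambda>F. coeff F 1"] by (simp add: ueq coeff_mult)
    then show False using HB_A_nonzero by simp
  qed
  have "u \<noteq> 0" "K \<noteq> 0" using H H_nonzero by auto
  then have "degree K \<le> 2" using degree_H_le H u(3) by (simp add: degree_mult_eq)
  then obtain k0 k1 k2 where K: "K = [:k0, k1, k2:]" using poly2_coeffs by blast
  define U where "U = cpoly u0 + J * cpoly u1"
  define W where "W = cpoly k0 + J * cpoly k1 + J\<^sup>2 * cpoly k2"
  have Hc: "HA A = u0 * u0 * k0" "HB A = (u0 * u1 + u0 * u1) * k0 + u0 * u0 * k1"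
    "HC = u1 * u1 * k0 + (u0 * u1 + u0 * u1) * k1 + u0 * u0 * k2"
    "HB B = u1 * u1 * k1 + (u0 * u1 + u0 * u1) * k2" "HA B = u1 * u1 * k2"
    using H unfolding H_def ueq K by (simp_all add: algebra_simps)
  have "U * (U * W) = cpoly (HA A) + J * cpoly (HB A) + J\<^sup>2 * cpoly HC + J ^ 3 * cpoly (HB B) + J ^ 4 * cpoly (HA B)"
    unfolding Hc U_def W_def cpoly_add cpoly_mult by Groebner_Basis.algebra
  also have "\<dots> = [:C:] * [:- \<i>, 1:]\<^sup>2 * [:\<i>, 1:]\<^sup>2"
    unfolding C_def by (rule H_at_node[OF m(2) J_def])
  finally obtain x y x' y' k l where *: "k * l = [:C:]" "x + x' = 2" "y + y' = 2"
      "U = k * [:- \<i>, 1:] ^ x * [:\<i>, 1:] ^ y" "U * W = l * [:- \<i>, 1:] ^ x' * [:\<i>, 1:] ^ y'"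
    using prime_powers_factor[OF prime_elem_linear_complex prime_elem_linear_complex] by blast
  have "k \<noteq> 0" "l \<noteq> 0" using *(1) C by auto
  then have deg: "degree k = 0" "degree l = 0"
    using arg_cong[OF *(1), of degree] by (auto simp: degree_mult_eq)
  then obtain w w' where w: "k = [:w:]" "l = [:w':]" by (meson degree_eq_zeroE)
  have w0: "w' \<noteq> 0" using w \<open>l \<noteq> 0\<close> by simp
  have "x \<le> 1"
  proof (rule ccontr)
    assume "\<not> x \<le> 1"
    then have x: "x = 2" "x' = 0" using *(2) by auto
    then have "poly U \<i> = 0" by (simp add: *(4))
    then have "poly (l * [:- \<i>, 1:] ^ x' * [:\<i>, 1:] ^ y') \<i> = 0" by (simp flip: *(5))
    then show False using x w0 by (simp add: w)
  qed
  have "y \<le> 1"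
  proof (rule ccontr)
    assume "\<not> y \<le> 1"
    then have y: "y = 2" "y' = 0" using *(3) by auto
    then have "poly U (- \<i>) = 0" by (simp add: *(4))
    then have "poly (l * [:- \<i>, 1:] ^ x' * [:\<i>, 1:] ^ y') (- \<i>) = 0" by (simp flip: *(5))
    moreover have "- \<i> - \<i> \<noteq> (0 :: complex)" by (simp add: complex_eq_iff)
    ultimately show False using y w0 by (simp add: w)
  qed
  have Us: "of_real (poly u0 s) + \<i> * of_real m * of_real (poly u1 s)
      = w * (of_real s - \<i>) ^ x * (of_real s + \<i>) ^ y" for s
    using arg_cong[OF *(4), of "\<lambda>p. poly p (of_real s)"] by (simp add: U_def J_def w add.commute)
  have re: "poly u0 s = Re (w * (of_real s - \<i>) ^ x * (of_real s + \<i>) ^ y)"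
    and im: "m * poly u1 s = Im (w * (of_real s - \<i>) ^ x * (of_real s + \<i>) ^ y)" for s
    using arg_cong[OF Us[of s], of Re] arg_cong[OF Us[of s], of Im] by simp_all
  have zero: False if "\<And>s. poly u0 s = 0"
    using that u0_nonzero by (metis poly_all_0_iff_0)
  consider "x = y" | "x = 1" "y = 0" | "x = 0" "y = 1"
    using \<open>x \<le> 1\<close> \<open>y \<le> 1\<close> by linarith
  then show False
  proof cases
    case 1
    have p: "((of_real s - \<i>) * (of_real s + \<i>)) ^ x = of_real ((s\<^sup>2 + 1) ^ x)" for s :: real
      by (simp add: algebra_simps power2_eq_square)
    have "poly u0 s = Re w * (s\<^sup>2 + 1) ^ x" for s
      unfolding re 1[symmetric] mult.assoc power_mult_distrib[symmetric] p
      by (simp del: of_real_power)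
    moreover from this[of 0] have "Re w = 0" using u00 by simp
    ultimately show False by (intro zero) simp
  next
    case 2
    have r: "poly u0 s = Re w * s + Im w" "m * poly u1 s = Im w * s - Re w" for s
      using re[of s] im[of s] 2 by (simp_all add: algebra_simps)
    have "Im w = 0" using r(1)[of 0] u00 by simp
    moreover have "eval2 u (s, m * s) = poly u0 s + s * (m * poly u1 s)" for s
      by (simp add: ueq eval2_pCons algebra_simps)
    ultimately have "eval2 u (s, m * s) = 0" for s
      by (simp add: r)
    then show False using villarceau_factor[OF H, of m] m by simp
  next
    case 3
    have r: "poly u0 s = Re w * s - Im w" "m * poly u1 s = Im w * s + Re w" for s
      using re[of s] im[of s] 3 by (simp_all add: algebra_simps)
    have "Im w = 0" using r(1)[of 0] u00 by simp
    moreover have "eval2 u (s, - m * s) = poly u0 s - s * (m * poly u1 s)" for s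
      by (simp add: ueq eval2_pCons algebra_simps)
    ultimately have "eval2 u (s, - m * s) = 0" for s
      by (simp add: r)
    then show False using villarceau_factor[OF H, of "- m"] m by simp
  qed
qed

lemma no_double_factor:
  assumes "prime_elem u" "eval2 u (0, 0) = 0" "u * u dvd H"
  shows False
proof -
  obtain K where K: "H = u * u * K" using assms(3) by blast
  have "u \<noteq> 0" "K \<noteq> 0" using K H_nonzero by auto
  then have "degree u \<le> 2" using degree_H_le K by (simp add: degree_mult_eq)
  then consider "degree u = 0" | "degree u = 1" | "degree u = 2" by linarith
  then show False
    using double_factor_degree_0[OF K assms(2)] double_factor_degree_1[OF K assms(1,2)]
      double_factor_degree_2[OF K] by cases
qed

section \<open>Exclusion of a factor with finitely many real zeros\<close>

lemma degree_coeff_H_le: "degree (coeff H k) \<le> 4"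
proof -
  have "degree (HA x) \<le> 4" "degree (HB x) \<le> 4" "degree HC \<le> 4" for x
    by (auto simp: HA_def HB_def HC_def intro: order_trans[OF degree_smult_le])
  then show ?thesis
    using coeff_eq_0[of H k] degree_H_le
    by (cases "k \<le> 4") (auto simp: H_def coeff_pCons split: nat.splits)
qed

lemma factor_with_finite_zeros:
  assumes H: "H = v * M" and M0: "coeff (coeff M 0) 0 = 0"
    and fin: "finite {P. eval2 v P = 0}" and v0: "eval2 v (0, 0) = 0"
  shows False
proof -
  have vM: "v \<noteq> 0" "M \<noteq> 0" using H H_nonzero by auto
  have v_00: "coeff (coeff v 0) 0 = 0"
    using v0 by (simp add: eval2_def poly_0_coeff_0)
  have v_01: "coeff (coeff v 0) 1 = 0" by (rule finite_zeros_partial_x[OF fin v0])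
  have v_10: "coeff (coeff v 1) 0 = 0" by (rule finite_zeros_partial_y[OF fin v0])
  \<comment> \<open>\<open>H\<close> has order at least 3 at the origin. The vanishing of its
    quadratic terms gives f = 0 and determines \<open>b\<close>, \<open>g\<close> and
    \<open>j\<close> in terms of \<open>a\<close>.\<close>
  note ord = coeff_coeff_mult_order[OF v_00 v_01 v_10 M0]
  have "coeff (HB A) 1 = 0" using ord(2) H by (metis H_coeffs(2))
  then have f: "f = 0" using A AB by (simp add: HB_def)
  then have e: "e \<noteq> 0" using q1_nonzero by simp
  then have i: "i \<noteq> 0" using q1_P A by auto
  have "coeff HC 0 = 0" using ord(3) H by (metis H_coeffs(4))
  then have hc: "(A - B)\<^sup>2 + 2 * A * B * a + (A + B) * g + 2 * j = 0" by (simp add: HC_def)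
  have "coeff (HA A) 2 = 0" using ord(1) H by (metis H_coeffs(1))
  then have ha: "A\<^sup>2 * (4 * b - 2 * a) + 2 * j = 0" by (simp add: HA_def numeral_eq_Suc)
  have g: "g = (A - B) - 2 * a * A"
  proof -
    have "(A - B) * ((A - B) - 2 * a * A - g) = 0" using hc q0_P by Groebner_Basis.algebra
    then show ?thesis using AB by simp
  qed
  have j: "j = a * A\<^sup>2 - (A - B) * A" using q0_P g by Groebner_Basis.algebra
  have b: "2 * b * A = A - B"
  proof -
    have "2 * A * (2 * b * A - (A - B)) = 0" using ha j by Groebner_Basis.algebra
    then show ?thesis using A by simp
  qed
  then have b0: "b \<noteq> 0" using AB by auto
  have h: "h = - d * A" using dq0_P by simp
  have ie: "i = - e * A" using q1_P by simp

  \<comment> \<open>The degree of \<open>v\<close> in t is even and positive, and that of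
    \<open>H\<close> is at most 4. So \<open>v\<close> has degree 2 unless \<open>M\<close> is free
    of t.\<close>
  have "degree v + degree M = degree H" using H vM by (simp add: degree_mult_eq)
  moreover have "even (degree v)" "degree v \<noteq> 0"
    using finite_zeros_even_degree[OF fin] finite_zeros_degree_pos[OF fin v0] by auto
  ultimately have "(degree v = 2 \<and> degree M \<le> 2) \<or> degree M = 0"
    using degree_H_le by presburger
  moreover have "degree M \<noteq> 0"
  proof
    assume "degree M = 0"
    then obtain p where p: "M = [:p:]" by (meson degree_eq_zeroE)
    have "H = [:p:] * v" "coeff p 0 = 0" using H p M0 by simp_all
    then show False using no_vertical_factor(1) e by blast
  qed
  ultimately have dv: "degree v = 2" "degree M \<le> 2" by auto
  obtain v0 v1 v2 where v: "v = [:v0, v1, v2:]" using poly2_coeffs[of v] dv by auto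
  obtain k0 k1 k2 where M: "M = [:k0, k1, k2:]" using poly2_coeffs[of M] dv by auto
  have Hc: "HA A = v0 * k0" "HB A = v0 * k1 + v1 * k0" "HC = v0 * k2 + v1 * k1 + v2 * k0"
    "HB B = v1 * k2 + v2 * k1" "HA B = v2 * k2"
    using H unfolding H_def v M by (simp_all add: algebra_simps)

  let ?sv = "swap2 v" and ?sM = "swap2 M"
  have sH: "swap2 H = ?sv * ?sM" by (simp add: H swap2_mult)
  have "degree (swap2 H) \<le> 4" by (rule degree_swap2_le) (rule degree_coeff_H_le)
  then have "degree ?sv + degree ?sM \<le> 4" using sH vM by (simp add: degree_mult_eq)
  moreover have "even (degree ?sv)"
    by (rule finite_zeros_even_degree[OF finite_zeros_swap2[OF fin]])
  moreover have "degree ?sv \<noteq> 0"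
    by (rule finite_zeros_degree_pos[OF finite_zeros_swap2[OF fin]]) (simp add: eval2_swap2 assms(4))
  ultimately have "(degree ?sv \<le> 2 \<and> degree ?sM \<le> 2) \<or> degree ?sM = 0" by presburger
  \<comment> \<open>Otherwise \<open>M\<close> depends on t alone and has the form c1 t + c2 t^2. At
    its root - c1 / c2 a whole parallel circle lies on the quadric. The conditions at the angles 0
    and pi, which are the coefficients of s^0 and s^4, force this root to be 0, and then
    \<open>HB A\<close> would vanish.\<close>
  moreover have "degree ?sM \<noteq> 0"
  proof
    assume "degree ?sM = 0"
    then have dM: "degree (coeff M k) = 0" for k using degree_coeff_le_swap2[of M k] by simp
    define c where "c k = coeff (coeff M k) 0" for k
    have c: "coeff M k = [:c k:]" for k
    proof -
      obtain x where "coeff M k = [:x:]" using dM[of k] by (meson degree_eq_zeroE)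
      then show ?thesis by (simp add: c_def)
    qed
    have k: "k0 = [:c 0:]" "k1 = [:c 1:]" "k2 = [:c 2:]"
      using c[of 0] c[of 1] c[of 2] by (simp_all add: M numeral_eq_Suc)
    have c0: "c 0 = 0" using M0 c[of 0] by simp
    have HA0: "HA A = 0" using Hc(1) by (simp add: k c0)
    then have "- 2 * d * A\<^sup>2 + 2 * h * A = 0" "A\<^sup>2 * a - A * g + j = 0"
      by (simp_all add: HA_def)
    then have "4 * A * (a * A) = 2 * A * (A - B)" using g j by Groebner_Basis.algebra
    then have aA: "2 * (a * A) = A - B" using A by simp
    then have g0: "g = 0" using g by simp
    have HB: "HB A = v0 * [:c 1:]" using Hc(2) by (simp add: k c0)
    have "coeff (HA B) 0 \<noteq> 0"
    proof
      assume "coeff (HA B) 0 = 0"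
      then have "B\<^sup>2 * a + B * g + j = 0" by (simp add: HA_def)
      then have "(A - B) * (A - B) * (A + B) = 0"
        using aA j g0 by Groebner_Basis.algebra
      then show False using A B AB by auto
    qed
    then have c2: "c 2 \<noteq> 0" using Hc(5) by (auto simp: k)
    define t where "t = - c 1 / c 2"
    have "eval2 M (s, t) = 0" for s
      using c2 by (simp add: M k eval2_pCons c0 t_def)
    then have "eval2 H (s, t) = 0" for s by (simp add: H)
    then have "poly (HA A + Polynomial.smult t (HB A) + Polynomial.smult (t\<^sup>2) HC
        + Polynomial.smult (t ^ 3) (HB B) + Polynomial.smult (t ^ 4) (HA B)) s = 0" for s
      by (simp add: H_def eval2_pCons algebra_simps power2_eq_square power3_eq_cube power4_eq_xxxx)
    then have "coeff (HA A + Polynomial.smult t (HB A) + Polynomial.smult (t\<^sup>2) HC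
        + Polynomial.smult (t ^ 3) (HB B) + Polynomial.smult (t ^ 4) (HA B)) n = 0" for n
      by (rule poly_coeffs_zero)
    from this[of 0] this[of 4]
    have "A\<^sup>2 * a + A * g + j + t * ((A - B) * (e * A + i)) + t\<^sup>2 * ((A - B)\<^sup>2 + 2 * A * B * a + (A + B) * g + 2 * j)
        + t ^ 3 * ((A - B) * (e * B + i)) + t ^ 4 * (B\<^sup>2 * a + B * g + j) = 0"
      "A\<^sup>2 * a - A * g + j + t * ((A - B) * (i - e * A)) + t\<^sup>2 * ((A - B)\<^sup>2 + 2 * A * B * a - (A + B) * g + 2 * j)
        + t ^ 3 * ((A - B) * (i - e * B)) + t ^ 4 * (B\<^sup>2 * a - B * g + j) = 0"
      by (simp_all add: HA_def HB_def HC_def numeral_eq_Suc)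
    then have "2 * (A - B) * e * t * (A + B * t\<^sup>2) = 0" using g0 by Groebner_Basis.algebra
    moreover have "A + B * t\<^sup>2 \<noteq> 0"
      using A B by (metis add_pos_nonneg less_irrefl mult_nonneg_nonneg less_imp_le zero_le_power2)
    ultimately have "t = 0" using AB e by simp
    then have "c 1 = 0" using c2 by (simp add: t_def)
    then show False using HB HB_A_nonzero by simp
  qed
  ultimately have dsv: "degree ?sv \<le> 2" "degree ?sM \<le> 2" by auto
  have deg_v: "degree (coeff v k) \<le> 2" and deg_M: "degree (coeff M k) \<le> 2" for k
    using degree_coeff_le_swap2[of v k] degree_coeff_le_swap2[of M k] dsv by auto
  have deg: "degree v0 \<le> 2" "degree v1 \<le> 2" "degree v2 \<le> 2" "degree k0 \<le> 2" "degree k1 \<le> 2" "degree k2 \<le> 2"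
    using deg_v[of 0] deg_v[of 1] deg_v[of 2] deg_M[of 0] deg_M[of 1] deg_M[of 2]
    by (simp_all add: v M numeral_eq_Suc)

  define m where "m = sqrt (A / B)"
  have m: "m > 0" "A = m\<^sup>2 * B" using A B by (simp_all add: m_def)
  define C where "C = node_value m"
  have C: "C \<noteq> 0" using node_value_zero(1)[OF m(2)] i by (auto simp: C_def)
  define J where "J = [:\<i> * of_real m:]"
  have J2: "J\<^sup>2 = [:- of_real (m\<^sup>2):]" by (simp add: J_def power2_eq_square complex_eq_iff)
  define U where "U = cpoly v0 + J * cpoly v1 + J\<^sup>2 * cpoly v2"
  define W where "W = cpoly k0 + J * cpoly k1 + J\<^sup>2 * cpoly k2"
  have UW: "U * W = [:C:] * [:- \<i>, 1:]\<^sup>2 * [:\<i>, 1:]\<^sup>2"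
  proof -
    have "U * W = cpoly (HA A) + J * cpoly (HB A) + J\<^sup>2 * cpoly HC + J ^ 3 * cpoly (HB B) + J ^ 4 * cpoly (HA B)"
      unfolding Hc U_def W_def cpoly_add cpoly_mult by Groebner_Basis.algebra
    then show ?thesis using H_at_node[OF m(2) J_def] by (simp only: C_def)
  qed
  then obtain x y x' y' k l where *: "k * l = [:C:]" "x + x' = 2" "y + y' = 2"
      "U = k * [:- \<i>, 1:] ^ x * [:\<i>, 1:] ^ y" "W = l * [:- \<i>, 1:] ^ x' * [:\<i>, 1:] ^ y'"
    using prime_powers_factor[OF prime_elem_linear_complex prime_elem_linear_complex] by blast
  have kl: "k \<noteq> 0" "l \<noteq> 0" using *(1) C by auto
  then have "degree k = 0" "degree l = 0"
    using arg_cong[OF *(1), of degree] by (auto simp: degree_mult_eq)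
  then obtain w w' where w: "k = [:w:]" "l = [:w':]" by (meson degree_eq_zeroE)
  have degU: "degree U = x + y" and degW: "degree W = x' + y'"
    using kl by (simp_all add: *(4,5) w degree_mult_eq degree_power_eq)
  have "degree U \<le> 2"
    unfolding U_def J2 unfolding J_def using deg
    by (intro degree_add_le) (auto intro: order_trans[OF degree_smult_le])
  moreover have "degree W \<le> 2"
    unfolding W_def J2 unfolding J_def using deg
    by (intro degree_add_le) (auto intro: order_trans[OF degree_smult_le])
  \<comment> \<open>The two degrees in s add up to 4 and neither exceeds 2.\<close>
  ultimately have "x + y = 2" using degU degW *(2,3) by linarith
  have re: "poly v0 s - m\<^sup>2 * poly v2 s = Re (w * (of_real s - \<i>) ^ x * (of_real s + \<i>) ^ y)"
    and im: "m * poly v1 s = Im (w * (of_real s - \<i>) ^ x * (of_real s + \<i>) ^ y)" for s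
  proof -
    have "of_real (poly v0 s) + \<i> * of_real m * of_real (poly v1 s) - of_real (m\<^sup>2) * of_real (poly v2 s)
      = w * (of_real s - \<i>) ^ x * (of_real s + \<i>) ^ y"
      using arg_cong[OF *(4), of "\<lambda>p. poly p (of_real s)"]
      unfolding U_def J2 by (simp add: J_def w add.commute)
    from arg_cong[OF this, of Re] arg_cong[OF this, of Im]
    show "poly v0 s - m\<^sup>2 * poly v2 s = Re (w * (of_real s - \<i>) ^ x * (of_real s + \<i>) ^ y)"
      "m * poly v1 s = Im (w * (of_real s - \<i>) ^ x * (of_real s + \<i>) ^ y)" by (simp_all del: of_real_power)
  qed
  have v10: "poly v1 0 = 0" using v_10 by (simp add: v poly_0_coeff_0)
  define c where "c = coeff v0 2"
  have v0c: "v0 = [:0, 0, c:]"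
    using poly2_coeffs[OF deg(1)] v_00 v_01 by (simp add: v c_def)

  text \<open>A double point over \<open>\<plusminus>\<i>\<close> makes the factor the square of a Villarceau circle.\<close>
  have villarceau: False
    if sg: "\<epsilon> = 1 \<or> \<epsilon> = - 1"
      and U: "\<And>s. w * (of_real s - \<i>) ^ x * (of_real s + \<i>) ^ y = w * (of_real s - of_real \<epsilon> * \<i>)\<^sup>2"
      and W0: "poly W (of_real \<epsilon> * \<i>) \<noteq> 0" and U0: "poly U (of_real \<epsilon> * \<i>) = 0" for \<epsilon> :: real
  proof -
    have r: "c * s\<^sup>2 - m\<^sup>2 * poly v2 s = Re w * (s\<^sup>2 - 1) + 2 * \<epsilon> * Im w * s"
      "m * poly v1 s = Im w * (s\<^sup>2 - 1) - 2 * \<epsilon> * Re w * s" for s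
      using re[of s] im[of s] sg unfolding U[of s] by (auto simp: v0c power2_eq_square algebra_simps)
    have w0: "Im w = 0" using r(2)[of 0] v10 by simp
    let ?r = "Re w"
    have v1: "v1 = [:0, - 2 * \<epsilon> * ?r / m:]"
      by (rule poly_eqI_infinite[OF infinite_UNIV_char_0])
        (use r(2) w0 m(1) in \<open>simp add: field_simps\<close>)
    have v2: "v2 = [:?r / m\<^sup>2, 0, (c - ?r) / m\<^sup>2:]"
      by (rule poly_eqI_infinite[OF infinite_UNIV_char_0])
        (use r(1) w0 m(1) in \<open>simp add: field_simps power2_eq_square\<close>)
    \<comment> \<open>At (s, t) = (\<open>?z\<close>, \<open>?y\<close>) the t-derivative of
      \<open>H\<close> vanishes. There \<open>U\<close> is zero and \<open>W\<close> is not, so by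
      the product rule the t-derivative of \<open>v\<close> vanishes too.\<close>
    let ?z = "of_real \<epsilon> * \<i>" and ?y = "\<i> * of_real m"
    have z: "poly (cpoly (HB k)) ?z = 0" for k
      using sg by (auto simp: HB_def complex_eq_iff algebra_simps)
    have z': "poly (cpoly HC) ?z * of_real B + 2 * ?y\<^sup>2 * poly (cpoly (HA B)) ?z * of_real B = 0"
      using sg unfolding HA_def HC_def by (auto simp: m(2) complex_eq_iff power2_eq_square algebra_simps)
    have "poly (cpoly (HB A)) ?z + 2 * ?y * poly (cpoly HC) ?z + 3 * ?y\<^sup>2 * poly (cpoly (HB B)) ?z
        + 4 * ?y ^ 3 * poly (cpoly (HA B)) ?z = 0"
      using z' B unfolding z by (simp add: power2_eq_square power3_eq_cube algebra_simps)
    moreover have "poly (cpoly (HB A)) ?z + 2 * ?y * poly (cpoly HC) ?z + 3 * ?y\<^sup>2 * poly (cpoly (HB B)) ?z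
        + 4 * ?y ^ 3 * poly (cpoly (HA B)) ?z =
        (poly (cpoly v1) ?z + 2 * ?y * poly (cpoly v2) ?z) * poly W ?z
        + poly U ?z * (poly (cpoly k1) ?z + 2 * ?y * poly (cpoly k2) ?z)"
      unfolding Hc U_def W_def J_def cpoly_add cpoly_mult poly_add poly_mult by simp Groebner_Basis.algebra
    ultimately have "poly (cpoly v1) ?z + 2 * ?y * poly (cpoly v2) ?z = 0"
      using W0 U0 by simp
    then have "c = ?r"
      using sg m(1) by (auto simp: v1 v2 complex_eq_iff field_simps power2_eq_square)
    \<comment> \<open>By now \<open>v\<close> is c (s - \<epsilon> t / m)^2, which has a whole line
      of real zeros.\<close>
    have "eval2 v (s, \<epsilon> * m * s) = 0" for s
      using sg m(1) unfolding v v0c v1 v2 \<open>c = ?r\<close>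
      by (auto simp: eval2_pCons field_simps power2_eq_square)
    then show False
      using infinite_zeros_if_fibres[of UNIV v] infinite_UNIV_char_0 fin by blast
  qed

  consider "x = 2" "y = 0" | "x = 0" "y = 2" | "x = 1" "y = 1"
    using \<open>x + y = 2\<close> by linarith
  then show False
  proof cases
    case 1
    then have "x' = 0" "y' = 2" using * by auto
    then show False
      using villarceau[of 1] 1 kl by (simp add: * w complex_eq_iff)
  next
    case 2
    then have "x' = 2" "y' = 0" using * by auto
    then show False
      using villarceau[of "- 1"] 2 kl by (simp add: * w complex_eq_iff)
  next
    case 3
    \<comment> \<open>Both restrictions are multiples of s^2 + 1. Since \<open>v1\<close> vanishes
      at 0, it is zero, so \<open>HB A\<close> and \<open>HB B\<close> are \<open>v0\<close> and
      \<open>v2\<close> times \<open>k1\<close>, a nonzero multiple of s^2 + 1.\<close>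
    then have x': "x' = 1" "y' = 1" using * by auto
    have r: "m * poly v1 s = Im w * (s\<^sup>2 + 1)" for s
      using im[of s] 3 by (simp add: algebra_simps power2_eq_square)
    then have "Im w = 0" using r[of 0] v10 by simp
    then have "poly v1 s = 0" for s using r[of s] m(1) by simp
    then have v1: "v1 = 0" by (metis poly_all_0_iff_0)
    have k1: "m * poly k1 s = Im w' * (s\<^sup>2 + 1)" for s
    proof -
      have "of_real (poly k0 s) + \<i> * of_real m * of_real (poly k1 s) - of_real (m\<^sup>2) * of_real (poly k2 s)
        = w' + of_real s * (of_real s * w')"
        using arg_cong[OF *(5), of "\<lambda>p. poly p (of_real s)"]
        unfolding W_def J2 by (simp add: J_def w x' add.commute)
      from arg_cong[OF this, of Im] show ?thesis
        by (simp add: algebra_simps power2_eq_square del: of_real_power)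
    qed
    define q where "q = Im w' / m"
    have k1: "k1 = [:q, 0, q:]"
      by (rule poly_eqI_infinite[OF infinite_UNIV_char_0])
        (use k1 m(1) in \<open>simp add: q_def field_simps power2_eq_square\<close>)
    have "HB A = v0 * k1" using Hc(2) by (simp add: v1)
    then have q: "q \<noteq> 0" using HB_A_nonzero k1 by auto
    have HBB: "HB B = v2 * k1" using Hc(4) by (simp add: v1)
    define t where "t = - e * (A - B) / q"
    have t: "t \<noteq> 0" using e AB q by (simp add: t_def)
    have "poly v2 s = poly [:t * (A - B), 0, t * (A + B):] s" for s
    proof -
      have "(1 + s\<^sup>2) * (q * poly v2 s) = (1 + s\<^sup>2) * (- e * (A - B) * ((A - B) + (A + B) * s\<^sup>2))"
      proof -
        have "poly (HB B) s = poly v2 s * poly k1 s" by (simp add: HBB)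
        then have "(A - B) * (1 + s\<^sup>2) * (B * (e * (1 - s\<^sup>2) + 2 * f * s) + i * (1 + s\<^sup>2))
            = poly v2 s * (q + s * (s * q))"
          unfolding poly_HB k1 by simp
        then show ?thesis using f ie by Groebner_Basis.algebra
      qed
      then have "q * poly v2 s = - e * (A - B) * ((A - B) + (A + B) * s\<^sup>2)"
        by (rule mult_left_cancel[THEN iffD1, rotated])
          (use zero_le_power2[of s] in linarith)
      then show ?thesis using q by (simp add: t_def field_simps power2_eq_square)
    qed
    then have v2: "v2 = [:t * (A - B), 0, t * (A + B):]"
      by (intro poly_eqI_infinite[OF infinite_UNIV_char_0])
    \<comment> \<open>This is q1 at radius \<open>B\<close> up to a factor: with f = 0 and i = - e
      A, the expression B e (1 - s^2) + i (1 + s^2) equals - e L. Modulo \<open>L\<close>, the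
      polynomial \<open>HA B\<close> is 4 b B^2 s^2, which is no multiple of \<open>L\<close>
      because \<open>L\<close> has constant term A - B.\<close>
    define L where "L = [:A - B, 0, A + B:]"
    have "v2 = Polynomial.smult t L" by (simp add: v2 L_def)
    then have "L dvd HA B" using Hc(5) by (metis dvd_refl dvd_smult dvd_mult2)
    moreover have "HA B = L * (Polynomial.smult (- (A - B)) [:1, 0, 1:] + Polynomial.smult a L
        + Polynomial.smult (- 2 * d * B) [:0, 1:]) + [:0, 0, 4 * b * B\<^sup>2:]"
      unfolding HA_def L_def unfolding g j h
      by simp (intro conjI; Groebner_Basis.algebra)
    ultimately have "L dvd [:0, 0, 4 * b * B\<^sup>2:]"
      by (metis dvd_add_right_iff dvd_triv_left)
    then obtain p where p: "[:0, 0, 4 * b * B\<^sup>2:] = L * p" by blast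
    have "4 * b * B\<^sup>2 \<noteq> 0" using b0 B by simp
    then have "p \<noteq> 0" "L \<noteq> 0" using p by auto
    moreover have "degree [:0, 0, 4 * b * B\<^sup>2:] = 2" using b0 B by simp
    moreover have "degree L = 2" using A B by (simp add: L_def)
    ultimately have "degree p = 0" using p degree_mult_eq[of L p] by simp
    then obtain p0 where "p = [:p0:]" by (meson degree_eq_zeroE)
    then have "(A - B) * p0 = 0" "4 * b * B\<^sup>2 = (A + B) * p0"
      using p by (auto simp: L_def algebra_simps)
    then show False using AB b0 B by simp
  qed
qed

section \<open>First derivatives of polynomials vanishing on the curve, in the chart\<close>

theorem chart_gradient_zero:
  assumes F: "\<And>P. eval2 H P = 0 \<Longrightarrow> eval2 F P = 0"
    and lim: "(0, 0) islimpt {P. eval2 H P = 0}"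
  shows "coeff (coeff F 0) 1 = 0" "coeff (coeff F 1) 0 = 0"
proof -
  have "coeff (coeff F 0) 1 = 0 \<and> coeff (coeff F 1) 0 = 0"
  proof (rule ccontr)
    assume grad: "\<not> ?thesis"
    obtain u where u: "prime_elem u" "u dvd H" "(0, 0) islimpt {P. eval2 u P = 0}"
      using prime_factor_islimpt[OF H_nonzero lim] by blast
    have u_fin: "infinite {P. eval2 u P = 0}"
      using u(3) islimpt_finite by blast
    have "closed {P. eval2 u P = 0}"
    proof -
      have "isCont (eval2 u) P" for P
        using eval2_has_derivative has_derivative_continuous by blast
      then show ?thesis using continuous_closed_vimage[of "{0}" "eval2 u"] by (simp add: vimage_def)
    qed
    then have u0: "eval2 u (0, 0) = 0" using u(3) by (simp add: closed_limpt)
    \<comment> \<open>Infinitely many zeros are essential here: a prime factor of \<open>H\<close>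
      with few real zeros need not divide \<open>F\<close>.\<close>
    have dvd_F: "p dvd F" if "prime_elem p" "p dvd H" "infinite {P. eval2 p P = 0}" for p
    proof (rule ccontr)
      assume "\<not> p dvd F"
      then have "finite {P. eval2 p P = 0 \<and> eval2 F P = 0}"
        using finite_common_zeros that(1) by blast
      moreover have "eval2 F P = 0" if "eval2 p P = 0" for P
        using F[of P] that \<open>p dvd H\<close> by (auto simp: dvd_def)
      then have "{P. eval2 p P = 0 \<and> eval2 F P = 0} = {P. eval2 p P = 0}" by blast
      ultimately show False using that(3) by simp
    qed
    obtain k where k: "F = u * k" using dvd_F[OF u(1,2) u_fin] by blast
    obtain K where K: "H = u * K" using u(2) by blast
    have u00: "coeff (coeff u 0) 0 = 0" using u0 by (simp add: eval2_def poly_0_coeff_0)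
    \<comment> \<open>The linear part of a multiple of \<open>u\<close> is the linear part of
      \<open>u\<close> times the value of the cofactor. For \<open>F\<close> this shows that
      \<open>u\<close> is smooth at the origin and \<open>k\<close> nonzero there; since
      \<open>H\<close> is critical, its cofactor \<open>K\<close> must then vanish.\<close>
    have lin: "coeff (coeff (u * q) 0) 1 = coeff (coeff u 0) 1 * coeff (coeff q 0) 0"
      "coeff (coeff (u * q) 1) 0 = coeff (coeff u 1) 0 * coeff (coeff q 0) 0" for q
      using u00 by (simp_all add: coeff_mult)
    have k0: "coeff (coeff k 0) 0 \<noteq> 0" using grad unfolding k lin by auto
    have "coeff (coeff u 0) 1 \<noteq> 0 \<or> coeff (coeff u 1) 0 \<noteq> 0" using grad unfolding k lin by auto
    then have K0: "coeff (coeff K 0) 0 = 0" using H_critical(2,3) unfolding K lin by auto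
    have "K \<noteq> 0" using K H_nonzero by auto
    moreover have "eval2 K (0, 0) = 0" using K0 by (simp add: eval2_def poly_0_coeff_0)
    ultimately obtain v where v: "prime_elem v" "v dvd K" "eval2 v (0, 0) = 0"
      using prime_factor_zero by blast
    obtain M where M: "K = v * M" using v(2) by blast
    show False
    proof (cases "finite {P. eval2 v P = 0}")
      case True
      have "H = v * (u * M)" using K M by (simp add: ac_simps)
      moreover have "coeff (coeff (u * M) 0) 0 = 0" using u00 by (simp add: coeff_mult)
      ultimately show False using factor_with_finite_zeros True v(3) by blast
    next
      case False
      have "v dvd H" using v(2) K by simp
      then have "v dvd u * k" using dvd_F[OF v(1) _ False] k by simp
      moreover have "\<not> v dvd k"
      proof
        assume "v dvd k"
        then have "eval2 k (0, 0) = 0" using v(3) by (auto simp: dvd_def)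
        then show False using k0 by (simp add: eval2_def poly_0_coeff_0)
      qed
      ultimately have "v dvd u" using v(1) by (meson prime_elem_dvd_multD)
      then have "u dvd v"
        using u(1) v(1) by (meson irreducibleD' prime_elem_imp_irreducible prime_elem_not_unit)
      then have "u * u dvd H" using K v(2) by (metis dvd_refl dvd_trans mult_dvd_mono)
      then show False using no_double_factor u(1) u0 by blast
    qed
  qed
  then show "coeff (coeff F 0) 1 = 0" "coeff (coeff F 1) 0 = 0" by auto
qed

end

section \<open>The half-angle chart\<close>

text \<open>Clearing denominators. The exponent can stay unspecified, since only zeros of the
  pull-back and its first derivatives at the origin are used.\<close>

lemma polynomial_pullback:
  fixes \<phi> \<psi> \<xi> w :: "real \<Rightarrow> real \<Rightarrow> real"
  assumes \<phi>: "\<And>s t. eval2 X (s, t) = w s t * \<phi> s t" and \<psi>: "\<And>s t. eval2 Y (s, t) = w s t * \<psi> s t"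
    and \<xi>: "\<And>s t. eval2 Z (s, t) = w s t * \<xi> s t" and w: "\<And>s t. eval2 W (s, t) = w s t"
  shows "\<exists>K n. \<forall>s t. eval2 K (s, t) = w s t ^ n * eval3 F (\<phi> s t, \<psi> s t, \<xi> s t)"
proof -
  have step: "\<exists>K n. \<forall>s t. eval2 K (s, t) = w s t ^ n * (u s t + p s t * v s t)"
    if u: "\<exists>K n. \<forall>s t. eval2 K (s, t) = w s t ^ n * u s t"
      and v: "\<exists>K n. \<forall>s t. eval2 K (s, t) = w s t ^ n * v s t"
      and p: "\<And>s t. eval2 L (s, t) = w s t * p s t" for u v p L
  proof -
    obtain K n K' n' where K: "\<And>s t. eval2 K (s, t) = w s t ^ n * u s t"
      "\<And>s t. eval2 K' (s, t) = w s t ^ n' * v s t" using u v by metis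
    have "eval2 (W ^ Suc n' * K + W ^ n * L * K') (s, t) = w s t ^ (n + Suc n') * (u s t + p s t * v s t)" for s t
      by (simp add: K p w power_add algebra_simps)
    then show ?thesis by blast
  qed
  have const: "\<exists>K n. \<forall>s t. eval2 K (s, t) = w s t ^ n * c" for c
    by (rule exI[of _ "const2 c"], rule exI[of _ 0]) simp
  have one: "\<exists>K n. \<forall>s t. eval2 K (s, t) = w s t ^ n * poly q (\<phi> s t)" for q
  proof (induction q)
    case (pCons c q)
    then show ?case using step[OF const[of c] pCons.IH \<phi>] by simp
  qed (use const[of 0] in simp)
  have two: "\<exists>K n. \<forall>s t. eval2 K (s, t) = w s t ^ n * eval2 q (\<phi> s t, \<psi> s t)" for q
  proof (induction q)
    case (pCons c q)
    then show ?case using step[OF one[of c] pCons.IH \<psi>] by (simp add: eval2_pCons)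
  qed (use const[of 0] in simp)
  show ?thesis
  proof (induction F)
    case (pCons c q)
    then show ?case using step[OF two[of c] pCons.IH \<xi>] by (simp add: eval3_pCons)
  qed (use const[of 0] in simp)
qed

text \<open>This form is symmetric in the two radii and so serves both equators.\<close>

lemma eval3_torus_radii:
  assumes "A + B = 2 * R" "A * B = R\<^sup>2 - r\<^sup>2"
  shows "eval3 (torus_poly R r) (x, y, z) = (x\<^sup>2 + y\<^sup>2 + z\<^sup>2 + A * B)\<^sup>2 - (A + B)\<^sup>2 * (x\<^sup>2 + y\<^sup>2)"
  unfolding eval3_torus assms by (simp add: algebra_simps)

text \<open>
  Half-angle parametrisation of the torus, centred at the point \<open>(A k, A l, 0)\<close> of one of the two
  equators; \<open>A\<close> and \<open>B\<close> are the radii of this equator and of the other one.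
\<close>

definition torus_chart :: "real \<Rightarrow> real \<Rightarrow> real \<Rightarrow> real \<Rightarrow> real \<Rightarrow> real \<Rightarrow> real \<times> real \<times> real" where
  "torus_chart A B k l s t =
    ((A + B * t\<^sup>2) * (k * (1 - s\<^sup>2) - 2 * l * s) / ((1 + s\<^sup>2) * (1 + t\<^sup>2)),
     (A + B * t\<^sup>2) * (l * (1 - s\<^sup>2) + 2 * k * s) / ((1 + s\<^sup>2) * (1 + t\<^sup>2)),
     (A - B) * t / (1 + t\<^sup>2))"

lemma one_plus_square_pos: "1 + s\<^sup>2 > (0::real)"
  by (simp add: add_pos_nonneg)

lemma torus_chart_on_torus:
  assumes "k\<^sup>2 + l\<^sup>2 = 1" and "torus_chart A B k l s t = (x, y, z)"
  shows "(x\<^sup>2 + y\<^sup>2 + z\<^sup>2 + A * B)\<^sup>2 - (A + B)\<^sup>2 * (x\<^sup>2 + y\<^sup>2) = 0"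
proof -
  define n N where "n = 1 + s\<^sup>2" and "N = 1 + t\<^sup>2"
  have nN: "n \<noteq> 0" "N \<noteq> 0" using one_plus_square_pos[of s] one_plus_square_pos[of t] by (simp_all add: n_def N_def)
  have x: "n * N * x = (A + B * t\<^sup>2) * (k * (1 - s\<^sup>2) - 2 * l * s)"
    and y: "n * N * y = (A + B * t\<^sup>2) * (l * (1 - s\<^sup>2) + 2 * k * s)" and z: "N * z = (A - B) * t"
    using assms(2) nN unfolding torus_chart_def n_def[symmetric] N_def[symmetric] by auto
  have "n\<^sup>2 * (N\<^sup>2 * (x\<^sup>2 + y\<^sup>2)) = (n * N * x)\<^sup>2 + (n * N * y)\<^sup>2" by Groebner_Basis.algebra
  also have "\<dots> = (A + B * t\<^sup>2)\<^sup>2 * ((k\<^sup>2 + l\<^sup>2) * n\<^sup>2)"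
    unfolding x y unfolding n_def by Groebner_Basis.algebra
  also have "\<dots> = n\<^sup>2 * (A + B * t\<^sup>2)\<^sup>2" unfolding assms(1) by simp
  finally have rho: "N\<^sup>2 * (x\<^sup>2 + y\<^sup>2) = (A + B * t\<^sup>2)\<^sup>2" using nN(1) by simp
  have "N\<^sup>2 * (x\<^sup>2 + y\<^sup>2 + z\<^sup>2 + A * B) = N\<^sup>2 * (x\<^sup>2 + y\<^sup>2) + (N * z)\<^sup>2 + N\<^sup>2 * (A * B)" by Groebner_Basis.algebra
  also have "\<dots> = N * ((A + B) * (A + B * t\<^sup>2))" unfolding rho z unfolding N_def by Groebner_Basis.algebra
  finally have "N * (N * (x\<^sup>2 + y\<^sup>2 + z\<^sup>2 + A * B)) = N * ((A + B) * (A + B * t\<^sup>2))"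
    by (simp add: power2_eq_square mult.assoc)
  then have S: "N * (x\<^sup>2 + y\<^sup>2 + z\<^sup>2 + A * B) = (A + B) * (A + B * t\<^sup>2)" using nN(2) by simp
  have "N\<^sup>2 * ((x\<^sup>2 + y\<^sup>2 + z\<^sup>2 + A * B)\<^sup>2 - (A + B)\<^sup>2 * (x\<^sup>2 + y\<^sup>2))
      = (N * (x\<^sup>2 + y\<^sup>2 + z\<^sup>2 + A * B))\<^sup>2 - (A + B)\<^sup>2 * (N\<^sup>2 * (x\<^sup>2 + y\<^sup>2))" by Groebner_Basis.algebra
  also have "\<dots> = 0" unfolding S rho by Groebner_Basis.algebra
  finally show ?thesis using nN(2) by simp
qed

text \<open>The coordinates k x + l y and k y - l x refer to the direction (k, l), so s is the
  tangent of half the angle of rotation. Since A + B > 0, the torus equation becomes z^2 = (A -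
  \<rho>) (\<rho> - B), so t = z / (\<rho> - B) satisfies (\<rho> - B) t^2 = A - \<rho>.\<close>

lemma torus_chart_inverse:
  fixes x y z A B k l :: real
  defines "\<rho> \<equiv> sqrt (x\<^sup>2 + y\<^sup>2)"
  assumes AB: "A > 0" "B > 0" "A \<noteq> B" and kl: "k\<^sup>2 + l\<^sup>2 = 1"
    and torus: "(x\<^sup>2 + y\<^sup>2 + z\<^sup>2 + A * B)\<^sup>2 - (A + B)\<^sup>2 * (x\<^sup>2 + y\<^sup>2) = 0"
    and nz: "\<rho> + (k * x + l * y) \<noteq> 0" "\<rho> \<noteq> B"
  shows "torus_chart A B k l ((k * y - l * x) / (\<rho> + (k * x + l * y))) (z / (\<rho> - B)) = (x, y, z)"
proof -
  define X Y where "X = k * x + l * y" and "Y = k * y - l * x"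
  have rho: "\<rho>\<^sup>2 = x\<^sup>2 + y\<^sup>2" "\<rho> \<ge> 0" by (simp_all add: \<rho>_def)
  have XY: "X\<^sup>2 + Y\<^sup>2 = \<rho>\<^sup>2"
  proof -
    have "X\<^sup>2 + Y\<^sup>2 = (k\<^sup>2 + l\<^sup>2) * (x\<^sup>2 + y\<^sup>2)" unfolding X_def Y_def by Groebner_Basis.algebra
    then show ?thesis by (simp add: kl rho)
  qed
  have xy: "k * X - l * Y = x" "l * X + k * Y = y"
  proof -
    have "k * X - l * Y = (k\<^sup>2 + l\<^sup>2) * x" "l * X + k * Y = (k\<^sup>2 + l\<^sup>2) * y"
      unfolding X_def Y_def by Groebner_Basis.algebra+
    then show "k * X - l * Y = x" "l * X + k * Y = y" by (simp_all add: kl)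
  qed
  have D: "\<rho> + X \<noteq> 0" using nz(1) by (simp add: X_def)
  have r0: "\<rho> \<noteq> 0"
  proof
    assume "\<rho> = 0"
    then have "X = 0" using XY by (simp add: sum_power2_eq_zero_iff)
    then show False using D \<open>\<rho> = 0\<close> by simp
  qed
  have E: "\<rho> - B \<noteq> 0" using nz(2) by simp
  have "(x\<^sup>2 + y\<^sup>2 + z\<^sup>2 + A * B)\<^sup>2 = ((A + B) * \<rho>)\<^sup>2" using torus rho(1) by (simp add: power_mult_distrib)
  moreover have "x\<^sup>2 + y\<^sup>2 + z\<^sup>2 + A * B \<ge> 0" "(A + B) * \<rho> \<ge> 0" using AB rho(2) by simp_all
  ultimately have "x\<^sup>2 + y\<^sup>2 + z\<^sup>2 + A * B = (A + B) * \<rho>" by (simp add: power2_eq_iff_nonneg)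
  then have z2: "z\<^sup>2 = (A - \<rho>) * (\<rho> - B)" using rho(1) by Groebner_Basis.algebra
  define s t where "s = Y / (\<rho> + X)" and "t = z / (\<rho> - B)"
  have s: "(\<rho> + X) * s = Y" using D by (simp add: s_def)
  have t: "(\<rho> - B) * t = z" using E by (simp add: t_def)
  have "(\<rho> + X) * ((\<rho> + X) * (1 + s\<^sup>2)) = (\<rho> + X)\<^sup>2 + ((\<rho> + X) * s)\<^sup>2" by Groebner_Basis.algebra
  also have "\<dots> = (\<rho> + X) * (2 * \<rho>)" unfolding s using XY by Groebner_Basis.algebra
  finally have s1: "(\<rho> + X) * (1 + s\<^sup>2) = 2 * \<rho>" using D by simp
  have s2: "(\<rho> + X) * (1 - s\<^sup>2) = 2 * X" using s1 by Groebner_Basis.algebra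
  have "(\<rho> - B) * ((\<rho> - B) * t\<^sup>2) = ((\<rho> - B) * t)\<^sup>2" by Groebner_Basis.algebra
  also have "\<dots> = (\<rho> - B) * (A - \<rho>)" unfolding t z2 by simp
  finally have t2: "(\<rho> - B) * t\<^sup>2 = A - \<rho>" using E by simp
  have t1: "(\<rho> - B) * (1 + t\<^sup>2) = A - B" using t2 by Groebner_Basis.algebra
  have ta: "A + B * t\<^sup>2 = \<rho> * (1 + t\<^sup>2)"
  proof -
    have "(\<rho> - B) * (A + B * t\<^sup>2) = (\<rho> - B) * (\<rho> * (1 + t\<^sup>2))" using t2 by Groebner_Basis.algebra
    then show ?thesis using E by simp
  qed
  have pos: "1 + s\<^sup>2 \<noteq> 0" "1 + t\<^sup>2 \<noteq> 0" using one_plus_square_pos[of s] one_plus_square_pos[of t] by simp_all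
  have "(\<rho> + X) * (\<rho> * (k * (1 - s\<^sup>2) - 2 * l * s)) = \<rho> * (k * ((\<rho> + X) * (1 - s\<^sup>2)) - 2 * l * ((\<rho> + X) * s))"
    by Groebner_Basis.algebra
  also have "\<dots> = (k * X - l * Y) * (2 * \<rho>)" unfolding s s2 by Groebner_Basis.algebra
  also have "\<dots> = (\<rho> + X) * (x * (1 + s\<^sup>2))" unfolding xy s1[symmetric] by Groebner_Basis.algebra
  finally have "(\<rho> + X) * (\<rho> * (k * (1 - s\<^sup>2) - 2 * l * s)) = (\<rho> + X) * (x * (1 + s\<^sup>2))" .
  then have c1: "\<rho> * (k * (1 - s\<^sup>2) - 2 * l * s) = x * (1 + s\<^sup>2)" using D by simp
  have "(\<rho> + X) * (\<rho> * (l * (1 - s\<^sup>2) + 2 * k * s)) = \<rho> * (l * ((\<rho> + X) * (1 - s\<^sup>2)) + 2 * k * ((\<rho> + X) * s))"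
    by Groebner_Basis.algebra
  also have "\<dots> = (l * X + k * Y) * (2 * \<rho>)" unfolding s s2 by Groebner_Basis.algebra
  also have "\<dots> = (\<rho> + X) * (y * (1 + s\<^sup>2))" unfolding xy s1[symmetric] by Groebner_Basis.algebra
  finally have "(\<rho> + X) * (\<rho> * (l * (1 - s\<^sup>2) + 2 * k * s)) = (\<rho> + X) * (y * (1 + s\<^sup>2))" .
  then have c2: "\<rho> * (l * (1 - s\<^sup>2) + 2 * k * s) = y * (1 + s\<^sup>2)" using D by simp
  have "(A - B) * t = z * (1 + t\<^sup>2)"
    unfolding t[symmetric] t1[symmetric] by Groebner_Basis.algebra
  then have "(A - B) * t / (1 + t\<^sup>2) = z" using pos by (simp add: divide_eq_eq)
  moreover have "\<rho> * (1 + t\<^sup>2) * (k * (1 - s\<^sup>2) - 2 * l * s) / ((1 + s\<^sup>2) * (1 + t\<^sup>2)) = x"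
  proof -
    have "\<rho> * (1 + t\<^sup>2) * (k * (1 - s\<^sup>2) - 2 * l * s) = x * ((1 + s\<^sup>2) * (1 + t\<^sup>2))"
      using c1 by Groebner_Basis.algebra
    then show ?thesis using pos by (simp add: divide_eq_eq)
  qed
  moreover have "\<rho> * (1 + t\<^sup>2) * (l * (1 - s\<^sup>2) + 2 * k * s) / ((1 + s\<^sup>2) * (1 + t\<^sup>2)) = y"
  proof -
    have "\<rho> * (1 + t\<^sup>2) * (l * (1 - s\<^sup>2) + 2 * k * s) = y * ((1 + s\<^sup>2) * (1 + t\<^sup>2))"
      using c2 by Groebner_Basis.algebra
    then show ?thesis using pos by (simp add: divide_eq_eq)
  qed
  ultimately have "torus_chart A B k l s t = (x, y, z)"
    unfolding torus_chart_def ta by simp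
  then show ?thesis by (simp add: s_def t_def X_def Y_def)
qed

text \<open>The inverse of the chart is continuous at the centre, so points of \<open>C\<close>
  close to the centre come from parameters close to the origin.\<close>

lemma islimpt_chart_preimage:
  fixes A B k l :: real
  assumes AB: "A > 0" "B > 0" "A \<noteq> B" and kl: "k\<^sup>2 + l\<^sup>2 = 1"
    and C: "\<And>x y z. (x, y, z) \<in> C \<Longrightarrow> (x\<^sup>2 + y\<^sup>2 + z\<^sup>2 + A * B)\<^sup>2 - (A + B)\<^sup>2 * (x\<^sup>2 + y\<^sup>2) = 0"
    and lim: "(A * k, A * l, 0) islimpt C"
  shows "(0, 0) islimpt {(s, t). torus_chart A B k l s t \<in> C}"
proof (rule islimptI)
  fix V :: "(real \<times> real) set" assume V: "(0, 0) \<in> V" "open V"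
  let ?P = "(A * k, A * l, 0) :: real \<times> real \<times> real"
  define \<rho> where "\<rho> M = sqrt ((fst M)\<^sup>2 + (fst (snd M))\<^sup>2)" for M :: "real \<times> real \<times> real"
  define D where "D M = \<rho> M + (k * fst M + l * fst (snd M))" for M
  define \<Psi> where "\<Psi> M = ((k * fst (snd M) - l * fst M) / D M, snd (snd M) / (\<rho> M - B))" for M
  have "(A * k)\<^sup>2 + (A * l)\<^sup>2 = A\<^sup>2 * (k\<^sup>2 + l\<^sup>2)" by Groebner_Basis.algebra
  then have rP: "\<rho> ?P = A" using AB(1) by (simp add: \<rho>_def kl)
  have "k * (A * k) + l * (A * l) = A * (k\<^sup>2 + l\<^sup>2)" by Groebner_Basis.algebra
  then have DP: "D ?P = 2 * A" by (simp add: D_def rP kl)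
  have lim_rho: "(\<rho> \<longlongrightarrow> \<rho> ?P) (nhds ?P)"
    unfolding \<rho>_def by (intro tendsto_intros filterlim_ident)
  have lim_D: "(D \<longlongrightarrow> D ?P) (nhds ?P)"
    unfolding D_def by (intro tendsto_intros lim_rho filterlim_ident)
  have "(\<Psi> \<longlongrightarrow> ((k * fst (snd ?P) - l * fst ?P) / D ?P, snd (snd ?P) / (\<rho> ?P - B))) (nhds ?P)"
    unfolding \<Psi>_def using DP rP AB by (intro tendsto_intros lim_rho lim_D filterlim_ident) simp_all
  then have "(\<Psi> \<longlongrightarrow> (0, 0)) (nhds ?P)" by (simp add: mult.commute mult.left_commute)
  then have "eventually (\<lambda>M. \<Psi> M \<in> V) (nhds ?P)" using V by (auto simp: tendsto_def)
  moreover have "eventually (\<lambda>M. D M \<noteq> 0) (nhds ?P)"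
    using tendsto_imp_eventually_ne[OF lim_D, of 0] DP AB by simp
  moreover have "eventually (\<lambda>M. \<rho> M \<noteq> B) (nhds ?P)"
    using tendsto_imp_eventually_ne[OF lim_rho, of B] rP AB by simp
  ultimately have "eventually (\<lambda>M. \<Psi> M \<in> V \<and> D M \<noteq> 0 \<and> \<rho> M \<noteq> B) (nhds ?P)"
    by eventually_elim simp
  then obtain U where U: "open U" "?P \<in> U" "\<And>M. M \<in> U \<Longrightarrow> \<Psi> M \<in> V \<and> D M \<noteq> 0 \<and> \<rho> M \<noteq> B"
    unfolding eventually_nhds by blast
  obtain M where M: "M \<in> C" "M \<in> U" "M \<noteq> ?P" using lim U(1,2) by (meson islimptE)
  obtain x y z where xyz: "M = (x, y, z)" by (cases M)
  obtain s t where st: "\<Psi> M = (s, t)" by (cases "\<Psi> M")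
  have ch: "torus_chart A B k l s t = M"
    using torus_chart_inverse[OF AB kl C[of x y z]] M U(3)[of M] st
    by (simp add: xyz \<Psi>_def D_def \<rho>_def)
  moreover have "torus_chart A B k l 0 0 = ?P" by (simp add: torus_chart_def)
  ultimately have "(s, t) \<noteq> (0, 0)" using M(3) by auto
  moreover have "(s, t) \<in> V" using U(3)[OF M(2)] st by simp
  ultimately show "\<exists>y\<in>{(s, t). torus_chart A B k l s t \<in> C}. y \<in> V \<and> y \<noteq> (0, 0)"
    using ch M(1) by (intro bexI[of _ "(s, t)"]) auto
qed

lemma torus_chart_derivatives:
  "((\<lambda>s. torus_chart A B k l s 0) has_derivative (\<lambda>v. v *\<^sub>R (- 2 * A * l, 2 * A * k, 0))) (at 0)"
  "((\<lambda>t. torus_chart A B k l 0 t) has_derivative (\<lambda>v. v *\<^sub>R (0, 0, A - B))) (at 0)"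
proof -
  have *: "((\<lambda>s. A * (k * (1 - s\<^sup>2) - 2 * l * s) / (1 + s\<^sup>2)) has_real_derivative - 2 * A * l) (at 0)"
    for A k l :: real
    by (auto intro!: derivative_eq_intros)
  have "((\<lambda>s. (A * (k * (1 - s\<^sup>2) - 2 * l * s) / (1 + s\<^sup>2), A * (l * (1 - s\<^sup>2) - 2 * (- k) * s) / (1 + s\<^sup>2), 0))
      has_derivative (\<lambda>v. (- 2 * A * l * v, - 2 * A * (- k) * v, 0))) (at 0)"
    using *[of A k l] *[of A l "- k"] unfolding has_field_derivative_def
    by (intro has_derivative_Pair has_derivative_const)
  then show "((\<lambda>s. torus_chart A B k l s 0) has_derivative (\<lambda>v. v *\<^sub>R (- 2 * A * l, 2 * A * k, 0))) (at 0)"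
    by (simp add: torus_chart_def mult.commute)
  have 1: "((\<lambda>t. (A + B * t\<^sup>2) * k / (1 + t\<^sup>2)) has_real_derivative 0) (at 0)" for k
    by (auto intro!: derivative_eq_intros)
  have 2: "((\<lambda>t. (A - B) * t / (1 + t\<^sup>2)) has_real_derivative A - B) (at 0)"
    by (auto intro!: derivative_eq_intros)
  have "((\<lambda>t. ((A + B * t\<^sup>2) * k / (1 + t\<^sup>2), (A + B * t\<^sup>2) * l / (1 + t\<^sup>2), (A - B) * t / (1 + t\<^sup>2)))
      has_derivative (\<lambda>v. (0 * v, 0 * v, (A - B) * v))) (at 0)"
    using 1[of k] 1[of l] 2 unfolding has_field_derivative_def
    by (intro has_derivative_Pair)
  then show "((\<lambda>t. torus_chart A B k l 0 t) has_derivative (\<lambda>v. v *\<^sub>R (0, 0, A - B))) (at 0)"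
    by (simp add: torus_chart_def mult.commute)
qed

text \<open>The factor (1 + s^2)^n has value 1 and derivative 0 at s = 0, so clearing denominators
  does not change the first derivative.\<close>

lemma pullback_derivative_zero:
  fixes \<gamma> :: "real \<Rightarrow> real \<times> real \<times> real"
  assumes \<gamma>: "(\<gamma> has_derivative (\<lambda>v. v *\<^sub>R u)) (at 0)" and F: "eval3 F (\<gamma> 0) = 0"
    and p: "\<And>s. poly p s = (1 + s\<^sup>2) ^ n * eval3 F (\<gamma> s)" "coeff p 1 = 0"
  shows "inner (grad3 F (\<gamma> 0)) u = 0"
proof -
  have "((\<lambda>s. eval3 F (\<gamma> s)) has_derivative (\<lambda>v. inner (grad3 F (\<gamma> 0)) (v *\<^sub>R u))) (at 0)"
    using has_derivative_compose[OF \<gamma> eval3_has_derivative] .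
  then have "((\<lambda>s. eval3 F (\<gamma> s)) has_real_derivative inner (grad3 F (\<gamma> 0)) u) (at 0)"
    by (simp add: has_field_derivative_def mult.commute[of _ "inner _ u"])
  moreover have "((\<lambda>s::real. (1 + s\<^sup>2) ^ n) has_real_derivative 0) (at 0)"
    by (auto intro!: derivative_eq_intros)
  ultimately have "((\<lambda>s. (1 + s\<^sup>2) ^ n * eval3 F (\<gamma> s)) has_real_derivative inner (grad3 F (\<gamma> 0)) u) (at 0)"
    using DERIV_mult[of "\<lambda>s. (1 + s\<^sup>2) ^ n" 0 0 UNIV "\<lambda>s. eval3 F (\<gamma> s)" "inner (grad3 F (\<gamma> 0)) u"] F by simp
  then have "(poly p has_real_derivative inner (grad3 F (\<gamma> 0)) u) (at 0)"
    by (simp add: p(1)[symmetric])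
  then have "inner (grad3 F (\<gamma> 0)) u = poly (pderiv p) 0" using poly_DERIV DERIV_unique by blast
  then show ?thesis using p(2) by (simp add: poly_0_coeff_0 coeff_pderiv)
qed

section \<open>Singular points and tangency\<close>

text \<open>The assumptions are Vieta's relations for Q = (z - L) (z - L').\<close>

lemma quadric_reducible_if_planes:
  assumes "\<And>x y. e * x + f * y + i = - ((p * x + q * y + s) + (p' * x + q' * y + s'))"
    and "\<And>x y. a * x\<^sup>2 + b * y\<^sup>2 + d * x * y + g * x + h * y + j
        = (p * x + q * y + s) * (p' * x + q' * y + s')"
  shows "\<not> irreducible (quadric_poly (lin2 e f i) (quad2 a b d g h j))"
proof
  let ?L = "lin2 p q s" and ?L' = "lin2 p' q' s'"
  have "lin2 e f i = - (?L + ?L')"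
    by (rule eval2_eqI) (simp add: eval2_lin2 assms(1))
  moreover have "quad2 a b d g h j = ?L * ?L'"
    by (rule eval2_eqI) (simp add: eval2_quad2 eval2_lin2 assms(2))
  ultimately have "quadric_poly (lin2 e f i) (quad2 a b d g h j) = [:- ?L, 1:] * [:- ?L', 1:]"
    by (simp add: quadric_poly_def)
  moreover assume "irreducible (quadric_poly (lin2 e f i) (quad2 a b d g h j))"
  ultimately have "is_unit [:- ?L, 1:] \<or> is_unit [:- ?L', 1:]"
    by (metis irreducibleD)
  then show False by (auto simp: is_unit_poly_iff)
qed

lemma rotate_back:
  fixes x y k l p q s :: real
  assumes "k\<^sup>2 + l\<^sup>2 = 1"
  shows "(p * k - q * l) * x + (p * l + q * k) * y + s = p * (k * x + l * y) + q * (k * y - l * x) + s"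
  by (simp add: algebra_simps)

text \<open>A rotation taking (k, l) to (1, 0) leads to \<open>torus_quadric\<close>; the primed
  constants are the rotated coefficients. The coordinate lines of the chart have velocities at the
  origin that span the tangent plane of the torus, and the gradient of \<open>F\<close> is
  orthogonal to both, hence normal.\<close>

lemma tangential_gradients_parallel:
  fixes a b d e f g h i j :: real
  defines "q1 \<equiv> lin2 e f i" and "q0 \<equiv> quad2 a b d g h j"
  assumes radii: "A > 0" "B > 0" "A \<noteq> B" "A + B = 2 * R" "A * B = R\<^sup>2 - r\<^sup>2"
    and kl: "k\<^sup>2 + l\<^sup>2 = 1"
    and irr: "irreducible (quadric_poly q1 q0)" and q1: "q1 \<noteq> 0"
    and q1_P: "eval2 q1 (A * k, A * l) = 0" and q0_P: "eval2 q0 (A * k, A * l) = 0"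
    and tang: "k * snd (grad2 q0 (A * k, A * l)) = l * fst (grad2 q0 (A * k, A * l))"
    and lim: "(A * k, A * l, 0) islimpt curve R r q1 q0"
    and F: "F \<in> vanishing_ideal (curve R r q1 q0)"
    and P: "(A * k, A * l, 0) \<in> curve R r q1 q0"
  shows "grad3 F (A * k, A * l, 0) \<in> span {(k, l, 0)}"
proof -
  define a' where "a' = a * k\<^sup>2 + b * l\<^sup>2 + d * k * l"
  define b' where "b' = a * l\<^sup>2 + b * k\<^sup>2 - d * k * l"
  define d' where "d' = 2 * (b - a) * k * l + d * (k\<^sup>2 - l\<^sup>2)"
  define e' where "e' = e * k + f * l"
  define f' where "f' = f * k - e * l"
  define g' where "g' = g * k + h * l"
  define h' where "h' = h * k - g * l"
  note rot = a'_def b'_def d'_def e'_def f'_def g'_def h'_def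
  have rot1: "e * x + f * y + i = e' * (k * x + l * y) + f' * (k * y - l * x) + i" for x y
  proof -
    have "e' * (k * x + l * y) + f' * (k * y - l * x) = (k\<^sup>2 + l\<^sup>2) * (e * x + f * y)"
      unfolding rot by Groebner_Basis.algebra
    then show ?thesis by (simp add: kl)
  qed
  have rot0: "a * x\<^sup>2 + b * y\<^sup>2 + d * x * y + g * x + h * y + j =
      a' * (k * x + l * y)\<^sup>2 + b' * (k * y - l * x)\<^sup>2 + d' * (k * x + l * y) * (k * y - l * x)
      + g' * (k * x + l * y) + h' * (k * y - l * x) + j" for x y
  proof -
    have "a' * (k * x + l * y)\<^sup>2 + b' * (k * y - l * x)\<^sup>2 + d' * (k * x + l * y) * (k * y - l * x)
        = (k\<^sup>2 + l\<^sup>2)\<^sup>2 * (a * x\<^sup>2 + b * y\<^sup>2 + d * x * y)"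
      unfolding rot by Groebner_Basis.algebra
    moreover have "g' * (k * x + l * y) + h' * (k * y - l * x) = (k\<^sup>2 + l\<^sup>2) * (g * x + h * y)"
      unfolding rot by Groebner_Basis.algebra
    ultimately show ?thesis by (simp add: kl)
  qed
  interpret torus_quadric A B a' b' d' e' f' g' h' i j
  proof
    show "A > 0" "B > 0" "A \<noteq> B" by fact+
    show e0: "e' * A + i = 0"
      using q1_P by (simp add: q1_def eval2_lin2 rot algebra_simps)
    show "a' * A\<^sup>2 + g' * A + j = 0"
      using q0_P by (simp add: q0_def eval2_quad2 rot algebra_simps power2_eq_square)
    \<comment> \<open>\<open>tang\<close> says that q0 has derivative zero along the equator, which
      after rotation is the y-derivative at (A, 0).\<close>
    show "d' * A + h' = 0"
      using tang by (simp add: q0_def grad2_quad2 rot algebra_simps power2_eq_square)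
    show "e' \<noteq> 0 \<or> f' \<noteq> 0"
    proof (rule ccontr)
      assume "\<not> ?thesis"
      then have "e * x + f * y + i = 0" for x y using rot1[of x y] e0 by simp
      then have "q1 = 0" by (intro eval2_eqI) (simp add: q1_def eval2_lin2)
      then show False using q1 by simp
    qed
    show False
      if "\<And>x y. e' * x + f' * y + i = - ((p * x + q * y + s) + (p' * x + q' * y + s'))"
        and "\<And>x y. a' * x\<^sup>2 + b' * y\<^sup>2 + d' * x * y + g' * x + h' * y + j
          = (p * x + q * y + s) * (p' * x + q' * y + s')" for p q s p' q' s'
    proof -
      have "\<not> irreducible (quadric_poly (lin2 e f i) (quad2 a b d g h j))"
        by (rule quadric_reducible_if_planes[of e f i "p * k - q * l" "p * l + q * k" s
              "p' * k - q' * l" "p' * l + q' * k" s'])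
          (simp_all only: rotate_back[OF kl] rot1 rot0 that)
      then show False using irr by (simp add: q1_def q0_def)
    qed
  qed
  define w where "w s t = (1 + s\<^sup>2) * (1 + t\<^sup>2)" for s t :: real
  define X where "X = (const2 A + const2 B * Y2\<^sup>2) * (const2 k * (1 - X2\<^sup>2) - const2 (2 * l) * X2)"
  define Y where "Y = (const2 A + const2 B * Y2\<^sup>2) * (const2 l * (1 - X2\<^sup>2) + const2 (2 * k) * X2)"
  define Z where "Z = const2 (A - B) * Y2 * (1 + X2\<^sup>2)"
  define W where "W = (1 + X2\<^sup>2) * (1 + Y2\<^sup>2)"
  define \<Phi> where "\<Phi> = torus_chart A B k l"
  have w0: "w s t \<noteq> 0" for s t
    using one_plus_square_pos[of s] one_plus_square_pos[of t] by (simp add: w_def)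
  have XYZ: "eval2 X (s, t) = w s t * fst (\<Phi> s t)" "eval2 Y (s, t) = w s t * fst (snd (\<Phi> s t))"
    "eval2 Z (s, t) = w s t * snd (snd (\<Phi> s t))" "eval2 W (s, t) = w s t" for s t
    using one_plus_square_pos[of s] one_plus_square_pos[of t]
    by (simp_all add: X_def Y_def Z_def W_def \<Phi>_def torus_chart_def w_def)
  obtain K n where K: "\<And>s t. eval2 K (s, t) = w s t ^ n * eval3 F (\<Phi> s t)"
    using polynomial_pullback[OF XYZ, of F] by auto
  have H: "eval2 H (s, t) = (w s t)\<^sup>2 * eval3 (quadric_poly q1 q0) (\<Phi> s t)" for s t
  proof -
    obtain x y z where xyz: "\<Phi> s t = (x, y, z)" by (cases "\<Phi> s t")
    \<comment> \<open>Q homogenised by \<open>w\<close>: every term becomes quadratic in w x, w y, w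
      z and w, the first three of which are polynomials in s and t.\<close>
    have "(w s t)\<^sup>2 * eval3 (quadric_poly q1 q0) (x, y, z) =
        (w s t * z)\<^sup>2 + (e * (w s t * x) + f * (w s t * y) + i * w s t) * (w s t * z)
        + a * (w s t * x)\<^sup>2 + b * (w s t * y)\<^sup>2 + d * (w s t * x) * (w s t * y)
        + g * (w s t * x) * w s t + h * (w s t * y) * w s t + j * (w s t)\<^sup>2"
      unfolding eval3_quadric q1_def q0_def eval2_lin2 eval2_quad2 by Groebner_Basis.algebra
    also have "\<dots> = eval2 H (s, t)"
    proof -
      have wxyz: "w s t * x = (A + B * t\<^sup>2) * (k * (1 - s\<^sup>2) - 2 * l * s)"
        "w s t * y = (A + B * t\<^sup>2) * (l * (1 - s\<^sup>2) + 2 * k * s)"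
        "w s t * z = (A - B) * t * (1 + s\<^sup>2)"
        using XYZ[of s t] by (simp_all add: xyz X_def Y_def Z_def)
      show ?thesis
        unfolding wxyz eval2_H unfolding rot w_def by Groebner_Basis.algebra
    qed
    finally show ?thesis by (simp add: xyz)
  qed
  have torus: "eval3 (torus_poly R r) (x, y, z) = (x\<^sup>2 + y\<^sup>2 + z\<^sup>2 + A * B)\<^sup>2 - (A + B)\<^sup>2 * (x\<^sup>2 + y\<^sup>2)" for x y z
    by (rule eval3_torus_radii[OF radii(4,5)])
  have H_iff: "\<Phi> s t \<in> curve R r q1 q0 \<longleftrightarrow> eval2 H (s, t) = 0" for s t
    using torus_chart_on_torus[OF kl, of A B s t] w0[of s t]
    by (cases "\<Phi> s t") (auto simp: curve_def zero_set3_def torus H \<Phi>_def)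
  have "eval2 K P = 0" if "eval2 H P = 0" for P
    using that F H_iff[of "fst P" "snd P"] K[of "fst P" "snd P"] by (auto simp: vanishing_ideal_def)
  moreover have "(0, 0) islimpt {P. eval2 H P = 0}"
  proof -
    have "(0, 0) islimpt {(s, t). torus_chart A B k l s t \<in> curve R r q1 q0}"
      using lim by (rule islimpt_chart_preimage[OF radii(1,2,3) kl, rotated])
        (simp add: curve_def zero_set3_def torus)
    moreover have "{(s, t). torus_chart A B k l s t \<in> curve R r q1 q0} = {P. eval2 H P = 0}"
      using H_iff by (auto simp: \<Phi>_def)
    ultimately show ?thesis by simp
  qed
  ultimately have grad: "coeff (coeff K 0) 1 = 0" "coeff (coeff K 1) 0 = 0"
    using chart_gradient_zero[of K] by blast+
  have \<Phi>0: "\<Phi> 0 0 = (A * k, A * l, 0)" by (simp add: \<Phi>_def torus_chart_def)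
  have FP: "eval3 F (\<Phi> 0 0) = 0" using F P unfolding \<Phi>0 by (simp add: vanishing_ideal_def)
  have "inner (grad3 F (\<Phi> 0 0)) (- 2 * A * l, 2 * A * k, 0) = 0"
  proof (rule pullback_derivative_zero[where \<gamma> = "\<lambda>s. \<Phi> s 0" and p = "coeff K 0" and n = n])
    show "((\<lambda>s. \<Phi> s 0) has_derivative (\<lambda>v. v *\<^sub>R (- 2 * A * l, 2 * A * k, 0))) (at 0)"
      unfolding \<Phi>_def by (rule torus_chart_derivatives)
    show "poly (coeff K 0) s = (1 + s\<^sup>2) ^ n * eval3 F (\<Phi> s 0)" for s
      using K[of s 0] by (simp add: eval2_def w_def poly_0_coeff_0)
  qed (use FP grad in auto)
  moreover have "inner (grad3 F (\<Phi> 0 0)) (0, 0, A - B) = 0"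
  proof (rule pullback_derivative_zero[where \<gamma> = "\<lambda>t. \<Phi> 0 t" and p = "map_poly (\<lambda>p. poly p 0) K" and n = n])
    show "((\<lambda>t. \<Phi> 0 t) has_derivative (\<lambda>v. v *\<^sub>R (0, 0, A - B))) (at 0)"
      unfolding \<Phi>_def by (rule torus_chart_derivatives)
    show "poly (map_poly (\<lambda>p. poly p 0) K) t = (1 + t\<^sup>2) ^ n * eval3 F (\<Phi> 0 t)" for t
      using K[of 0 t] by (simp add: eval2_conv_poly w_def)
  qed (use FP grad in \<open>auto simp: coeff_map_poly poly_0_coeff_0\<close>)
  moreover obtain u v u' where uv: "grad3 F (\<Phi> 0 0) = (u, v, u')" by (cases "grad3 F (\<Phi> 0 0)")
  ultimately have "A * (v * k - u * l) = 0" "u' * (A - B) = 0"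
    by (simp_all add: inner_prod_def algebra_simps)
  then have vk: "v * k = u * l" and u': "u' = 0" using radii by simp_all
  have "u = (k\<^sup>2 + l\<^sup>2) * u" "v = (k\<^sup>2 + l\<^sup>2) * v" by (simp_all add: kl)
  then have "u = (u * k + v * l) * k" "v = (u * k + v * l) * l"
    using vk by Groebner_Basis.algebra+
  then have "grad3 F (\<Phi> 0 0) = (u * k + v * l) *\<^sub>R (k, l, 0)" by (simp add: uv u')
  then show ?thesis unfolding \<Phi>0 by (auto simp: span_singleton)
qed

section \<open>Discriminant curves and the equivalence\<close>

lemma grad2_torus_p0:
  assumes "A\<^sup>2 = x\<^sup>2 + y\<^sup>2" "A + B = 2 * R" "A * B = R\<^sup>2 - r\<^sup>2"
  shows "grad2 (torus_p0 R r) (x, y) = (2 * (A\<^sup>2 - B\<^sup>2)) *\<^sub>R (x, y)"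
proof -
  have "grad2 (torus_p0 R r) (x, y) = (4 * (x\<^sup>2 + y\<^sup>2 - R\<^sup>2 - r\<^sup>2)) *\<^sub>R (x, y)"
    by (simp add: torus_p0_def grad2_simps) (simp add: algebra_simps)
  moreover have "2 * (x\<^sup>2 + y\<^sup>2 - R\<^sup>2 - r\<^sup>2) = A\<^sup>2 - B\<^sup>2" using assms by Groebner_Basis.algebra
  ultimately show ?thesis by (metis mult.assoc mult_2 numeral_Bit0 numeral_One)
qed

text \<open>Tangent lines through a common regular point coincide exactly when the gradients are
  parallel. A critical point of \<open>G\<close> is covered as well, by u = v = 0.\<close>

lemma nontransversal_iff_parallel:
  assumes G: "eval2 F P = 0" "eval2 G P = 0"
    and gF: "grad2 F P = c *\<^sub>R (x, y)" and gG: "grad2 G P = c' *\<^sub>R (u, v)"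
    and c: "c \<noteq> 0" "c' \<noteq> 0" and xy: "(x, y) \<noteq> (0, 0)"
  shows "nontransversal_intersection F G P \<longleftrightarrow> x * v = y * u"
proof
  assume nt: "nontransversal_intersection F G P"
  show "x * v = y * u"
  proof (rule ccontr)
    assume ne: "x * v \<noteq> y * u"
    then have "(u, v) \<noteq> 0" by (auto simp: zero_prod_def)
    then have "regular_point2 F P" "regular_point2 G P"
      using G c xy by (auto simp: regular_point2_def gF gG zero_prod_def)
    moreover have "tangent_line2 F P \<noteq> tangent_line2 G P"
    proof
      assume eq: "tangent_line2 F P = tangent_line2 G P"
      have "P + (- y, x) \<in> tangent_line2 F P" by (simp add: tangent_line2_def gF inner_prod_def)
      then have "c' * (x * v - y * u) = 0"
        unfolding eq by (simp add: tangent_line2_def gG inner_prod_def algebra_simps)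
      then show False using c ne by simp
    qed
    ultimately show False using nt by (simp add: nontransversal_intersection_def transversal_at_def)
  qed
next
  assume par: "x * v = y * u"
  show "nontransversal_intersection F G P"
  proof (rule ccontr)
    assume "\<not> ?thesis"
    then have tr: "transversal_at F G P" using G by (simp add: nontransversal_intersection_def)
    then have "(u, v) \<noteq> (0, 0)" by (auto simp: transversal_at_def regular_point2_def gG zero_prod_def)
    have "x * p + y * q = 0 \<longleftrightarrow> u * p + v * q = 0" for p q
    proof -
      have "u * (x * p + y * q) = x * (u * p + v * q)" "v * (x * p + y * q) = y * (u * p + v * q)"
        using par by Groebner_Basis.algebra+
      then show ?thesis using xy \<open>(u, v) \<noteq> (0, 0)\<close> by (metis mult_eq_0_iff)
    qed
    then have "tangent_line2 F P = tangent_line2 G P"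
      using c by (auto simp: tangent_line2_def gF gG inner_prod_def mult.assoc simp flip: distrib_left)
    then show False using tr by (simp add: transversal_at_def)
  qed
qed

text \<open>p0 is ((R + r)^2 - x^2 - y^2) ((R - r)^2 - x^2 - y^2), so the point lies on one of the
  two equators; \<open>A\<close> is the radius of this one and \<open>B\<close> that of the
  other.\<close>

lemma equator_point:
  assumes "0 < r" "r < R" and "eval2 (torus_p0 R r) (x, y) = 0"
  obtains A B where "A > 0" "B > 0" "A \<noteq> B" "A + B = 2 * R" "A * B = R\<^sup>2 - r\<^sup>2" "A\<^sup>2 = x\<^sup>2 + y\<^sup>2"
proof -
  have "((R + r)\<^sup>2 - (x\<^sup>2 + y\<^sup>2)) * ((R - r)\<^sup>2 - (x\<^sup>2 + y\<^sup>2)) = 0"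
  proof -
    have "(R\<^sup>2 + 2 * R * r + r\<^sup>2 - x\<^sup>2 - y\<^sup>2) * (R\<^sup>2 - 2 * R * r + r\<^sup>2 - x\<^sup>2 - y\<^sup>2) = 0"
      using assms(3) by (simp add: torus_p0_def)
    then show ?thesis by Groebner_Basis.algebra
  qed
  then consider "(R + r)\<^sup>2 = x\<^sup>2 + y\<^sup>2" | "(R - r)\<^sup>2 = x\<^sup>2 + y\<^sup>2" by auto
  then show thesis
  proof cases
    case 1
    then show thesis using assms(1,2) by (intro that[of "R + r" "R - r"]) (auto simp: power2_eq_square algebra_simps)
  next
    case 2
    then show thesis using assms(1,2) by (intro that[of "R - r" "R + r"]) (auto simp: power2_eq_square algebra_simps)
  qed
qed

theorem corollary3p18:
  fixes R r a b d e f g h i j x0 y0 :: real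
    and q0 q1 :: "real poly poly"
  assumes "0 < r" and "r < R"
    and "q1 = lin2 e f i"
    and "q0 = quad2 a b d g h j"
    and "irreducible (quadric_poly q1 q0)"
    and "(x0, y0) \<in> cutcurve R r q1 q0"
    and "q1 \<noteq> 0"
    and "\<not> q1 dvd S0 R r q1 q0"
    and "eval2 q1 (x0, y0) = 0"
    and "eval2 (disc_torus R r) (x0, y0) = 0"
  shows "singular_point (curve R r q1 q0) (x0, y0, 0)
     \<longleftrightarrow> nontransversal_intersection (disc_torus R r) (disc_quadric q1 q0) (x0, y0)"
proof -
  let ?C = "curve R r q1 q0" and ?P = "(x0, y0, 0 :: real)"
  have p0: "eval2 (torus_p0 R r) (x0, y0) = 0" using assms(10) by (simp add: disc_torus_def)
  obtain A B where AB: "A > 0" "B > 0" "A \<noteq> B" "A + B = 2 * R" "A * B = R\<^sup>2 - r\<^sup>2"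
    and Axy: "A\<^sup>2 = x0\<^sup>2 + y0\<^sup>2"
    using equator_point[OF assms(1,2) p0] .
  have torus: "eval3 (torus_poly R r) (x, y, z) = (x\<^sup>2 + y\<^sup>2 + z\<^sup>2 + A * B)\<^sup>2 - (A + B)\<^sup>2 * (x\<^sup>2 + y\<^sup>2)" for x y z
    by (rule eval3_torus_radii[OF AB(4,5)])
  \<comment> \<open>Over a point of an equator, T is z^2 times a positive factor, so the point of
    the curve there has z = 0.\<close>
  obtain z where z: "(x0, y0, z) \<in> ?C" using assms(6) by (auto simp: cutcurve_def proj_z_def)
  have "z\<^sup>2 * (z\<^sup>2 + 2 * (A\<^sup>2 + A * B)) = (A\<^sup>2 + z\<^sup>2 + A * B)\<^sup>2 - (A + B)\<^sup>2 * A\<^sup>2"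
    by Groebner_Basis.algebra
  also have "\<dots> = 0" using z by (simp add: curve_def zero_set3_def torus Axy)
  finally have "z = 0 \<or> z\<^sup>2 + 2 * (A\<^sup>2 + A * B) = 0" by simp
  moreover have "A\<^sup>2 + A * B > 0"
    using AB(1,2) by (simp add: add_pos_pos)
  then have "z\<^sup>2 + 2 * (A\<^sup>2 + A * B) > 0"
    by (intro add_nonneg_pos) simp_all
  ultimately have z0: "z = 0" by auto
  have PC: "?P \<in> ?C" using z z0 by simp
  have q0P: "eval2 q0 (x0, y0) = 0"
    using PC assms(9) by (simp add: curve_def zero_set3_def eval3_quadric)
  obtain u v where uv: "grad2 q0 (x0, y0) = (u, v)" by (cases "grad2 q0 (x0, y0)")
  have gT: "grad2 (torus_p0 R r) (x0, y0) = (2 * (A\<^sup>2 - B\<^sup>2)) *\<^sub>R (x0, y0)"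
    using grad2_torus_p0[OF Axy AB(4,5)] .
  have cT: "2 * (A\<^sup>2 - B\<^sup>2) \<noteq> 0" using AB by (simp add: power2_eq_iff_nonneg)
  have xy: "(x0, y0) \<noteq> (0, 0)" using Axy AB by auto
  \<comment> \<open>As q1 vanishes at the point, its square contributes nothing to the
    gradient.\<close>
  have gQ: "grad2 (disc_quadric q1 q0) (x0, y0) = (- 4) *\<^sub>R (u, v)"
    by (simp add: disc_quadric_def grad2_simps assms(9) q0P uv)
  have nt: "nontransversal_intersection (disc_torus R r) (disc_quadric q1 q0) (x0, y0) \<longleftrightarrow> x0 * v = y0 * u"
  proof (rule nontransversal_iff_parallel[OF assms(10) _ _ gQ cT _ xy])
    show "eval2 (disc_quadric q1 q0) (x0, y0) = 0"
      by (simp add: disc_quadric_def assms(9) q0P)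
    show "grad2 (disc_torus R r) (x0, y0) = (2 * (A\<^sup>2 - B\<^sup>2)) *\<^sub>R (x0, y0)"
      unfolding disc_torus_def by (rule gT)
  qed simp
  have gT3: "grad3 (torus_poly R r) ?P = (2 * (A\<^sup>2 - B\<^sup>2) * x0, 2 * (A\<^sup>2 - B\<^sup>2) * y0, 0)"
    by (simp add: grad3_torus gT)
  have gQ3: "grad3 (quadric_poly q1 q0) ?P = (u, v, 0)"
    by (simp add: grad3_quadric uv assms(9))
  show ?thesis unfolding nt
  proof
    assume sing: "singular_point ?C ?P"
    show "x0 * v = y0 * u"
    proof (rule ccontr)
      assume ne: "x0 * v \<noteq> y0 * u"
      have "\<not> ?P isolated_in ?C"
        unfolding curve_def
      proof (rule transversal_zeros_not_isolated[OF _ _ gT3 gQ3])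
        have "2 * (A\<^sup>2 - B\<^sup>2) * x0 * v - 2 * (A\<^sup>2 - B\<^sup>2) * y0 * u = 2 * (A\<^sup>2 - B\<^sup>2) * (x0 * v - y0 * u)"
          by Groebner_Basis.algebra
        then show "2 * (A\<^sup>2 - B\<^sup>2) * x0 * v - 2 * (A\<^sup>2 - B\<^sup>2) * y0 * u \<noteq> 0" using cT ne by simp
      qed (use PC in \<open>auto simp: curve_def zero_set3_def\<close>)
      then obtain G where G: "generates G (vanishing_ideal ?C)" "jacobian_rank G ?P \<le> 1"
        using sing by (auto simp: singular_point_def)
      have "jacobian_rank G ?P \<ge> 2"
      proof (rule rank_two_not_singular[OF PC _ _ _ _ G(1)])
        show "torus_poly R r \<in> vanishing_ideal ?C" "quadric_poly q1 q0 \<in> vanishing_ideal ?C"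
          by (auto simp: vanishing_ideal_def curve_def zero_set3_def)
        show "grad3 (quadric_poly q1 q0) ?P \<noteq> 0" using ne by (auto simp: gQ3 zero_prod_def)
        show "grad3 (torus_poly R r) ?P \<noteq> c *\<^sub>R grad3 (quadric_poly q1 q0) ?P" for c
        proof
          assume "grad3 (torus_poly R r) ?P = c *\<^sub>R grad3 (quadric_poly q1 q0) ?P"
          then have "2 * (A\<^sup>2 - B\<^sup>2) * x0 = c * u" "2 * (A\<^sup>2 - B\<^sup>2) * y0 = c * v"
            by (simp_all add: gT3 gQ3)
          then have "2 * (A\<^sup>2 - B\<^sup>2) * (x0 * v - y0 * u) = 0" by Groebner_Basis.algebra
          then show False using cT ne by simp
        qed
      qed
      then show False using G(2) by simp
    qed
  next
    assume par: "x0 * v = y0 * u"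
    show "singular_point ?C ?P"
    proof (cases "?P isolated_in ?C")
      case True
      then show ?thesis using PC by (simp add: singular_point_def)
    next
      case False
      then have lim: "?P islimpt ?C" using PC by (simp add: isolated_in_islimpt_iff)
      define k l where "k = x0 / A" and "l = y0 / A"
      have kl: "A * k = x0" "A * l = y0" using AB by (simp_all add: k_def l_def)
      have "A\<^sup>2 * (k\<^sup>2 + l\<^sup>2) = A\<^sup>2" using Axy by (simp add: kl[symmetric] power_mult_distrib algebra_simps)
      then have kl1: "k\<^sup>2 + l\<^sup>2 = 1" using AB by simp
      have "A * (k * v) = A * (l * u)" using par by (simp add: kl[symmetric] mult.assoc)
      then have tang: "k * v = l * u" using AB by simp
      have "grad3 F ?P \<in> span {(k, l, 0)}" if "F \<in> vanishing_ideal ?C" for F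
        using tangential_gradients_parallel[OF AB kl1, of e f i a b d g h j F]
          assms(3,4,5,7,9) q0P uv tang lim PC that by (simp add: kl)
      then have "\<exists>G. generates G (vanishing_ideal ?C) \<and> jacobian_rank G ?P \<le> 1"
        by (rule rank_one_if_gradients_parallel)
      then show ?thesis using PC unfolding singular_point_def by blast
    qed
  qed
qed

end
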